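(* Let $1\le p<\infty$, and let $(\Omega,\mathcal A,\mu)$, $\mu=\mu'+\mu''$, the band $M$ in $L_p(\mu)$ with disjoint complement $M^\perp$, the positive $C_0$-semigroup $T=T'\oplus T''$ on $L_p(\mu)=M\oplus M^\perp$, and the function $V\colon\Omega\to[0,\infty)$ be as constructed in the context. Then the absorption semigroup $T_V$ is given by $$T_V(t)f=\mathrm e^{-tV}f\qquad(t\ge0)$$ for $f\in M$, and by $$T_V(t)f=0\qquad(t>0)$$ for $f\in M^\perp$. As a consequence, $$P:=\operatorname*{s-lim}_{t\to0+}T_V(t)$$ is the band projection onto $M$.
   Context: Construction of the measure space. Let $\mathfrak c$ denote the cardinality of the continuum, let $\Gamma$ be a set of cardinality greater than $\mathfrak c$, and let $\Omega:=(0,1)\times\Gamma$. Let $\lambda$ be Lebesgue measure on $(0,1)$. On $\Gamma$ use the $\sigma$-algebra of countable and co-countable subsets and the measure $\nu$ with $\nu(G):=0$ if $G\subseteq\Gamma$ is countable and $\nu(G):=1$ if $G\subseteq\Gamma$ is co-countable. For $A\subseteq\Omega$, $x\in(0,1)$, $\gamma\in\Gamma$ put $A_x:=\{\gamma\in\Gamma : (x,\gamma)\in A\}$ and $A^\gamma:=\{x\in(0,1) : (x,\gamma)\in A\}$. Let $\mathcal A$ be the $\sigma$-algebra of all $A\subseteq\Omega$ such that $A_x$ is countable or co-countable for every $x\in(0,1)$ and $A^\gamma$ is a Borel set in $(0,1)$ for every $\gamma\in\Gamma$. For $A\in\mathcal A$ define $$\mu'(A):=\sum_{x\in(0,1)}\nu(A_x),\qquad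 \mu''(A):=\sum_{\gamma\in\Gamma}\lambda(A^\gamma),\qquad \mu:=\mu'+\mu''.$$ These are measures on $\mathcal A$. The bands. $L_p(\mu)$ consists of (equivalence classes of) real-valued functions. Put $M:=\{f\in L_p(\mu) : f=0\ \mu''\text{-a.e.}\}$. This is a band in $L_p(\mu)$ (a lattice ideal stable under all suprema of its subsets that exist in $L_p(\mu)$); its disjoint complement $M^\perp:=\{f\in L_p(\mu) : |f|\wedge|g|=0\text{ for all }g\in M\}$ equals $\{f\in L_p(\mu) : f=0\ \mu'\text{-a.e.}\}$, and $L_p(\mu)=M\oplus M^\perp$. The band projection onto $M$ is the projection of $L_p(\mu)$ onto $M$ along $M^\perp$. One identifies $M=L_p(\mu')\cong\ell_p(0,1)$ (the space $\ell_p$ with index set $(0,1)$) and $M^\perp=L_p(\mu'')\cong\ell_p(\Gamma;L_p(0,1))$, the latter via $f\mapsto(f(\cdot,\gamma))_{\gamma\in\Gamma}$. The semigroup $T$. On $M$ let $T'(t)$ be the identity operator for all $t\ge0$. On $M^\perp=\ell_p(\Gamma;L_p(0,1))$ let $T''$ be right translation on all fibers: $$T''(t)f(x,\gamma)=f(x-t,\gamma)\qquad(t\ge0,\ (x,\gamma)\in\Omega),$$ for $f\in M^\perp$, where $f(x-t,\gamma):=0$ if $x-t\le0$. Then $T:=T'\oplus T''$ is a positive $C_0$-semigroup on $L_p(\mu)=M\oplus M^\perp$. The absorption rate $V$. Let $W\colon(0,1)\to[0,\infty)$ be a Borel-measurable function such that $W\notin L_1(U)$ for every open set $\varnothing\ne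 U\subseteq(0,1)$, and put $V(x,\gamma):=W(x)$ for $(x,\gamma)\in\Omega$. The absorption semigroup. For a positive $C_0$-semigroup $T$ on $L_p(\mu)$ with generator $A$ and a locally measurable $V\colon\Omega\to[0,\infty]$ (locally measurable: the restriction of $V$ to each set of $\mathcal A$ of finite $\mu$-measure is measurable), define $$T_V(t):=\operatorname*{s-lim}_{n\to\infty}\mathrm e^{t(A-V\wedge n)}\qquad(t\ge0),$$ where $V\wedge n$ denotes the bounded multiplication operator by $\min(V,n)$, $(\mathrm e^{t(A-V\wedge n)})_{t\ge0}$ is the $C_0$-semigroup generated by $A-V\wedge n$, and $\operatorname{s-lim}$ denotes the limit in the strong operator topology. (The limit exists by monotone convergence.) *)

theory Defs
  imports "HOL-Analysis.Analysis" "HOL-Library.Equipollence"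
begin

section \<open>The measure space\<close>

text \<open>The set \<open>\<Gamma>\<close> is the universe of a type \<open>'g\<close>; that it is larger than the continuum is an
  assumption of the theorem, not of the construction.\<close>

definition Omega :: "(real \<times> 'g) set" where
  "Omega = {0<..<1} \<times> UNIV"

definition xsec :: "(real \<times> 'g) set \<Rightarrow> real \<Rightarrow> 'g set" where
  "xsec A x = {\<gamma>. (x, \<gamma>) \<in> A}"

definition gsec :: "(real \<times> 'g) set \<Rightarrow> 'g \<Rightarrow> real set" where
  "gsec A \<gamma> = {x. (x, \<gamma>) \<in> A}"

definition Asets :: "(real \<times> 'g) set set" where
  "Asets = {A. A \<subseteq> Omega \<and>
     (\<forall>x\<in>{0<..<1}. countable (xsec A x) \<or> countable (- xsec A x)) \<and>
     (\<forall>\<gamma>. gsec A \<gamma> \<in> sets borel)}"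

text \<open>Only the values on countable and co-countable sets matter.\<close>

definition nu :: "'g set \<Rightarrow> ennreal" where
  "nu G = (if countable G then 0 else 1)"

definition val1 :: "(real \<times> 'g) set \<Rightarrow> ennreal" where
  "val1 A = (\<Sum>\<^sub>\<infinity>x\<in>{0<..<1}. nu (xsec A x))"

definition val2 :: "(real \<times> 'g) set \<Rightarrow> ennreal" where
  "val2 A = (\<Sum>\<^sub>\<infinity>\<gamma>\<in>UNIV. emeasure lborel (gsec A \<gamma>))"

definition mu1 :: "(real \<times> 'g) measure" where
  "mu1 = measure_of Omega Asets val1"

definition mu2 :: "(real \<times> 'g) measure" where
  "mu2 = measure_of Omega Asets val2"

definition mu :: "(real \<times> 'g) measure" where
  "mu = measure_of Omega Asets (\<lambda>A. val1 A + val2 A)"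

lemma xsec_Diff_Omega: "x \<in> {0<..<1} \<Longrightarrow> xsec (Omega - A) x = - xsec A x"
  by (auto simp: xsec_def Omega_def)

lemma gsec_Diff_Omega: "gsec (Omega - A) \<gamma> = {0<..<1} - gsec A \<gamma>"
  by (auto simp: gsec_def Omega_def)

lemma xsec_UN: "xsec (\<Union>(A ` I)) x = (\<Union>i\<in>I. xsec (A i) x)"
  by (auto simp: xsec_def)

lemma gsec_UN: "gsec (\<Union>(A ` I)) x = (\<Union>i\<in>I. gsec (A i) x)"
  by (auto simp: gsec_def)

lemma sigma_algebra_Asets: "sigma_algebra Omega (Asets :: (real \<times> 'g) set set)"
  unfolding sigma_algebra_iff2
proof (intro conjI ballI allI impI)
  show "Asets \<subseteq> Pow (Omega :: (real \<times> 'g) set)" by (auto simp: Asets_def)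
  show "{} \<in> (Asets :: (real \<times> 'g) set set)" by (auto simp: Asets_def xsec_def gsec_def)
  fix A :: "(real \<times> 'g) set" assume "A \<in> Asets"
  then show "Omega - A \<in> Asets"
    by (auto simp: Asets_def xsec_Diff_Omega gsec_Diff_Omega)
next
  fix A :: "nat \<Rightarrow> (real \<times> 'g) set" assume A: "range A \<subseteq> Asets"
  show "(\<Union>i. A i) \<in> Asets"
    unfolding Asets_def
  proof (intro CollectI conjI ballI allI)
    show "(\<Union>i. A i) \<subseteq> Omega" using A by (auto simp: Asets_def)
    show "gsec (\<Union>i. A i) \<gamma> \<in> sets borel" for \<gamma>
      unfolding gsec_UN using A by (intro sets.countable_UN) (auto simp: Asets_def)
    fix x :: real assume x: "x \<in> {0<..<1}"
    show "countable (xsec (\<Union>i. A i) x) \<or> countable (- xsec (\<Union>i. A i) x)"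
    proof (cases "\<forall>i. countable (xsec (A i) x)")
      case True
      then show ?thesis by (simp add: xsec_UN)
    next
      case False
      then obtain i where "uncountable (xsec (A i) x)" by auto
      moreover have "A i \<in> Asets" using A by auto
      ultimately have "countable (- xsec (A i) x)" using x by (auto simp: Asets_def)
      moreover have "- xsec (\<Union>i. A i) x \<subseteq> - xsec (A i) x" by (auto simp: xsec_UN)
      ultimately show ?thesis using countable_subset by blast
    qed
  qed
qed

interpretation Asets: sigma_algebra Omega "Asets :: (real \<times> 'g) set set"
  by (rule sigma_algebra_Asets)

lemma space_mus [simp]: "space mu = Omega" "space mu1 = Omega" "space mu2 = Omega"
  by (simp_all add: mu_def mu1_def mu2_def Asets.space_measure_of_eq)

lemma sets_mus [simp]: "sets mu = Asets" "sets mu1 = Asets" "sets mu2 = Asets"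
  by (simp_all add: mu_def mu1_def mu2_def Asets.sets_measure_of_eq)

lemma suminf_infsum_ennreal:
  fixes f :: "nat \<Rightarrow> 'b \<Rightarrow> ennreal"
  shows "(\<Sum>i. \<Sum>\<^sub>\<infinity>x\<in>X. f i x) = (\<Sum>\<^sub>\<infinity>x\<in>X. \<Sum>i. f i x)"
proof -
  have fin: "(\<Sum>i<n. \<Sum>\<^sub>\<infinity>x\<in>X. f i x) = (\<Sum>\<^sub>\<infinity>x\<in>X. \<Sum>i<n. f i x)" for n
    by (induction n) (simp_all add: infsum_add nonneg_summable_on_complete)
  have SUP: "(\<Sum>\<^sub>\<infinity>x\<in>X. g x) = (SUP F\<in>{F. finite F \<and> F \<subseteq> X}. sum g F)" for g :: "'b \<Rightarrow> ennreal"
    by (rule nonneg_infsum_complete) simp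
  have "(\<Sum>i. \<Sum>\<^sub>\<infinity>x\<in>X. f i x) = (SUP n. SUP F\<in>{F. finite F \<and> F \<subseteq> X}. \<Sum>x\<in>F. \<Sum>i<n. f i x)"
    unfolding suminf_eq_SUP fin unfolding SUP ..
  also have "\<dots> = (SUP F\<in>{F. finite F \<and> F \<subseteq> X}. SUP n. \<Sum>i<n. \<Sum>x\<in>F. f i x)"
    by (subst SUP_commute, subst sum.swap) (rule refl)
  also have "\<dots> = (SUP F\<in>{F. finite F \<and> F \<subseteq> X}. \<Sum>x\<in>F. \<Sum>i. f i x)"
    unfolding suminf_eq_SUP[symmetric] by (subst suminf_sum) simp_all
  finally show ?thesis unfolding SUP .
qed

lemma nu_UN:
  fixes G :: "nat \<Rightarrow> 'g set"
  assumes G: "\<And>i. countable (G i) \<or> countable (- G i)" and disj: "disjoint_family G"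
  shows "nu (\<Union>i. G i) = (\<Sum>i. nu (G i))"
proof (cases "\<forall>i. countable (G i)")
  case True
  then show ?thesis by (simp add: nu_def)
next
  case False
  then obtain j where j: "uncountable (G j)" "countable (- G j)" using G by auto
  have "countable (G i)" if "i \<noteq> j" for i
    using that disj by (intro countable_subset[OF _ j(2)]) (auto simp: disjoint_family_on_def)
  then have "(\<Sum>i. nu (G i)) = (\<Sum>i\<in>{j}. nu (G i))"
    by (intro suminf_finite) (auto simp: nu_def)
  moreover have "uncountable (\<Union>i. G i)" using j(1) by (meson UNIV_I UN_upper countable_subset)
  ultimately show ?thesis using j by (simp add: nu_def)
qed

lemma countably_additive_val1: "countably_additive Asets (val1 :: (real \<times> 'g) set \<Rightarrow> _)"
proof (rule countably_additiveI)
  fix A :: "nat \<Rightarrow> (real \<times> 'g) set" assume A: "range A \<subseteq> Asets" "disjoint_family A"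
  have "nu (xsec (\<Union>i. A i) x) = (\<Sum>i. nu (xsec (A i) x))" if "x \<in> {0<..<1}" for x
    unfolding xsec_UN
  proof (rule nu_UN)
    show "countable (xsec (A i) x) \<or> countable (- xsec (A i) x)" for i
      using that A(1) by (auto simp: Asets_def image_subset_iff)
    show "disjoint_family (\<lambda>i. xsec (A i) x)"
      using A(2) by (auto simp: disjoint_family_on_def xsec_def)
  qed
  then show "(\<Sum>i. val1 (A i)) = val1 (\<Union>i. A i)"
    unfolding val1_def suminf_infsum_ennreal by (intro infsum_cong) simp
qed

lemma countably_additive_val2: "countably_additive Asets (val2 :: (real \<times> 'g) set \<Rightarrow> _)"
proof (rule countably_additiveI)
  fix A :: "nat \<Rightarrow> (real \<times> 'g) set" assume A: "range A \<subseteq> Asets" "disjoint_family A"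
  have "emeasure lborel (gsec (\<Union>i. A i) \<gamma>) = (\<Sum>i. emeasure lborel (gsec (A i) \<gamma>))" for \<gamma>
    unfolding gsec_UN
  proof (rule suminf_emeasure[symmetric])
    show "range (\<lambda>i. gsec (A i) \<gamma>) \<subseteq> sets lborel"
      using A(1) by (auto simp: Asets_def image_subset_iff)
    show "disjoint_family (\<lambda>i. gsec (A i) \<gamma>)"
      using A(2) unfolding disjoint_family_on_def gsec_def by blast
  qed
  then show "(\<Sum>i. val2 (A i)) = val2 (\<Union>i. A i)"
    by (simp add: val2_def suminf_infsum_ennreal)
qed

lemma val_empty [simp]: "val1 {} = 0" "val2 {} = 0"
  by (simp_all add: val1_def val2_def nu_def xsec_def gsec_def)

lemma emeasure_mu1: "A \<in> Asets \<Longrightarrow> emeasure mu1 A = val1 A"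
  unfolding mu1_def
  by (rule emeasure_measure_of_sigma)
    (auto simp: sigma_algebra_Asets positive_def countably_additive_val1)

lemma emeasure_mu2: "A \<in> Asets \<Longrightarrow> emeasure mu2 A = val2 A"
  unfolding mu2_def
  by (rule emeasure_measure_of_sigma)
    (auto simp: sigma_algebra_Asets positive_def countably_additive_val2)

lemma emeasure_mu: "A \<in> Asets \<Longrightarrow> emeasure mu A = emeasure mu1 A + emeasure mu2 A"
proof -
  have "countably_additive Asets (\<lambda>A :: (real \<times> 'g) set. val1 A + val2 A)"
  proof (rule countably_additiveI)
    fix A :: "nat \<Rightarrow> (real \<times> 'g) set"
    assume A: "range A \<subseteq> Asets" "disjoint_family A" "(\<Union>i. A i) \<in> Asets"
    have "(\<Sum>i. val1 (A i) + val2 (A i)) = (\<Sum>i. val1 (A i)) + (\<Sum>i. val2 (A i))"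
      by (simp add: suminf_add[OF summableI summableI, symmetric])
    also have "(\<Sum>i. val1 (A i)) = val1 (\<Union>i. A i)"
      using countably_additive_val1 A unfolding countably_additive_def by blast
    also have "(\<Sum>i. val2 (A i)) = val2 (\<Union>i. A i)"
      using countably_additive_val2 A unfolding countably_additive_def by blast
    finally show "(\<Sum>i. val1 (A i) + val2 (A i)) = val1 (\<Union>i. A i) + val2 (\<Union>i. A i)" .
  qed
  then have "emeasure mu A = val1 A + val2 A" if "A \<in> Asets" for A :: "(real \<times> 'g) set"
    unfolding mu_def using that
    by (intro emeasure_measure_of_sigma) (auto simp: sigma_algebra_Asets positive_def)
  then show "A \<in> Asets \<Longrightarrow> emeasure mu A = emeasure mu1 A + emeasure mu2 A"
    by (simp add: emeasure_mu1 emeasure_mu2)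
qed

lemma infsum_eq_0_iff_ennreal:
  fixes f :: "'b \<Rightarrow> ennreal"
  shows "(\<Sum>\<^sub>\<infinity>x\<in>X. f x) = 0 \<longleftrightarrow> (\<forall>x\<in>X. f x = 0)"
proof
  assume *: "(\<Sum>\<^sub>\<infinity>x\<in>X. f x) = 0"
  show "\<forall>x\<in>X. f x = 0"
  proof
    fix x assume "x \<in> X"
    then have "sum f {x} \<le> (\<Sum>\<^sub>\<infinity>x\<in>X. f x)"
      by (subst nonneg_infsum_complete) (simp, intro SUP_upper, auto)
    with * show "f x = 0" by simp
  qed
qed (simp cong: infsum_cong)

lemma null_sets_mu_iff:
  "A \<in> null_sets mu \<longleftrightarrow> A \<in> Asets \<and> (\<forall>x\<in>{0<..<1}. countable (xsec A x)) \<and>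
     (\<forall>\<gamma>. emeasure lborel (gsec A \<gamma>) = 0)"
  by (auto simp: null_sets_def emeasure_mu emeasure_mu1 emeasure_mu2 val1_def val2_def
      infsum_eq_0_iff_ennreal nu_def split: if_splits)


section \<open>Equivalence classes of measurable functions\<close>

definition ae_eq :: "(real \<times> 'g \<Rightarrow> real) \<Rightarrow> (real \<times> 'g \<Rightarrow> real) \<Rightarrow> bool" where
  "ae_eq f g \<longleftrightarrow> f \<in> borel_measurable mu \<and> g \<in> borel_measurable mu \<and> (AE \<omega> in mu. f \<omega> = g \<omega>)"

text \<open>The space \<open>L_0(\<mu>)\<close>; the class of a measurable function \<open>f\<close> is \<open>cls f\<close>.\<close>

quotient_type 'g L0 = "real \<times> 'g \<Rightarrow> real" / partial: ae_eq
  morphisms rep_L0 cls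
proof (rule part_equivpI)
  show "\<exists>f. ae_eq f f" by (rule exI[of _ "\<lambda>_. 0"]) (simp add: ae_eq_def)
  show "symp ae_eq" by (auto simp: symp_def ae_eq_def)
  show "transp ae_eq" by (auto simp: transp_def ae_eq_def elim!: eventually_elim2)
qed

instantiation L0 :: (type) "{real_vector, comm_ring}"
begin

lift_definition zero_L0 :: "'a L0" is "\<lambda>_. 0" by (simp add: ae_eq_def)

lift_definition plus_L0 :: "'a L0 \<Rightarrow> 'a L0 \<Rightarrow> 'a L0" is "\<lambda>f g \<omega>. f \<omega> + g \<omega>"
  by (auto simp: ae_eq_def elim!: eventually_elim2)

lift_definition minus_L0 :: "'a L0 \<Rightarrow> 'a L0 \<Rightarrow> 'a L0" is "\<lambda>f g \<omega>. f \<omega> - g \<omega>"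
  by (auto simp: ae_eq_def elim!: eventually_elim2)

lift_definition uminus_L0 :: "'a L0 \<Rightarrow> 'a L0" is "\<lambda>f \<omega>. - f \<omega>"
  by (auto simp: ae_eq_def)

lift_definition times_L0 :: "'a L0 \<Rightarrow> 'a L0 \<Rightarrow> 'a L0" is "\<lambda>f g \<omega>. f \<omega> * g \<omega>"
  by (auto simp: ae_eq_def elim!: eventually_elim2)

lift_definition scaleR_L0 :: "real \<Rightarrow> 'a L0 \<Rightarrow> 'a L0" is "\<lambda>c f \<omega>. c * f \<omega>"
  by (auto simp: ae_eq_def elim!: eventually_mono)

instance
  by standard (transfer; auto simp: ae_eq_def algebra_simps)+

end

instantiation L0 :: (type) lattice
begin

lift_definition less_eq_L0 :: "'a L0 \<Rightarrow> 'a L0 \<Rightarrow> bool" is "\<lambda>f g. AE \<omega> in mu. f \<omega> \<le> g \<omega>"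
  unfolding ae_eq_def by (elim conjE, rule eventually_subst, erule (1) eventually_elim2, simp)

definition less_L0 :: "'a L0 \<Rightarrow> 'a L0 \<Rightarrow> bool" where
  "less_L0 F G \<longleftrightarrow> F \<le> G \<and> \<not> G \<le> F"

lift_definition inf_L0 :: "'a L0 \<Rightarrow> 'a L0 \<Rightarrow> 'a L0" is "\<lambda>f g \<omega>. min (f \<omega>) (g \<omega>)"
  by (auto simp: ae_eq_def elim!: eventually_elim2)

lift_definition sup_L0 :: "'a L0 \<Rightarrow> 'a L0 \<Rightarrow> 'a L0" is "\<lambda>f g \<omega>. max (f \<omega>) (g \<omega>)"
  by (auto simp: ae_eq_def elim!: eventually_elim2)

instance
proof
  fix x y z :: "'a L0"
  show "x < y \<longleftrightarrow> x \<le> y \<and> \<not> y \<le> x" by (rule less_L0_def)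
  show "x \<le> x" by transfer simp
  show "x \<le> y \<Longrightarrow> y \<le> z \<Longrightarrow> x \<le> z" by transfer (auto elim!: eventually_elim2)
  show "x \<le> y \<Longrightarrow> y \<le> x \<Longrightarrow> x = y" by transfer (auto simp: ae_eq_def elim!: eventually_elim2)
  show "inf x y \<le> x" "inf x y \<le> y" "x \<le> sup x y" "y \<le> sup x y" by (transfer; simp)+
  show "x \<le> y \<Longrightarrow> x \<le> z \<Longrightarrow> x \<le> inf y z" by transfer (auto elim!: eventually_elim2)
  show "y \<le> x \<Longrightarrow> z \<le> x \<Longrightarrow> sup y z \<le> x" by transfer (auto elim!: eventually_elim2)
qed

end

instantiation L0 :: (type) abs
begin

lift_definition abs_L0 :: "'a L0 \<Rightarrow> 'a L0" is "\<lambda>f \<omega>. \<bar>f \<omega>\<bar>"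
  by (auto simp: ae_eq_def)

instance ..

end

lift_definition p_integrable :: "real \<Rightarrow> 'g L0 \<Rightarrow> bool" is
  "\<lambda>p f. integrable mu (\<lambda>\<omega>. \<bar>f \<omega>\<bar> powr p)"
  unfolding ae_eq_def by (rule integrable_cong_AE) (auto elim!: eventually_mono)

lift_definition Lp_norm :: "real \<Rightarrow> 'g L0 \<Rightarrow> real" is
  "\<lambda>p f. (LINT \<omega>|mu. \<bar>f \<omega>\<bar> powr p) powr (1 / p)"
  unfolding ae_eq_def
  by (rule arg_cong[where f = "\<lambda>c. c powr _"], rule integral_cong_AE) (auto elim!: eventually_mono)

definition Lp :: "real \<Rightarrow> 'g L0 set" where
  "Lp p = {f. p_integrable p f}"


section \<open>The bands\<close>

lemma AE_mu2: "AE \<omega> in mu. P \<omega> \<Longrightarrow> AE \<omega> in mu2. P \<omega>"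
  by (rule absolutely_continuous_AE[of mu2 mu])
    (auto simp: absolutely_continuous_def null_sets_def emeasure_mu)

lift_definition zero_AE_mu2 :: "'g L0 \<Rightarrow> bool" is "\<lambda>f. AE \<omega> in mu2. f \<omega> = 0"
  unfolding ae_eq_def
  by (elim conjE, rule eventually_subst, drule AE_mu2, erule eventually_mono, simp)

definition bandM :: "real \<Rightarrow> 'g L0 set" where
  "bandM p = {f \<in> Lp p. zero_AE_mu2 f}"

definition disj_compl :: "'g L0 set \<Rightarrow> 'g L0 set \<Rightarrow> 'g L0 set" where
  "disj_compl X B = {f \<in> X. \<forall>g\<in>B. inf \<bar>f\<bar> \<bar>g\<bar> = 0}"

text \<open>The projection of \<open>X = B \<oplus> B\<^sup>\<bottom>\<close> onto \<open>B\<close> along \<open>B\<^sup>\<bottom>\<close>.\<close>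

definition band_proj :: "'g L0 set \<Rightarrow> 'g L0 set \<Rightarrow> 'g L0 \<Rightarrow> 'g L0" where
  "band_proj X B f = (THE g. g \<in> B \<and> f - g \<in> disj_compl X B)"


section \<open>Operator semigroups\<close>

text \<open>Throughout, \<open>X\<close> is a linear subspace of a real vector space and \<open>N\<close> a norm on \<open>X\<close>;
  only the values of operators on \<open>X\<close>, at times \<open>t \<ge> 0\<close>, are meaningful.\<close>

definition bounded_op :: "'a::real_vector set \<Rightarrow> ('a \<Rightarrow> real) \<Rightarrow> ('a \<Rightarrow> 'a) \<Rightarrow> bool" where
  "bounded_op X N B \<longleftrightarrow>
     (\<forall>f\<in>X. B f \<in> X) \<and>
     (\<forall>f\<in>X. \<forall>g\<in>X. B (f + g) = B f + B g) \<and>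
     (\<forall>c. \<forall>f\<in>X. B (c *\<^sub>R f) = c *\<^sub>R B f) \<and>
     (\<exists>C. \<forall>f\<in>X. N (B f) \<le> C * N f)"

definition strong_limit ::
    "'a::real_vector set \<Rightarrow> ('a \<Rightarrow> real) \<Rightarrow> ('i \<Rightarrow> 'a \<Rightarrow> 'a) \<Rightarrow> 'i filter \<Rightarrow> ('a \<Rightarrow> 'a) \<Rightarrow> bool" where
  "strong_limit X N S F P \<longleftrightarrow>
     bounded_op X N P \<and> (\<forall>f\<in>X. ((\<lambda>i. N (S i f - P f)) \<longlongrightarrow> 0) F)"

definition C0_semigroup :: "'a::real_vector set \<Rightarrow> ('a \<Rightarrow> real) \<Rightarrow> (real \<Rightarrow> 'a \<Rightarrow> 'a) \<Rightarrow> bool" where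
  "C0_semigroup X N S \<longleftrightarrow>
     (\<forall>t\<ge>0. bounded_op X N (S t)) \<and>
     (\<forall>f\<in>X. S 0 f = f) \<and>
     (\<forall>s\<ge>0. \<forall>t\<ge>0. \<forall>f\<in>X. S (s + t) f = S s (S t f)) \<and>
     (\<forall>f\<in>X. ((\<lambda>t. N (S t f - f)) \<longlongrightarrow> 0) (at_right 0))"

text \<open>Unbounded operators are represented by their graphs.\<close>

definition generator ::
    "'a::real_vector set \<Rightarrow> ('a \<Rightarrow> real) \<Rightarrow> (real \<Rightarrow> 'a \<Rightarrow> 'a) \<Rightarrow> ('a \<times> 'a) set" where
  "generator X N S = {(f, g). f \<in> X \<and> g \<in> X \<and>
     ((\<lambda>h. N ((1 / h) *\<^sub>R (S h f - f) - g)) \<longlongrightarrow> 0) (at_right 0)}"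

text \<open>A \<open>C\<^sub>0\<close>-semigroup is determined, on \<open>X\<close> and for \<open>t \<ge> 0\<close>, by its generator.\<close>

definition semigroup_generated_by ::
    "'a::real_vector set \<Rightarrow> ('a \<Rightarrow> real) \<Rightarrow> ('a \<times> 'a) set \<Rightarrow> real \<Rightarrow> 'a \<Rightarrow> 'a" where
  "semigroup_generated_by X N A = (SOME S. C0_semigroup X N S \<and> generator X N S = A)"


section \<open>The absorption semigroup\<close>

definition mult_op :: "(real \<times> 'g \<Rightarrow> real) \<Rightarrow> 'g L0 \<Rightarrow> 'g L0" where
  "mult_op h f = cls h * f"

definition perturbed_semigroup ::
    "real \<Rightarrow> (real \<Rightarrow> 'g L0 \<Rightarrow> 'g L0) \<Rightarrow> (real \<times> 'g \<Rightarrow> real) \<Rightarrow> nat \<Rightarrow> real \<Rightarrow> 'g L0 \<Rightarrow> 'g L0" where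
  "perturbed_semigroup p T V n = semigroup_generated_by (Lp p) (Lp_norm p)
     {(f, g - mult_op (\<lambda>\<omega>. min (V \<omega>) (real n)) f) | f g. (f, g) \<in> generator (Lp p) (Lp_norm p) T}"

text \<open>Here \<open>V\<close> has to be measurable with values in \<open>[0, \<infinity>)\<close> on \<open>Omega\<close>.\<close>

definition absorption_semigroup ::
    "real \<Rightarrow> (real \<Rightarrow> 'g L0 \<Rightarrow> 'g L0) \<Rightarrow> (real \<times> 'g \<Rightarrow> real) \<Rightarrow> real \<Rightarrow> 'g L0 \<Rightarrow> 'g L0" where
  "absorption_semigroup p T V t = (SOME P.
     strong_limit (Lp p) (Lp_norm p) (\<lambda>n. perturbed_semigroup p T V n t) sequentially P)"


section \<open>The semigroup \<open>T\<close>\<close>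

text \<open>For \<open>t \<ge> 0\<close> and \<open>x \<in> (0, 1)\<close>, the condition \<open>x - t \<in> (0, 1)\<close> just says \<open>x - t > 0\<close>.\<close>

definition shift_fun :: "real \<Rightarrow> (real \<times> 'g \<Rightarrow> real) \<Rightarrow> real \<times> 'g \<Rightarrow> real" where
  "shift_fun t f = (\<lambda>(x, \<gamma>). if x - t \<in> {0<..<1} then f (x - t, \<gamma>) else 0)"

definition shift_set :: "real \<Rightarrow> (real \<times> 'g) set \<Rightarrow> (real \<times> 'g) set" where
  "shift_set t A = {(x, \<gamma>). x \<in> {0<..<1} \<and> (x - t, \<gamma>) \<in> A}"

lemma xsec_shift_set:
  "x \<in> {0<..<1} \<Longrightarrow> xsec (shift_set t A) x = xsec A (x - t)"
  by (auto simp: xsec_def shift_set_def)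

lemma gsec_shift_set:
  "gsec (shift_set t A) \<gamma> = {0<..<1} \<inter> ((\<lambda>x. x - t) -` gsec A \<gamma>)"
  by (auto simp: gsec_def shift_set_def)

lemma shift_set_Asets:
  assumes "A \<in> Asets"
  shows "shift_set t A \<in> Asets"
  unfolding Asets_def
proof (intro CollectI conjI ballI allI)
  show "shift_set t A \<subseteq> Omega" by (auto simp: shift_set_def Omega_def)
  fix x :: real assume x: "x \<in> {0<..<1}"
  show "countable (xsec (shift_set t A) x) \<or> countable (- xsec (shift_set t A) x)"
  proof (cases "x - t \<in> {0<..<1}")
    case True
    with assms x show ?thesis by (auto simp: xsec_shift_set Asets_def)
  next
    case False
    with assms have "xsec A (x - t) = {}" by (auto simp: Asets_def Omega_def xsec_def)
    with x show ?thesis by (simp add: xsec_shift_set)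
  qed
next
  fix \<gamma>
  have "(\<lambda>x. x - t) -` gsec A \<gamma> \<in> sets borel"
    using assms measurable_sets[of "\<lambda>x. x - t" borel borel "gsec A \<gamma>"] by (simp add: Asets_def)
  then show "gsec (shift_set t A) \<gamma> \<in> sets borel"
    unfolding gsec_shift_set by (intro sets.Int) auto
qed

lemma shift_set_null_sets:
  assumes "A \<in> null_sets mu"
  shows "shift_set t A \<in> null_sets mu"
  unfolding null_sets_mu_iff
proof (intro conjI ballI allI)
  have A: "A \<in> Asets" "\<And>\<gamma>. gsec A \<gamma> \<in> sets borel" "\<And>\<gamma>. emeasure lborel (gsec A \<gamma>) = 0"
    "\<And>x. x \<in> {0<..<1} \<Longrightarrow> countable (xsec A x)" "A \<subseteq> Omega"
    using assms by (auto simp: null_sets_mu_iff Asets_def)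
  then show "shift_set t A \<in> Asets" by (simp add: shift_set_Asets)
  show "countable (xsec (shift_set t A) x)" if x: "x \<in> {0<..<1}" for x
  proof (cases "x - t \<in> {0<..<1}")
    case True
    with A x show ?thesis by (simp add: xsec_shift_set)
  next
    case False
    with A have "xsec A (x - t) = {}" by (auto simp: Omega_def xsec_def)
    with x show ?thesis by (simp add: xsec_shift_set)
  qed
  fix \<gamma>
  have "(\<lambda>x. x - t) -` gsec A \<gamma> \<in> sets borel"
    using A measurable_sets[of "\<lambda>x. x - t" borel borel "gsec A \<gamma>"] by simp
  moreover have "emeasure lborel ((\<lambda>x. x - t) -` gsec A \<gamma>) = 0"
  proof -
    have "emeasure lborel (gsec A \<gamma>) = emeasure (distr lborel borel ((+) (- t))) (gsec A \<gamma>)"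
      by (simp add: lborel_distr_plus)
    also have "\<dots> = emeasure lborel ((+) (- t) -` gsec A \<gamma>)"
      using A by (subst emeasure_distr) auto
    also have "(+) (- t) = (\<lambda>x. x - t)" by auto
    finally show ?thesis using A by simp
  qed
  ultimately show "emeasure lborel (gsec (shift_set t A) \<gamma>) = 0"
    unfolding gsec_shift_set
    by (metis Int_lower2 emeasure_mono le_zero_eq sets_lborel)
qed

lemma shift_fun_measurable:
  assumes "f \<in> borel_measurable mu"
  shows "shift_fun t f \<in> borel_measurable mu"
proof (rule measurableI)
  fix B :: "real set" assume B: "B \<in> sets borel"
  let ?D = "shift_set t Omega"
  have D: "?D \<in> Asets" by (intro shift_set_Asets Asets.top)
  have "f -` B \<inter> Omega \<in> Asets" using measurable_sets[OF assms B] by simp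
  then have "shift_set t (f -` B \<inter> Omega) \<in> Asets" by (rule shift_set_Asets)
  moreover have "(if 0 \<in> B then Omega - ?D else {}) \<in> Asets" using D by auto
  moreover have "shift_fun t f -` B \<inter> Omega =
      shift_set t (f -` B \<inter> Omega) \<union> (if 0 \<in> B then Omega - ?D else {})"
    by (auto simp: shift_fun_def shift_set_def Omega_def split: if_splits)
  ultimately show "shift_fun t f -` B \<inter> space mu \<in> sets mu" by auto
qed simp

lift_definition shift :: "real \<Rightarrow> 'g L0 \<Rightarrow> 'g L0" is shift_fun
proof -
  fix t and f g :: "real \<times> 'g \<Rightarrow> real" assume *: "ae_eq f g"
  then obtain A where A: "A \<in> null_sets mu" "{\<omega> \<in> space mu. f \<omega> \<noteq> g \<omega>} \<subseteq> A"
    by (auto simp: ae_eq_def eventually_ae_filter)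
  have "{\<omega> \<in> space mu. shift_fun t f \<omega> \<noteq> shift_fun t g \<omega>} \<subseteq> shift_set t A"
    using A(2) by (auto simp: shift_fun_def shift_set_def Omega_def split: if_splits)
  then have "AE \<omega> in mu. shift_fun t f \<omega> = shift_fun t g \<omega>"
    using shift_set_null_sets[OF A(1)] unfolding eventually_ae_filter by blast
  with * show "ae_eq (shift_fun t f) (shift_fun t g)"
    by (simp add: ae_eq_def shift_fun_measurable)
qed

text \<open>\<open>T = T' \<oplus> T''\<close>: the identity on \<open>M\<close>, the translation on \<open>M\<^sup>\<bottom>\<close>.\<close>

definition T_sg :: "real \<Rightarrow> real \<Rightarrow> 'g L0 \<Rightarrow> 'g L0" where
  "T_sg p t f = band_proj (Lp p) (bandM p) f + shift t (f - band_proj (Lp p) (bandM p) f)"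

end

theory Submission
  imports Defs
begin

text \<open>A vector that starts in \<open>M\<close> stays where it is, and one that starts in \<open>M\<^sup>\<bottom>\<close> is moved along its
fibre. A bounded potential \<open>w = min(W, n)\<close> changes this only by a damping factor: it is \<open>exp(-t w(x))\<close>
for a particle that rests at \<open>x\<close>, and \<open>exp(-\<integral> w)\<close>, with the integral over \<open>(x - t, x)\<close>, for a particle
that moves from \<open>x - t\<close> to \<open>x\<close>. As \<open>n \<rightarrow> \<infinity>\<close>, the first factor tends to \<open>exp(-t W(x))\<close>, but the second
one tends to 0, because \<open>W\<close> is not integrable over any interval. Dominated convergence turns this into
convergence in \<open>L\<^sub>p(\<mu>)\<close> (\<open>K_tendsto\<close>, \<open>R_tendsto\<close>), and again shows that \<open>exp(-t W) f \<rightarrow> f\<close> for \<open>f \<in> M\<close>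
as \<open>t \<rightarrow> 0\<close> (\<open>strong_limit_at_0\<close>).

Most of the work goes into the claim that these formulas describe the semigroup generated by \<open>A - w\<close>,
which is only given by its generator.

\<^item> The formulas define a \<open>C\<^sub>0\<close>-semigroup \<open>S\<close>. On \<open>M\<^sup>\<bottom>\<close> this holds because the damped translation is
  similar to the translation, via multiplication by \<open>exp(G)\<close> where \<open>G\<close> is a primitive of \<open>w\<close>.

\<^item> Its generator is \<open>A - w\<close> (\<open>generator_S\<close>), since \<open>(S(h) - T(h)) f / h\<close> tends to \<open>-w f\<close> for every
  \<open>f\<close>. These operators are bounded uniformly in \<open>h\<close>, and \<open>M\<^sup>\<bottom>\<close> is the closed span of the indicator
  functions of the sets \<open>(a, 1) \<times> {\<gamma>}\<close> (\<open>bandN_closed_subspace_induct\<close>). For such an indicator function,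
  the claim is that the averages of \<open>w\<close> over \<open>(x - h, x)\<close> converge to \<open>w(x)\<close> in mean, which
  follows from the strong continuity of the translation in \<open>L\<^sub>1\<close>.

\<^item> No other \<open>C\<^sub>0\<close>-semigroup \<open>S'\<close> has this generator (\<open>C0_semigroup_unique\<close>). For \<open>f\<close> in the domain,
  which is dense (\<open>generator_T_dense\<close>), the function \<open>s \<mapsto> S(t - s) S'(s) f\<close> is continuous with right
  derivative 0, hence constant. Its continuity relies on the local boundedness of \<open>C\<^sub>0\<close>-semigroups, hence on
  the principle of uniform boundedness and on the completeness of \<open>L\<^sub>p(\<mu>)\<close> (\<open>banach_subspace_Lp\<close>).

The splitting into the bands is elementary: the integrability of \<open>|f|\<^sup>p\<close> leaves only countably many
\<open>x\<close> for which \<open>f(x, \<cdot>)\<close> is nonzero at uncountably many points, and the restriction of \<open>f\<close> to these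
\<open>x\<close> is its component in \<open>M\<close> (\<open>Lp_band_decomposition\<close>).\<close>

section \<open>Semigroups on normed spaces\<close>

locale normed_subspace =
  fixes X :: "'a::real_vector set" and N :: "'a \<Rightarrow> real"
  assumes subspace_X: "subspace X"
    and N_triangle: "f \<in> X \<Longrightarrow> g \<in> X \<Longrightarrow> N (f + g) \<le> N f + N g"
    and N_scaleR: "f \<in> X \<Longrightarrow> N (c *\<^sub>R f) = \<bar>c\<bar> * N f"
    and N_eq_0: "f \<in> X \<Longrightarrow> N f = 0 \<Longrightarrow> f = 0"
begin

lemma X_zero [simp]: "0 \<in> X"
  and X_add [simp]: "f \<in> X \<Longrightarrow> g \<in> X \<Longrightarrow> f + g \<in> X"
  and X_scaleR [simp]: "f \<in> X \<Longrightarrow> c *\<^sub>R f \<in> X"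
  and X_diff [simp]: "f \<in> X \<Longrightarrow> g \<in> X \<Longrightarrow> f - g \<in> X"
  and X_minus [simp]: "f \<in> X \<Longrightarrow> - f \<in> X"
  using subspace_X by (simp_all add: subspace_0 subspace_add subspace_scale subspace_diff subspace_neg)

lemma X_sum [simp]: "(\<And>i. i \<in> I \<Longrightarrow> y i \<in> X) \<Longrightarrow> (\<Sum>i\<in>I. y i) \<in> X"
  using subspace_X by (simp add: subspace_sum)

lemma N_zero [simp]: "N 0 = 0"
  using N_scaleR[of 0 0] by simp

lemma N_minus [simp]: "f \<in> X \<Longrightarrow> N (- f) = N f"
  using N_scaleR[of f "-1"] by simp

lemma N_nonneg [simp]: "f \<in> X \<Longrightarrow> 0 \<le> N f"
  using N_triangle[of f "- f"] by simp

lemma N_diff_commute: "f \<in> X \<Longrightarrow> g \<in> X \<Longrightarrow> N (f - g) = N (g - f)"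
  using N_minus[of "f - g"] by simp

lemma N_diff_triangle: "f \<in> X \<Longrightarrow> g \<in> X \<Longrightarrow> h \<in> X \<Longrightarrow> N (f - h) \<le> N (f - g) + N (g - h)"
  using N_triangle[of "f - g" "g - h"] by simp

lemma N_diff_le: "f \<in> X \<Longrightarrow> g \<in> X \<Longrightarrow> N (f - g) \<le> N f + N g"
  using N_triangle[of f "- g"] by simp

lemma N_le_diff: "f \<in> X \<Longrightarrow> g \<in> X \<Longrightarrow> N f \<le> N g + N (f - g)"
  using N_triangle[of g "f - g"] by simp

lemma N_sum: "(\<And>i. i \<in> I \<Longrightarrow> y i \<in> X) \<Longrightarrow> N (\<Sum>i\<in>I. y i) \<le> (\<Sum>i\<in>I. N (y i))"
proof (induction I rule: infinite_finite_induct)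
  case (insert i I)
  then show ?case using N_triangle[of "y i" "\<Sum>i\<in>I. y i"] by simp
qed simp_all

lemma bounded_op_closed: "bounded_op X N B \<Longrightarrow> f \<in> X \<Longrightarrow> B f \<in> X"
  and bounded_op_add: "bounded_op X N B \<Longrightarrow> f \<in> X \<Longrightarrow> g \<in> X \<Longrightarrow> B (f + g) = B f + B g"
  and bounded_op_scaleR: "bounded_op X N B \<Longrightarrow> f \<in> X \<Longrightarrow> B (c *\<^sub>R f) = c *\<^sub>R B f"
  by (simp_all add: bounded_op_def)

lemma bounded_op_minus: "bounded_op X N B \<Longrightarrow> f \<in> X \<Longrightarrow> B (- f) = - B f"
  using bounded_op_scaleR[of B f "-1"] by simp

lemma bounded_op_diff:
  "bounded_op X N B \<Longrightarrow> f \<in> X \<Longrightarrow> g \<in> X \<Longrightarrow> B (f - g) = B f - B g"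
  using bounded_op_add[of B f "- g"] by (simp add: bounded_op_minus)

lemma bounded_op_bound:
  assumes "bounded_op X N B"
  obtains C where "0 < C" "\<And>f. f \<in> X \<Longrightarrow> N (B f) \<le> C * N f"
proof -
  obtain C where C: "\<And>f. f \<in> X \<Longrightarrow> N (B f) \<le> C * N f"
    using assms unfolding bounded_op_def by blast
  show ?thesis
  proof (rule that[of "\<bar>C\<bar> + 1"])
    show "N (B f) \<le> (\<bar>C\<bar> + 1) * N f" if "f \<in> X" for f
    proof (rule order_trans[OF C[OF that]])
      show "C * N f \<le> (\<bar>C\<bar> + 1) * N f" using N_nonneg[OF that] by (intro mult_right_mono) auto
    qed
  qed simp
qed

lemma strong_limit_unique:
  assumes "strong_limit X N S F P" "strong_limit X N S F Q" "F \<noteq> bot" "f \<in> X"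
    and S: "\<forall>\<^sub>F i in F. S i f \<in> X"
  shows "P f = Q f"
proof -
  have PQ: "P f \<in> X" "Q f \<in> X"
    using assms by (auto simp: strong_limit_def bounded_op_def)
  have "((\<lambda>i. N (S i f - P f) + N (S i f - Q f)) \<longlongrightarrow> 0 + 0) F"
    using assms by (intro tendsto_add) (auto simp: strong_limit_def)
  moreover have "\<forall>\<^sub>F i in F. N (P f - Q f) \<le> N (S i f - P f) + N (S i f - Q f)"
    using S
  proof eventually_elim
    case (elim i)
    then show ?case
      using N_diff_triangle[of "P f" "S i f" "Q f"] PQ by (simp add: N_diff_commute)
  qed
  ultimately have "N (P f - Q f) \<le> 0 + 0"
    using assms(3) by (rule tendsto_lowerbound)
  then have "N (P f - Q f) = 0" using PQ N_nonneg[of "P f - Q f"] X_diff[of "P f" "Q f"] by linarith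
  then show ?thesis using N_eq_0[of "P f - Q f"] PQ by simp
qed

text \<open>For linear operators that are bounded uniformly in \<open>h\<close>, the vectors on which they tend to 0 form a
closed set. So convergence has to be checked only on a set with dense span.\<close>

lemma tendsto_0_closed:
  assumes S: "\<And>h f. h > 0 \<Longrightarrow> f \<in> Y \<Longrightarrow> B h f \<in> X"
    and diff: "\<And>h f g. h > 0 \<Longrightarrow> f \<in> Y \<Longrightarrow> g \<in> Y \<Longrightarrow> B h (f - g) = B h f - B h g"
    and bound: "\<And>h f. h > 0 \<Longrightarrow> f \<in> Y \<Longrightarrow> N (B h f) \<le> C * N f"
    and Y: "Y \<subseteq> X" "\<And>f g. f \<in> Y \<Longrightarrow> g \<in> Y \<Longrightarrow> f - g \<in> Y"
    and f: "f \<in> Y" and s: "\<And>i. s i \<in> Y" "(\<lambda>i. N (s i - f)) \<longlonglongrightarrow> 0"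
    and lim: "\<And>i. ((\<lambda>h. N (B h (s i))) \<longlongrightarrow> 0) (at_right (0::real))"
  shows "((\<lambda>h. N (B h f)) \<longlongrightarrow> 0) (at_right 0)"
proof (rule tendstoI)
  fix e :: real assume e: "e > 0"
  have "(\<lambda>i. \<bar>C\<bar> * N (s i - f)) \<longlonglongrightarrow> \<bar>C\<bar> * 0" by (intro tendsto_intros s)
  then have "\<forall>\<^sub>F i in sequentially. \<bar>C\<bar> * N (s i - f) < e / 2"
    using e by (intro order_tendstoD) auto
  then obtain i where i: "\<bar>C\<bar> * N (s i - f) < e / 2"
    by (auto simp: eventually_sequentially)
  have "\<forall>\<^sub>F h in at_right 0. N (B h (s i)) < e / 2"
    using e by (intro order_tendstoD[OF lim]) auto
  then show "\<forall>\<^sub>F h in at_right 0. dist (N (B h f)) 0 < e"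
    using eventually_at_right_less[of 0]
  proof eventually_elim
    case (elim h)
    have sf: "s i - f \<in> Y" "s i - f \<in> X" using s f Y by auto
    have "N (B h (s i) - B h f) \<le> C * N (s i - f)"
      using bound[of h "s i - f"] diff[of h "s i" f] s f Y elim by auto
    also have "\<dots> \<le> \<bar>C\<bar> * N (s i - f)"
      using sf by (intro mult_right_mono) auto
    finally have "N (B h f - B h (s i)) < e / 2"
      using i S elim s f by (subst N_diff_commute) auto
    with elim N_le_diff[of "B h f" "B h (s i)"] S[of h] s f show ?case by simp
  qed
qed

end

text \<open>Completeness is stated in terms of absolutely convergent series, which is the form that a function
space satisfies most directly and that the construction in the uniform boundedness principle uses.\<close>

locale banach_subspace = normed_subspace +
  assumes abs_summable_limit: "range y \<subseteq> X \<Longrightarrow> summable (\<lambda>n. N (y n)) \<Longrightarrow>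
    \<exists>x\<in>X. (\<lambda>n. N (x - (\<Sum>i<n::nat. y i))) \<longlonglongrightarrow> 0"
begin

lemma abs_summable_limit_tail:
  assumes y: "range y \<subseteq> X" and sm: "summable (\<lambda>n. N (y n))"
    and lim: "(\<lambda>n. N (x - (\<Sum>i<n::nat. y i))) \<longlonglongrightarrow> 0" and x: "x \<in> X"
  shows "N (x - (\<Sum>i<k. y i)) \<le> (\<Sum>i. N (y (i + k)))"
proof -
  have yX: "y i \<in> X" for i using y by auto
  have "N (x - (\<Sum>i<k. y i)) \<le> N (x - (\<Sum>i<n. y i)) + (\<Sum>i. N (y (i + k)))" if "n \<ge> k" for n
  proof -
    have "(\<Sum>i<n. y i) - (\<Sum>i<k. y i) = (\<Sum>i<n - k. y (i + k))"
      using sum_diff_nat_ivl[of 0 k n y] sum.shift_bounds_nat_ivl[of y 0 k "n - k"] that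
      by (simp add: lessThan_atLeast0)
    then have "N ((\<Sum>i<n. y i) - (\<Sum>i<k. y i)) \<le> (\<Sum>i<n - k. N (y (i + k)))"
      using N_sum[of "{..<n-k}" "\<lambda>i. y (i + k)"] yX by simp
    also have "\<dots> \<le> (\<Sum>i. N (y (i + k)))"
      using sm yX by (intro sum_le_suminf) (auto intro: summable_ignore_initial_segment)
    finally show ?thesis
      using N_diff_triangle[of x "\<Sum>i<n. y i" "\<Sum>i<k. y i"] x yX by simp
  qed
  then have "\<forall>\<^sub>F n in sequentially. N (x - (\<Sum>i<k. y i)) \<le>
      N (x - (\<Sum>i<n. y i)) + (\<Sum>i. N (y (i + k)))"
    by (auto simp: eventually_sequentially)
  moreover have "(\<lambda>n. N (x - (\<Sum>i<n. y i)) + (\<Sum>i. N (y (i + k)))) \<longlonglongrightarrow> 0 + (\<Sum>i. N (y (i + k)))"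
    by (intro tendsto_intros lim)
  ultimately have "N (x - (\<Sum>i<k. y i)) \<le> 0 + (\<Sum>i. N (y (i + k)))"
    by (intro tendsto_lowerbound) auto
  then show ?thesis by simp
qed

lemma bounded_op_least_bound:
  assumes "bounded_op X N B"
  obtains C where "\<And>f. f \<in> X \<Longrightarrow> N (B f) \<le> C * N f"
    "\<And>c. c < C \<Longrightarrow> 0 \<le> c \<Longrightarrow> \<exists>f\<in>X. c * N f < N (B f)" "0 \<le> C"
proof -
  let ?A = "{C. 0 \<le> C \<and> (\<forall>f\<in>X. N (B f) \<le> C * N f)}"
  obtain C0 where C0: "0 < C0" "\<And>f. f \<in> X \<Longrightarrow> N (B f) \<le> C0 * N f"
    using bounded_op_bound[OF assms] by blast
  then have ne: "?A \<noteq> {}" by (auto intro!: exI[of _ C0])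
  have bdd: "bdd_below ?A" by (auto intro!: bdd_belowI[of _ 0])
  show ?thesis
  proof (rule that[of "Inf ?A"])
    fix f assume f: "f \<in> X"
    show "N (B f) \<le> Inf ?A * N f"
    proof (cases "N f = 0")
      case True
      then show ?thesis using C0(2)[OF f] by simp
    next
      case False
      then have "N f > 0" using N_nonneg[OF f] by linarith
      moreover have "N (B f) / N f \<le> Inf ?A"
        using ne f \<open>N f > 0\<close> by (intro cInf_greatest) (auto simp: field_simps)
      ultimately show ?thesis by (simp add: field_simps)
    qed
  next
    fix c assume c: "c < Inf ?A" "0 \<le> c"
    then have "c \<notin> ?A" using cInf_lower[OF _ bdd, of c] by linarith
    with c(2) show "\<exists>f\<in>X. c * N f < N (B f)" by (auto simp: not_le)
  next
    show "0 \<le> Inf ?A" using ne by (intro cInf_greatest) auto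
  qed
qed

text \<open>A proof without Baire's theorem, due to Sokal: if the norms \<open>C (n k)\<close> exceed \<open>4\<^sup>k\<close>, add up vectors
\<open>\<plusminus> g k\<close> of norm \<open>3\<^sup>-\<^sup>k\<close> that nearly attain these norms. One of the two signs keeps the \<open>k\<close>-th value
large, and the remaining terms are too small to destroy it.\<close>

theorem uniform_boundedness:
  assumes B: "\<And>n::nat. bounded_op X N (B n)"
    and pointwise: "\<And>f. f \<in> X \<Longrightarrow> \<exists>C. \<forall>n. N (B n f) \<le> C"
  shows "\<exists>K. \<forall>n. \<forall>f\<in>X. N (B n f) \<le> K * N f"
proof (rule ccontr)
  assume contra: "\<not> ?thesis"
  have "\<forall>n. \<exists>C. (\<forall>f\<in>X. N (B n f) \<le> C * N f) \<and>
      (\<forall>c. 0 \<le> c \<longrightarrow> c < C \<longrightarrow> (\<exists>f\<in>X. c * N f < N (B n f))) \<and> 0 \<le> C"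
    using bounded_op_least_bound[OF B] by metis
  then obtain C where C: "\<And>n f. f \<in> X \<Longrightarrow> N (B n f) \<le> C n * N f"
    "\<And>n c. 0 \<le> c \<Longrightarrow> c < C n \<Longrightarrow> \<exists>f\<in>X. c * N f < N (B n f)" "\<And>n. 0 \<le> C n"
    by metis
  have "\<exists>n. C n > K" for K
  proof (rule ccontr)
    assume "\<nexists>n. C n > K"
    then have "N (B n f) \<le> K * N f" if "f \<in> X" for n f
      using C(1)[OF that, of n] mult_right_mono[of "C n" K "N f"] that by (auto simp: not_less)
    with contra show False by blast
  qed
  then have "\<forall>k. \<exists>n. C n > 4 ^ k" by blast
  then obtain n where n: "\<And>k::nat. C (n k) > 4 ^ k" by metis
  have "\<exists>g\<in>X. N g = (1/3) ^ k \<and> N (B (n k) g) \<ge> 2/3 * C (n k) * (1/3) ^ k" for k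
  proof -
    have pos: "C (n k) > 0" using n[of k] by (meson less_trans zero_less_numeral zero_less_power)
    then obtain f where f: "f \<in> X" "2/3 * C (n k) * N f < N (B (n k) f)"
      using C(2)[of "2/3 * C (n k)" "n k"] by auto
    then have "N f \<noteq> 0" using C(1)[of f "n k"] by auto
    then have Nf: "N f > 0" using N_nonneg[OF f(1)] by linarith
    define c where "c = (1/3) ^ k / N f"
    have c: "c > 0" "c * N f = (1/3) ^ k" using Nf by (auto simp: c_def)
    have "N (c *\<^sub>R f) = (1/3) ^ k" using f c by (simp add: N_scaleR)
    moreover have "N (B (n k) (c *\<^sub>R f)) = c * N (B (n k) f)"
      using f c bounded_op_closed[OF B] by (simp add: bounded_op_scaleR[OF B] N_scaleR)
    moreover have "c * (2/3 * C (n k) * N f) \<le> c * N (B (n k) f)"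
      using f c by (intro mult_left_mono) auto
    moreover have "c * (2/3 * C (n k) * N f) = 2/3 * C (n k) * (1/3) ^ k"
      using c(2) by (simp add: algebra_simps)
    ultimately have "2/3 * C (n k) * (1/3) ^ k \<le> N (B (n k) (c *\<^sub>R f))" by linarith
    with \<open>N (c *\<^sub>R f) = (1/3) ^ k\<close> show ?thesis using f(1) by (intro bexI[of _ "c *\<^sub>R f"]) auto
  qed
  then obtain g where g: "\<And>k. g k \<in> X" "\<And>k. N (g k) = (1/3) ^ k"
      "\<And>k. N (B (n k) (g k)) \<ge> 2/3 * C (n k) * (1/3) ^ k"
    by metis
  \<comment> \<open>One of \<open>B (x + g)\<close> and \<open>B (x - g)\<close> is at least as large as \<open>B g\<close>, since their difference is \<open>2 B g\<close>.\<close>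
  define step where "step k x =
    (if N (B (n k) (x + g k)) \<ge> N (B (n k) (g k)) then g k else - g k)" for k x
  define x where "x = rec_nat 0 (\<lambda>k x. x + step k x)"
  define y where "y k = step k (x k)" for k
  have x_Suc: "x (Suc k) = x k + y k" and x_0: "x 0 = 0" for k by (simp_all add: x_def y_def)
  have yX: "y k \<in> X" and Ny: "N (y k) = (1/3) ^ k" for k
    using g by (auto simp: y_def step_def)
  have x_sum: "x k = (\<Sum>i<k. y i)" for k
    by (induction k) (simp_all add: x_0 x_Suc)
  have xX: "x k \<in> X" for k using yX by (simp add: x_sum)
  have big: "N (B (n k) (x (Suc k))) \<ge> 2/3 * C (n k) * (1/3) ^ k" for k
  proof -
    have "N (B (n k) (x (Suc k))) \<ge> N (B (n k) (g k))"
    proof (cases "N (B (n k) (x k + g k)) \<ge> N (B (n k) (g k))")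
      case True
      then show ?thesis by (simp add: x_Suc y_def step_def)
    next
      case False
      let ?a = "B (n k) (x k)" and ?b = "B (n k) (g k)"
      have X: "?a \<in> X" "?b \<in> X" using xX g bounded_op_closed[OF B] by auto
      have "2 * N ?b = N ((?a + ?b) - (?a - ?b))"
        using N_scaleR[of ?b 2] X by (simp add: scaleR_2)
      also have "\<dots> \<le> N (?a + ?b) + N (?a - ?b)" using X by (intro N_diff_le) auto
      finally have "N ?b \<le> N (?a - ?b)"
        using False xX g by (simp add: bounded_op_add[OF B])
      then show ?thesis using False xX g by (simp add: x_Suc y_def step_def bounded_op_diff[OF B])
    qed
    with g(3)[of k] show ?thesis by linarith
  qed
  have sm: "summable (\<lambda>k. N (y k))" by (simp add: Ny summable_geometric)
  obtain z where z: "z \<in> X" "(\<lambda>k. N (z - (\<Sum>i<k. y i))) \<longlonglongrightarrow> 0"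
    using abs_summable_limit[of y] yX sm by blast
  have near: "N (z - x (Suc k)) \<le> (1/3) ^ k / 2" for k
  proof -
    have "N (z - x (Suc k)) \<le> (\<Sum>i. N (y (i + Suc k)))"
      unfolding x_sum by (rule abs_summable_limit_tail) (use yX sm z in auto)
    also have "\<dots> = (\<Sum>i. (1/3) ^ Suc k * (1/3) ^ i)" by (simp add: Ny power_add mult_ac)
    also have "\<dots> = (1/3) ^ Suc k * (3/2)"
      by (subst suminf_mult) (simp_all add: suminf_geometric summable_geometric)
    finally show ?thesis by simp
  qed
  obtain D where D: "\<And>k. N (B k z) \<le> D" using pointwise[OF z(1)] by blast
  \<comment> \<open>The tail can destroy \<open>1/2\<close> of the \<open>2/3\<close> that \<open>g k\<close> contributes, which leaves \<open>1/6\<close>.\<close>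
  have "(4/3) ^ k / 6 \<le> D" for k
  proof -
    have "2/3 * C (n k) * (1/3) ^ k \<le> N (B (n k) (x (Suc k)))" by (rule big)
    also have "\<dots> \<le> N (B (n k) z) + N (B (n k) (x (Suc k)) - B (n k) z)"
      using z xX bounded_op_closed[OF B] by (intro N_le_diff) auto
    also have "B (n k) (x (Suc k)) - B (n k) z = B (n k) (x (Suc k) - z)"
      using z xX by (simp add: bounded_op_diff[OF B])
    also have "N \<dots> \<le> C (n k) * N (x (Suc k) - z)" using z xX by (intro C) auto
    also have "\<dots> \<le> C (n k) * ((1/3) ^ k / 2)"
      using near[of k] z xX C(3) by (intro mult_left_mono) (auto simp: N_diff_commute)
    also have "\<dots> = (C (n k) * (1/3) ^ k) / 2" by simp
    finally have "C (n k) * (1/3) ^ k / 6 \<le> D" using D[of "n k"] by linarith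
    moreover have "4 ^ k * (1/3) ^ k \<le> C (n k) * (1/3) ^ k"
      using n[of k] by (intro mult_right_mono) auto
    moreover have "(4::real) ^ k * (1/3) ^ k = (4/3) ^ k" by (simp flip: power_mult_distrib)
    ultimately show ?thesis by simp
  qed
  moreover obtain k where "(4/3::real) ^ k > 6 * D" using real_arch_pow[of "4/3" "6 * D"] by auto
  ultimately show False by (metis leD mult.commute divide_le_eq_numeral1(1))
qed

text \<open>Otherwise there are times \<open>s n \<rightarrow> 0\<close> at which the operators are not uniformly bounded, although
\<open>S (s n) g \<rightarrow> g\<close> for every \<open>g\<close>.\<close>

lemma C0_semigroup_bounded_near_0:
  assumes S: "C0_semigroup X N S"
  shows "\<exists>d>0. \<exists>K. \<forall>s\<in>{0..d}. \<forall>f\<in>X. N (S s f) \<le> K * N f"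
proof (rule ccontr)
  assume contra: "\<not> ?thesis"
  have "\<exists>s f. 0 \<le> s \<and> s \<le> 1 / real (Suc n) \<and> f \<in> X \<and> \<not> N (S s f) \<le> real n * N f" for n
    using contra[simplified, rule_format, of "1 / real (Suc n)" "real n"] by auto
  then obtain s f where sf: "\<And>n. 0 \<le> s n" "\<And>n. s n \<le> 1 / real (Suc n)" "\<And>n. f n \<in> X"
      "\<And>n. \<not> N (S (s n) (f n)) \<le> real n * N (f n)"
    by metis
  have s0: "s \<longlonglongrightarrow> 0"
    by (rule tendsto_sandwich[OF _ _ tendsto_const LIMSEQ_inverse_real_of_nat])
      (use sf in \<open>auto simp: inverse_eq_divide\<close>)
  have "\<exists>K. \<forall>n. \<forall>g\<in>X. N (S (s n) g) \<le> K * N g"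
  proof (rule uniform_boundedness)
    show B: "bounded_op X N (S (s n))" for n using S sf by (simp add: C0_semigroup_def)
    fix g assume g: "g \<in> X"
    have "((\<lambda>t. N (S t g - g)) \<longlongrightarrow> 0) (at_right 0)" using S g by (simp add: C0_semigroup_def)
    then have "\<forall>\<^sub>F t in at_right 0. N (S t g - g) < 1" by (rule order_tendstoD) simp
    then obtain b where b: "b > 0" "\<And>t. 0 < t \<Longrightarrow> t < b \<Longrightarrow> N (S t g - g) < 1"
      by (auto simp: eventually_at_right_field)
    have "S 0 g = g" using S g by (simp add: C0_semigroup_def)
    with b have b': "N (S t g - g) < 1" if "0 \<le> t" "t < b" for t
      using that by (cases "t = 0") auto
    have "\<forall>\<^sub>F n in sequentially. s n < b" using s0 b(1) by (rule order_tendstoD)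
    then obtain m where m: "\<And>n. n \<ge> m \<Longrightarrow> s n < b" by (auto simp: eventually_sequentially)
    have "N (S (s n) g) \<le> Max ((\<lambda>n. N (S (s n) g)) ` {..m}) + (N g + 1)" for n
    proof (cases "n \<le> m")
      case True
      then have "N (S (s n) g) \<le> Max ((\<lambda>n. N (S (s n) g)) ` {..m})" by (intro Max_ge) auto
      with g show ?thesis using N_nonneg[OF g] by linarith
    next
      case False
      have "N (S (s 0) g) \<le> Max ((\<lambda>n. N (S (s n) g)) ` {..m})" by (intro Max_ge) auto
      then have "0 \<le> Max ((\<lambda>n. N (S (s n) g)) ` {..m})"
        using N_nonneg[OF bounded_op_closed[OF B g, of 0]] by linarith
      moreover have "N (S (s n) g) \<le> N g + N (S (s n) g - g)"
        using g bounded_op_closed[OF B g] by (intro N_le_diff) auto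
      moreover have "N (S (s n) g - g) < 1" using False m sf by (intro b') auto
      ultimately show ?thesis by linarith
    qed
    then show "\<exists>C. \<forall>n. N (S (s n) g) \<le> C" by blast
  qed
  then obtain K where K: "\<And>n g. g \<in> X \<Longrightarrow> N (S (s n) g) \<le> K * N g" by blast
  obtain n :: nat where n: "K \<le> real n" using real_arch_simple by blast
  have "N (S (s n) (f n)) \<le> real n * N (f n)"
    using K[of "f n" n] mult_right_mono[OF n, of "N (f n)"] sf(3)[of n] by simp
  with sf(4) show False by blast
qed

lemma C0_semigroup_locally_bounded:
  assumes S: "C0_semigroup X N S"
  obtains K where "0 < K" "\<And>s f. 0 \<le> s \<Longrightarrow> s \<le> t \<Longrightarrow> f \<in> X \<Longrightarrow> N (S s f) \<le> K * N f"
proof -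
  obtain d K where d: "d > 0" and K: "\<And>s f. 0 \<le> s \<Longrightarrow> s \<le> d \<Longrightarrow> f \<in> X \<Longrightarrow> N (S s f) \<le> K * N f"
    using C0_semigroup_bounded_near_0[OF S] by fastforce
  have B: "0 \<le> s \<Longrightarrow> f \<in> X \<Longrightarrow> S s f \<in> X" for s f
    using S by (simp add: C0_semigroup_def bounded_op_def)
  define L where "L = max K 1"
  have L: "N (S s f) \<le> L * N f" if "0 \<le> s" "s \<le> d" "f \<in> X" for s f
    using K[OF that] mult_right_mono[of K L "N f"] that by (simp add: L_def)
  have pow: "N (S (real k * r) f) \<le> L ^ k * N f" if "0 \<le> r" "r \<le> d" "f \<in> X" for k r f
  proof (induction k)
    case 0
    then show ?case using S that by (simp add: C0_semigroup_def)
  next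
    case (Suc k)
    have "S (real (Suc k) * r) f = S r (S (real k * r) f)"
      using S that by (simp add: C0_semigroup_def algebra_simps)
    moreover have "S (real k * r) f \<in> X" using that by (simp add: B)
    ultimately have "N (S (real (Suc k) * r) f) \<le> L * N (S (real k * r) f)"
      using L that by simp
    also have "\<dots> \<le> L * (L ^ k * N f)" by (intro mult_left_mono Suc.IH) (simp add: L_def)
    finally show ?case by (simp add: mult.assoc)
  qed
  obtain k :: nat where k: "t / d \<le> real k" using real_arch_simple by blast
  define m where "m = Suc k"
  have m: "t \<le> d * real m" using k d by (simp add: m_def field_simps)
  show ?thesis
  proof (rule that[of "L ^ m"])
    show "0 < L ^ m" by (simp add: L_def)
    fix s f assume s: "0 \<le> s" "s \<le> t" "f \<in> X"
    have "s / real m \<le> d" using s m by (simp add: m_def field_simps)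
    then show "N (S s f) \<le> L ^ m * N f" using pow[of "s / real m" f m] s by (simp add: m_def)
  qed
qed

end

text \<open>For every \<open>e > 0\<close>, the set of times up to which \<open>\<phi> r \<le> e * r\<close> holds contains its supremum, by the
condition from the left, and can be extended beyond it, by the condition from the right.\<close>

lemma nonpositive_right_growth:
  fixes \<phi> :: "real \<Rightarrow> real"
  assumes t: "0 \<le> t" and \<phi>0: "\<phi> 0 \<le> 0"
    and left: "\<And>s e. 0 < s \<Longrightarrow> s \<le> t \<Longrightarrow> 0 < e \<Longrightarrow> \<exists>d>0. \<forall>h. 0 < h \<and> h < d \<longrightarrow> \<phi> s \<le> \<phi> (s - h) + e"
    and right: "\<And>s e. 0 \<le> s \<Longrightarrow> s < t \<Longrightarrow> 0 < e \<Longrightarrow> \<exists>d>0. \<forall>h. 0 < h \<and> h < d \<longrightarrow> \<phi> (s + h) \<le> \<phi> s + e * h"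
  shows "\<phi> t \<le> 0"
proof -
  have "\<phi> t \<le> e * t" if e: "e > 0" for e
  proof -
    define E where "E = {s\<in>{0..t}. \<forall>r\<in>{0..s}. \<phi> r \<le> e * r}"
    have E0: "0 \<in> E" using t \<phi>0 by (auto simp: E_def)
    have bdd: "bdd_above E" by (auto simp: E_def intro!: bdd_aboveI[of _ t])
    define \<sigma> where "\<sigma> = Sup E"
    have \<sigma>: "0 \<le> \<sigma>" "\<sigma> \<le> t"
      using cSup_upper[OF E0 bdd] E0 by (auto simp: \<sigma>_def E_def intro!: cSup_least)
    have below: "\<phi> r \<le> e * r" if r: "0 \<le> r" "r < \<sigma>" for r
    proof -
      obtain s where "s \<in> E" "r < s" using r E0 less_cSupD[of E r] by (auto simp: \<sigma>_def)
      then show ?thesis using r by (auto simp: E_def)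
    qed
    have at: "\<phi> \<sigma> \<le> e * \<sigma>"
    proof (cases "\<sigma> = 0")
      case False
      have "\<phi> \<sigma> \<le> e * \<sigma> + c" if c: "c > 0" for c
      proof -
        obtain d where d: "d > 0" "\<And>h. 0 < h \<Longrightarrow> h < d \<Longrightarrow> \<phi> \<sigma> \<le> \<phi> (\<sigma> - h) + c"
          using left[of \<sigma> c] False \<sigma> c by auto
        define h where "h = min d \<sigma> / 2"
        have h: "0 < h" "h < d" "h < \<sigma>" using d False \<sigma> by (auto simp: h_def min_def)
        have "e * h > 0" using e h by simp
        moreover have "e * (\<sigma> - h) = e * \<sigma> - e * h" by (simp add: algebra_simps)
        ultimately show ?thesis using d(2)[OF h(1,2)] below[of "\<sigma> - h"] h by linarith
      qed
      then show ?thesis by (rule field_le_epsilon)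
    qed (use \<phi>0 in simp)
    have "\<sigma> = t"
    proof (rule ccontr)
      assume "\<sigma> \<noteq> t"
      then obtain d where d: "d > 0" "\<And>h. 0 < h \<Longrightarrow> h < d \<Longrightarrow> \<phi> (\<sigma> + h) \<le> \<phi> \<sigma> + e * h"
        using right[of \<sigma> e] \<sigma> e by auto
      define h where "h = min d (t - \<sigma>) / 2"
      have h: "0 < h" "h < d" "\<sigma> + h \<le> t" using d \<open>\<sigma> \<noteq> t\<close> \<sigma> by (auto simp: h_def min_def field_simps)
      have "\<sigma> + h \<in> E"
        unfolding E_def
      proof (intro CollectI conjI ballI)
        show "\<sigma> + h \<in> {0..t}" using \<sigma> h by auto
        fix r assume r: "r \<in> {0..\<sigma> + h}"
        consider "r < \<sigma>" | "r = \<sigma>" | "r > \<sigma>" by linarith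
        then show "\<phi> r \<le> e * r"
        proof cases
          case 3
          then show ?thesis using d(2)[of "r - \<sigma>"] r h at by (simp add: algebra_simps)
        qed (use below r at in auto)
      qed
      then have "\<sigma> + h \<le> \<sigma>" unfolding \<sigma>_def by (rule cSup_upper[OF _ bdd])
      with h show False by simp
    qed
    with at show ?thesis by simp
  qed
  note bound = this
  have "\<phi> t \<le> 0 + c" if "c > 0" for c
  proof -
    have "\<phi> t \<le> c / (t + 1) * t" using that t by (intro bound) simp
    also have "\<dots> \<le> c" using that t by (simp add: field_simps)
    finally show ?thesis by simp
  qed
  then show ?thesis by (rule field_le_epsilon)
qed

context banach_subspace
begin

text \<open>The function \<open>u s = S (t - s) (S' s g)\<close> interpolates between \<open>S t g\<close> and \<open>S' t g\<close>. If \<open>g\<close> is in the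
domain, then so is \<open>w = S' s g\<close>, and \<open>u (s + h) - u s = S (t - s - h) (S' h w - S h w)\<close> is \<open>o(h)\<close> because
both semigroups have the same derivative at \<open>w\<close>. From the left, \<open>u\<close> is continuous because both
semigroups are locally bounded.\<close>

theorem C0_semigroup_unique:
  assumes S: "C0_semigroup X N S" and S': "C0_semigroup X N S'"
    and gen: "generator X N S = generator X N S'"
    and dense: "\<And>f e. f \<in> X \<Longrightarrow> 0 < e \<Longrightarrow> \<exists>g\<in>Domain (generator X N S). N (f - g) < e"
    and t: "0 \<le> t" and f: "f \<in> X"
  shows "S t f = S' t f"
proof -
  have B: "bounded_op X N (S s)" "bounded_op X N (S' s)" if "0 \<le> s" for s
    using S S' that by (simp_all add: C0_semigroup_def)
  have cl: "S s g \<in> X" "S' s g \<in> X" if "0 \<le> s" "g \<in> X" for s g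
    using B that by (simp_all add: bounded_op_def)
  have add: "S (r + s) g = S r (S s g)" "S' (r + s) g = S' r (S' s g)" if "0 \<le> r" "0 \<le> s" "g \<in> X" for r s g
    using S S' that by (simp_all add: C0_semigroup_def)
  have zero: "S 0 g = g" "S' 0 g = g" if "g \<in> X" for g
    using S S' that by (simp_all add: C0_semigroup_def)
  have cont: "((\<lambda>h. N (S h g - g)) \<longlongrightarrow> 0) (at_right 0)" "((\<lambda>h. N (S' h g - g)) \<longlongrightarrow> 0) (at_right 0)"
    if "g \<in> X" for g
    using S S' that by (simp_all add: C0_semigroup_def)
  obtain K1 where K1: "0 < K1" "\<And>s f. 0 \<le> s \<Longrightarrow> s \<le> t \<Longrightarrow> f \<in> X \<Longrightarrow> N (S s f) \<le> K1 * N f"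
    using C0_semigroup_locally_bounded[OF S, of t] by blast
  obtain K2 where K2: "0 < K2" "\<And>s f. 0 \<le> s \<Longrightarrow> s \<le> t \<Longrightarrow> f \<in> X \<Longrightarrow> N (S' s f) \<le> K2 * N f"
    using C0_semigroup_locally_bounded[OF S', of t] by blast
  define K where "K = max K1 K2"
  have K0: "K > 0" using K1 by (auto simp: K_def)
  have K: "N (S s g) \<le> K * N g" "N (S' s g) \<le> K * N g" if "0 \<le> s" "s \<le> t" "g \<in> X" for s g
    using K1(2)[OF that] K2(2)[OF that] mult_right_mono[of K1 K "N g"] mult_right_mono[of K2 K "N g"] that
    by (auto simp: K_def)
  have dom: "S t g = S' t g" if g: "(g, g') \<in> generator X N S" for g g'
  proof -
    have gX: "g \<in> X" using g by (simp add: generator_def)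
    define u where "u s = S (t - s) (S' s g)" for s
    have uX: "u s \<in> X" if "0 \<le> s" "s \<le> t" for s using that gX by (simp add: u_def cl)
    \<comment> \<open>\<open>S' s\<close> commutes with the difference quotients of \<open>S'\<close>, so it preserves the domain.\<close>
    have orbit: "(S' s g, S' s g') \<in> generator X N S" if s: "0 \<le> s" for s
    proof -
      have g': "g' \<in> X" "((\<lambda>h. N ((1 / h) *\<^sub>R (S' h g - g) - g')) \<longlongrightarrow> 0) (at_right 0)"
        using g unfolding gen by (simp_all add: generator_def)
      obtain C where C: "0 < C" "\<And>f. f \<in> X \<Longrightarrow> N (S' s f) \<le> C * N f"
        using bounded_op_bound[OF B(2)[OF s]] by blast
      have "((\<lambda>h. N ((1 / h) *\<^sub>R (S' h (S' s g) - S' s g) - S' s g')) \<longlongrightarrow> 0) (at_right 0)"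
      proof (rule tendsto_sandwich[OF _ _ tendsto_const])
        show "((\<lambda>h. C * N ((1 / h) *\<^sub>R (S' h g - g) - g')) \<longlongrightarrow> 0) (at_right 0)"
          using tendsto_mult[OF tendsto_const g'(2), of C] by simp
        show "\<forall>\<^sub>F h in at_right 0. N ((1 / h) *\<^sub>R (S' h (S' s g) - S' s g) - S' s g') \<le>
            C * N ((1 / h) *\<^sub>R (S' h g - g) - g')"
          using eventually_at_right_less[of 0]
        proof eventually_elim
          case (elim h)
          have "S' h (S' s g) = S' s (S' h g)" using add(2)[of h s g] add(2)[of s h g] elim s gX
            by (simp add: add.commute)
          then have "(1 / h) *\<^sub>R (S' h (S' s g) - S' s g) - S' s g' =
              S' s ((1 / h) *\<^sub>R (S' h g - g) - g')"
            using elim gX g' s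
            by (simp add: bounded_op_diff[OF B(2)] bounded_op_scaleR[OF B(2)] cl)
          also have "N \<dots> \<le> C * N ((1 / h) *\<^sub>R (S' h g - g) - g')"
            using elim gX g' by (intro C) (simp add: cl)
          finally show ?case .
        qed
        show "\<forall>\<^sub>F h in at_right 0. 0 \<le> N ((1 / h) *\<^sub>R (S' h (S' s g) - S' s g) - S' s g')"
          using eventually_at_right_less[of 0]
          by eventually_elim (use s gX g' in \<open>simp add: cl\<close>)
      qed
      then show ?thesis unfolding gen using s gX g' by (simp add: generator_def cl)
    qed
    have "N (u t - u 0) \<le> 0"
    proof (rule nonpositive_right_growth[where \<phi> = "\<lambda>s. N (u s - u 0)"])
      show "0 \<le> t" by (rule t)
      show "N (u 0 - u 0) \<le> 0" by simp
    next
      fix s e :: real assume s: "0 < s" "s \<le> t" and e: "0 < e"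
      define w where "w = S' s g"
      have wX: "w \<in> X" using s gX by (simp add: w_def cl)
      have "((\<lambda>h. K * K * N (S' h g - g) + K * (N (S h w - w) + (K + 1) * (K * N (S' h g - g))))
          \<longlongrightarrow> K * K * 0 + K * (0 + (K + 1) * (K * 0))) (at_right 0)"
        by (intro tendsto_intros cont gX wX)
      then have "\<forall>\<^sub>F h in at_right 0. K * K * N (S' h g - g) + K * (N (S h w - w) + (K + 1) * (K * N (S' h g - g))) < e"
        using e by (intro order_tendstoD) simp_all
      then obtain d where d: "d > 0" "\<And>h. 0 < h \<Longrightarrow> h < d \<Longrightarrow>
          K * K * N (S' h g - g) + K * (N (S h w - w) + (K + 1) * (K * N (S' h g - g))) < e"
        by (auto simp: eventually_at_right_field)
      show "\<exists>d>0. \<forall>h. 0 < h \<and> h < d \<longrightarrow> N (u s - u 0) \<le> N (u (s - h) - u 0) + e"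
      proof (intro exI[of _ "min d s"] conjI allI impI)
        show "min d s > 0" using d s by simp
        fix h assume h: "0 < h \<and> h < min d s"
        \<comment> \<open>The difference \<open>u s - u (s - h)\<close> is controlled by \<open>S' h g - g\<close> and \<open>S h w - w\<close>, where
          neither \<open>g\<close> nor \<open>w\<close> depends on \<open>h\<close>.\<close>
        define v where "v = S' (s - h) g"
        have vX: "v \<in> X" using h gX by (simp add: v_def cl)
        have w: "w = S' (s - h) (S' h g)" using add(2)[of "s - h" h g] h gX by (simp add: w_def)
        have "w - v = S' (s - h) (S' h g - g)"
          using h gX by (simp add: w v_def bounded_op_diff[OF B(2)] cl)
        then have wv: "N (w - v) \<le> K * N (S' h g - g)"
          using K(2)[of "s - h" "S' h g - g"] h s gX by (simp add: cl)
        have "u (s - h) = S (t - s) (S h v)"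
          using add(1)[of "t - s" h v] h s vX by (simp add: u_def v_def[symmetric] algebra_simps)
        then have "u s - u (s - h) = S (t - s) (w - S h v)"
          using s h vX wX by (simp add: u_def w_def[symmetric] bounded_op_diff[OF B(1)] cl)
        then have 1: "N (u s - u (s - h)) \<le> K * N (w - S h v)"
          using K(1)[of "t - s" "w - S h v"] s h vX wX by (simp add: cl)
        have eq: "w - S h v = (w - S h w) + S h (w - v)"
          using h vX wX by (simp add: bounded_op_diff[OF B(1)])
        have "N (w - S h v) \<le> N (w - S h w) + N (S h (w - v))"
          unfolding eq using h vX wX by (intro N_triangle) (simp_all add: cl)
        moreover have "N (w - S h w) = N (S h w - w)" using h wX by (intro N_diff_commute) (auto simp: cl)
        moreover have "N (S h (w - v)) \<le> K * N (w - v)" using h s vX wX by (intro K) auto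
        moreover have "K * N (w - v) \<le> (K + 1) * (K * N (S' h g - g))"
        proof -
          have "K * N (w - v) \<le> (K + 1) * N (w - v)" using vX wX by (simp add: algebra_simps)
          also have "\<dots> \<le> (K + 1) * (K * N (S' h g - g))" using wv K0 by (intro mult_left_mono) auto
          finally show ?thesis .
        qed
        ultimately have "N (w - S h v) \<le> N (S h w - w) + (K + 1) * (K * N (S' h g - g))" by linarith
        then have "K * N (w - S h v) \<le> K * (N (S h w - w) + (K + 1) * (K * N (S' h g - g)))"
          using K0 by (intro mult_left_mono) auto
        moreover have "0 \<le> K * K * N (S' h g - g)" using h gX K0 by (simp add: cl)
        ultimately have "N (u s - u (s - h)) \<le> e" using d(2)[of h] h 1 by linarith
        then show "N (u s - u 0) \<le> N (u (s - h) - u 0) + e"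
          using N_diff_triangle[of "u s" "u (s - h)" "u 0"] s h uX t by simp
      qed
    next
      fix s e :: real assume s: "0 \<le> s" "s < t" and e: "0 < e"
      define w where "w = S' s g"
      define w' where "w' = S' s g'"
      have ww: "(w, w') \<in> generator X N S" "(w, w') \<in> generator X N S'"
        using orbit[OF s(1)] gen by (simp_all add: w_def w'_def)
      then have wX: "w \<in> X" "w' \<in> X" by (simp_all add: generator_def)
      have "((\<lambda>h. K * (N ((1 / h) *\<^sub>R (S' h w - w) - w') + N ((1 / h) *\<^sub>R (S h w - w) - w')))
          \<longlongrightarrow> K * (0 + 0)) (at_right 0)"
        using ww by (intro tendsto_intros) (simp_all add: generator_def)
      then have "\<forall>\<^sub>F h in at_right 0. K * (N ((1 / h) *\<^sub>R (S' h w - w) - w') + N ((1 / h) *\<^sub>R (S h w - w) - w')) < e"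
        using e by (intro order_tendstoD) simp_all
      then obtain d where d: "d > 0" "\<And>h. 0 < h \<Longrightarrow> h < d \<Longrightarrow>
          K * (N ((1 / h) *\<^sub>R (S' h w - w) - w') + N ((1 / h) *\<^sub>R (S h w - w) - w')) < e"
        by (auto simp: eventually_at_right_field)
      show "\<exists>d>0. \<forall>h. 0 < h \<and> h < d \<longrightarrow> N (u (s + h) - u 0) \<le> N (u s - u 0) + e * h"
      proof (intro exI[of _ "min d (t - s)"] conjI allI impI)
        show "min d (t - s) > 0" using d s by simp
        fix h assume h: "0 < h \<and> h < min d (t - s)"
        define a where "a = (1 / h) *\<^sub>R (S' h w - w) - w'"
        define b where "b = (1 / h) *\<^sub>R (S h w - w) - w'"
        have abX: "a \<in> X" "b \<in> X" using h wX by (simp_all add: a_def b_def cl)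
        have "S' (s + h) g = S' h w"
          using add(2)[of h s g] s h gX by (simp add: w_def add.commute)
        moreover have "S (t - s) w = S (t - (s + h)) (S h w)"
          using add(1)[of "t - (s + h)" h w] s h wX by simp
        ultimately have "u (s + h) - u s = S (t - (s + h)) (S' h w - S h w)"
          using s h wX by (simp add: u_def w_def[symmetric] bounded_op_diff[OF B(1)] cl)
        also have "S' h w - S h w = h *\<^sub>R (a - b)"
          using h by (simp add: a_def b_def scaleR_diff_right)
        finally have "N (u (s + h) - u s) \<le> K * N (h *\<^sub>R (a - b))"
          using K(1)[of "t - (s + h)" "h *\<^sub>R (a - b)"] s h abX by simp
        also have "\<dots> = h * (K * N (a - b))" using h abX by (simp add: N_scaleR)
        also have "\<dots> \<le> h * (K * (N a + N b))"
          using h abX K0 by (intro mult_left_mono N_diff_le) auto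
        also have "\<dots> \<le> h * e"
          using d(2)[of h] h unfolding a_def b_def by (intro mult_left_mono) auto
        finally have "N (u (s + h) - u s) \<le> e * h" by (simp add: mult.commute)
        then show "N (u (s + h) - u 0) \<le> N (u s - u 0) + e * h"
          using N_diff_triangle[of "u (s + h)" "u s" "u 0"] s h uX t by simp
      qed
    qed
    then have "N (u t - u 0) = 0" using uX t by (simp add: antisym)
    then have "u t = u 0" using N_eq_0[of "u t - u 0"] uX t by simp
    then show ?thesis using t gX by (simp add: u_def zero cl)
  qed
  have "N (S t f - S' t f) \<le> 0 + e" if e: "e > 0" for e
  proof -
    obtain g g' where g: "(g, g') \<in> generator X N S" "N (f - g) < e / (2 * K)"
      using dense[OF f, of "e / (2 * K)"] e K0 by auto
    have gX: "g \<in> X" using g(1) by (simp add: generator_def)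
    have "S t f - S' t f = S t (f - g) - S' t (f - g)"
      using t f gX dom[OF g(1)] by (simp add: bounded_op_diff[OF B(1)] bounded_op_diff[OF B(2)])
    also have "N \<dots> \<le> N (S t (f - g)) + N (S' t (f - g))"
      using t f gX by (intro N_diff_le) (simp_all add: cl)
    also have "\<dots> \<le> K * N (f - g) + K * N (f - g)" using t f gX by (intro add_mono K) auto
    also have "\<dots> \<le> e" using g(2) K0 by (simp add: field_simps)
    finally show ?thesis by simp
  qed
  then have "N (S t f - S' t f) \<le> 0" by (rule field_le_epsilon)
  then have "N (S t f - S' t f) = 0" using N_nonneg[of "S t f - S' t f"] t f by (simp add: cl antisym)
  then show ?thesis using N_eq_0[of "S t f - S' t f"] t f cl by simp
qed

end

section \<open>The Banach space of p-integrable classes\<close>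

lemma L0_cases:
  obtains f where "f \<in> borel_measurable mu" "F = cls f"
  using that[of "rep_L0 F"] Quotient3_rep_reflp[OF Quotient3_L0, of F] Quotient3_abs_rep[OF Quotient3_L0, of F]
  by (simp add: ae_eq_def)

lemma ae_eq_refl: "f \<in> borel_measurable mu \<Longrightarrow> ae_eq f f"
  by (simp add: ae_eq_def)

lemma L0_ex_cls: "\<exists>f. f \<in> borel_measurable mu \<and> F = cls f"
  by (rule L0_cases[of F]) blast

lemma cls_eq_iff:
  assumes "f \<in> borel_measurable mu" "g \<in> borel_measurable mu"
  shows "cls f = cls g \<longleftrightarrow> (AE \<omega> in mu. f \<omega> = g \<omega>)"
  using Quotient3_rel[OF Quotient3_L0, of f g] assms by (auto simp: ae_eq_def)

lemma cls_plus: "f \<in> borel_measurable mu \<Longrightarrow> g \<in> borel_measurable mu \<Longrightarrow> cls f + cls g = cls (\<lambda>\<omega>. f \<omega> + g \<omega>)"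
  and cls_diff: "f \<in> borel_measurable mu \<Longrightarrow> g \<in> borel_measurable mu \<Longrightarrow> cls f - cls g = cls (\<lambda>\<omega>. f \<omega> - g \<omega>)"
  and cls_times: "f \<in> borel_measurable mu \<Longrightarrow> g \<in> borel_measurable mu \<Longrightarrow> cls f * cls g = cls (\<lambda>\<omega>. f \<omega> * g \<omega>)"
  and cls_scaleR: "f \<in> borel_measurable mu \<Longrightarrow> c *\<^sub>R cls f = cls (\<lambda>\<omega>. c * f \<omega>)"
  and cls_shift: "f \<in> borel_measurable mu \<Longrightarrow> shift t (cls f) = cls (shift_fun t f)"
  by (simp_all add: plus_L0.abs_eq minus_L0.abs_eq times_L0.abs_eq scaleR_L0.abs_eq shift.abs_eq ae_eq_refl)

lemma cls_sum:
  "(\<And>i. i \<in> I \<Longrightarrow> f i \<in> borel_measurable mu) \<Longrightarrow> (\<Sum>i\<in>I. cls (f i)) = cls (\<lambda>\<omega>. \<Sum>i\<in>I. f i \<omega>)"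
  by (induction I rule: infinite_finite_induct) (simp_all add: zero_L0_def cls_plus)

lemma cls_in_Lp: "f \<in> borel_measurable mu \<Longrightarrow> cls f \<in> Lp p \<longleftrightarrow> integrable mu (\<lambda>\<omega>. \<bar>f \<omega>\<bar> powr p)"
  by (simp add: Lp_def p_integrable.abs_eq ae_eq_refl)

lemma Lp_norm_cls: "f \<in> borel_measurable mu \<Longrightarrow>
    Lp_norm p (cls f) = (LINT \<omega>|mu. \<bar>f \<omega>\<bar> powr p) powr (1 / p)"
  by (simp add: Lp_norm.abs_eq ae_eq_refl)

lemma Lp_norm_powr:
  assumes "f \<in> borel_measurable mu" "1 \<le> p"
  shows "Lp_norm p (cls f) powr p = (LINT \<omega>|mu. \<bar>f \<omega>\<bar> powr p)"
  using assms by (simp add: Lp_norm_cls powr_powr)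

lemma Lp_norm_nonneg': "0 \<le> Lp_norm p F"
  by (cases F rule: L0_cases) (simp add: Lp_norm_cls)

lemma Lp_norm_le_iff:
  assumes "f \<in> borel_measurable mu" "1 \<le> p" "0 \<le> c"
  shows "Lp_norm p (cls f) \<le> c \<longleftrightarrow> (LINT \<omega>|mu. \<bar>f \<omega>\<bar> powr p) \<le> c powr p"
proof -
  have "Lp_norm p (cls f) powr p \<le> c powr p \<longleftrightarrow> Lp_norm p (cls f) \<le> c"
    using powr_mono2[of p "Lp_norm p (cls f)" c] powr_less_mono2[of p c "Lp_norm p (cls f)"] assms
      Lp_norm_nonneg'[of p "cls f"] by linarith
  then show ?thesis using assms by (simp add: Lp_norm_powr)
qed

lemma Lp_bounded_by:
  assumes f: "f \<in> borel_measurable mu" and g: "g \<in> borel_measurable mu" "cls g \<in> Lp p" and p: "1 \<le> p"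
    and le: "AE \<omega> in mu. \<bar>f \<omega>\<bar> \<le> c * \<bar>g \<omega>\<bar>" and c: "0 \<le> c"
  shows "cls f \<in> Lp p" "Lp_norm p (cls f) \<le> c * Lp_norm p (cls g)"
proof -
  have le': "AE \<omega> in mu. \<bar>f \<omega>\<bar> powr p \<le> c powr p * \<bar>g \<omega>\<bar> powr p"
    using le
  proof eventually_elim
    case (elim \<omega>)
    then show ?case using powr_mono2[of p "\<bar>f \<omega>\<bar>" "c * \<bar>g \<omega>\<bar>"] p c by (simp add: powr_mult)
  qed
  have int: "integrable mu (\<lambda>\<omega>. c powr p * \<bar>g \<omega>\<bar> powr p)"
    using g by (simp add: cls_in_Lp)
  have int': "integrable mu (\<lambda>\<omega>. \<bar>f \<omega>\<bar> powr p)"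
    by (rule Bochner_Integration.integrable_bound[OF int]) (use f le' in \<open>auto elim!: eventually_mono\<close>)
  then show "cls f \<in> Lp p" using f by (simp add: cls_in_Lp)
  have "(LINT \<omega>|mu. \<bar>f \<omega>\<bar> powr p) \<le> c powr p * Lp_norm p (cls g) powr p"
    using integral_mono_AE[OF int' int le'] g p by (simp add: Lp_norm_powr)
  then show "Lp_norm p (cls f) \<le> c * Lp_norm p (cls g)"
    using f p c Lp_norm_nonneg'[of p "cls g"] by (subst Lp_norm_le_iff) (simp_all add: powr_mult)
qed

text \<open>Convexity of \<open>u\<^sup>p\<close> up to the end point 0 of the half line.\<close>

lemma powr_convex_at_0:
  fixes u v :: real
  assumes p: "1 \<le> p" and "0 \<le> u" "0 \<le> v" "0 \<le> \<theta>" "\<theta> \<le> 1"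
  shows "(\<theta> * u + (1 - \<theta>) * v) powr p \<le> \<theta> * u powr p + (1 - \<theta>) * v powr p"
proof -
  have le: "c powr p \<le> c" if "0 \<le> c" "c \<le> 1" for c :: real
    using powr_mono'[OF p, of c] that by simp
  consider "u = 0" | "v = 0" | "0 < u" "0 < v" using assms by linarith
  then show ?thesis
  proof cases
    case 1
    then show ?thesis using le[of "1 - \<theta>"] assms mult_right_mono[of "(1 - \<theta>) powr p" "1 - \<theta>" "v powr p"]
      by (simp add: powr_mult)
  next
    case 2
    then show ?thesis using le[of \<theta>] assms mult_right_mono[of "\<theta> powr p" \<theta> "u powr p"]
      by (simp add: powr_mult)
  next
    case 3
    then show ?thesis using convex_onD[OF powr_convex[OF p], of "1 - \<theta>" u v] assms by simp
  qed
qed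

lemma Lp_norm_eq_0:
  assumes f: "f \<in> borel_measurable mu" "cls f \<in> Lp p" and p: "1 \<le> p" and 0: "Lp_norm p (cls f) = 0"
  shows "cls f = 0"
proof -
  have "(LINT \<omega>|mu. \<bar>f \<omega>\<bar> powr p) = 0" using Lp_norm_powr[OF f(1) p] 0 by simp
  then have "AE \<omega> in mu. \<bar>f \<omega>\<bar> powr p = 0"
    using integral_nonneg_eq_0_iff_AE[of mu "\<lambda>\<omega>. \<bar>f \<omega>\<bar> powr p"] f by (simp add: cls_in_Lp)
  then show ?thesis using f by (simp add: zero_L0_def cls_eq_iff)
qed

text \<open>Convexity of \<open>u\<^sup>p\<close>, applied to \<open>|f| / a\<close> and \<open>|g| / b\<close>, where \<open>a\<close> and \<open>b\<close> are the norms, with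
weights \<open>a / (a + b)\<close> and \<open>b / (a + b)\<close>.\<close>

lemma Lp_Minkowski:
  assumes f: "f \<in> borel_measurable mu" "cls f \<in> Lp p" and g: "g \<in> borel_measurable mu" "cls g \<in> Lp p"
    and p: "1 \<le> p"
  shows "cls f + cls g \<in> Lp p \<and> Lp_norm p (cls f + cls g) \<le> Lp_norm p (cls f) + Lp_norm p (cls g)"
proof -
  define a where "a = Lp_norm p (cls f)"
  define b where "b = Lp_norm p (cls g)"
  have nn: "0 \<le> a" "0 \<le> b" by (simp_all add: a_def b_def Lp_norm_nonneg')
  consider "a = 0" | "b = 0" | "0 < a" "0 < b" using nn by linarith
  then show ?thesis
  proof cases
    case 1
    then have "cls f = 0" using Lp_norm_eq_0[OF f p] by (simp add: a_def)
    then show ?thesis using g Lp_norm_nonneg'[of p 0] by simp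
  next
    case 2
    then have "cls g = 0" using Lp_norm_eq_0[OF g p] by (simp add: b_def)
    then show ?thesis using f Lp_norm_nonneg'[of p 0] by simp
  next
    case 3
    define s where "s = a + b"
    define \<theta> where "\<theta> = a / s"
    have s: "s > 0" using 3 by (simp add: s_def)
    have \<theta>: "0 \<le> \<theta>" "\<theta> \<le> 1" "1 - \<theta> = b / s" using 3 by (auto simp: \<theta>_def s_def field_simps)
    have If: "integrable mu (\<lambda>\<omega>. \<bar>f \<omega>\<bar> powr p)" "(LINT \<omega>|mu. \<bar>f \<omega>\<bar> powr p) = a powr p"
      and Ig: "integrable mu (\<lambda>\<omega>. \<bar>g \<omega>\<bar> powr p)" "(LINT \<omega>|mu. \<bar>g \<omega>\<bar> powr p) = b powr p"
      using f g p by (simp_all add: cls_in_Lp a_def b_def Lp_norm_powr)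
    let ?w = "\<lambda>\<omega>. s powr p * (\<theta> * (\<bar>f \<omega>\<bar> powr p / a powr p) + (1 - \<theta>) * (\<bar>g \<omega>\<bar> powr p / b powr p))"
    have le: "\<bar>f \<omega> + g \<omega>\<bar> powr p \<le> ?w \<omega>" for \<omega>
    proof -
      have "\<bar>f \<omega> + g \<omega>\<bar> \<le> \<bar>f \<omega>\<bar> + \<bar>g \<omega>\<bar>" by simp
      also have "\<dots> = s * (\<theta> * (\<bar>f \<omega>\<bar> / a) + (1 - \<theta>) * (\<bar>g \<omega>\<bar> / b))"
        unfolding \<theta>(3) using 3 s by (simp add: \<theta>_def field_simps)
      finally have "\<bar>f \<omega> + g \<omega>\<bar> powr p \<le> (s * (\<theta> * (\<bar>f \<omega>\<bar> / a) + (1 - \<theta>) * (\<bar>g \<omega>\<bar> / b))) powr p"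
        using p by (intro powr_mono2) auto
      also have "\<dots> = s powr p * (\<theta> * (\<bar>f \<omega>\<bar> / a) + (1 - \<theta>) * (\<bar>g \<omega>\<bar> / b)) powr p"
        by (rule powr_mult)
      also have "\<dots> \<le> s powr p * (\<theta> * (\<bar>f \<omega>\<bar> / a) powr p + (1 - \<theta>) * (\<bar>g \<omega>\<bar> / b) powr p)"
        using 3 \<theta>(1,2) by (intro mult_left_mono powr_convex_at_0 p) auto
      finally show ?thesis using 3 by (simp add: powr_divide)
    qed
    have Iw: "integrable mu ?w" using If Ig by auto
    have int: "integrable mu (\<lambda>\<omega>. \<bar>f \<omega> + g \<omega>\<bar> powr p)"
    proof (rule Bochner_Integration.integrable_bound[OF Iw])
      show "AE \<omega> in mu. norm (\<bar>f \<omega> + g \<omega>\<bar> powr p) \<le> norm (?w \<omega>)"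
        using order_trans[OF le abs_ge_self] by (intro AE_I2) simp
    qed (use f g in measurable)
    have "(LINT \<omega>|mu. \<bar>f \<omega> + g \<omega>\<bar> powr p) \<le> integral\<^sup>L mu ?w"
      by (intro integral_mono int Iw le)
    also have "integral\<^sup>L mu ?w = s powr p * (\<theta> + (1 - \<theta>))"
      using If Ig 3 by simp
    finally have "(LINT \<omega>|mu. \<bar>f \<omega> + g \<omega>\<bar> powr p) \<le> s powr p" by simp
    then show ?thesis
      using f g p int s by (simp add: cls_plus cls_in_Lp Lp_norm_le_iff a_def b_def s_def)
  qed
qed

lemma Lp_dominated_convergence:
  fixes s :: "nat \<Rightarrow> real \<times> 'g \<Rightarrow> real"
  assumes p: "1 \<le> p" and s: "\<And>i. s i \<in> borel_measurable mu" and f: "f \<in> borel_measurable mu"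
    and w: "w \<in> borel_measurable mu" "cls w \<in> Lp p"
    and le: "\<And>i. AE \<omega> in mu. \<bar>s i \<omega>\<bar> \<le> w \<omega>"
    and lim: "AE \<omega> in mu. (\<lambda>i. s i \<omega>) \<longlonglongrightarrow> f \<omega>"
  shows "(\<lambda>i. Lp_norm p (cls (s i) - cls f)) \<longlonglongrightarrow> 0"
proof -
  have "(\<lambda>i. LINT \<omega>|mu. \<bar>s i \<omega> - f \<omega>\<bar> powr p) \<longlonglongrightarrow> (LINT \<omega>::real \<times> 'g|mu. 0)"
  proof (rule integral_dominated_convergence[where w = "\<lambda>\<omega>. (2 * \<bar>w \<omega>\<bar>) powr p"])
    show "integrable mu (\<lambda>\<omega>. (2 * \<bar>w \<omega>\<bar>) powr p)"
      using w by (simp add: powr_mult cls_in_Lp)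
    show "AE \<omega> in mu. (\<lambda>i. \<bar>s i \<omega> - f \<omega>\<bar> powr p) \<longlonglongrightarrow> 0"
      using lim
    proof eventually_elim
      case (elim \<omega>)
      then have "(\<lambda>i. \<bar>s i \<omega> - f \<omega>\<bar>) \<longlonglongrightarrow> 0" by (simp add: tendsto_rabs_zero LIM_zero)
      then have "(\<lambda>i. \<bar>s i \<omega> - f \<omega>\<bar> powr p) \<longlonglongrightarrow> 0 powr p"
        using p by (intro tendsto_powr2) auto
      then show ?case by simp
    qed
    show "AE \<omega> in mu. norm (\<bar>s i \<omega> - f \<omega>\<bar> powr p) \<le> (2 * \<bar>w \<omega>\<bar>) powr p" for i
    proof -
      have "AE \<omega> in mu. \<forall>i. \<bar>s i \<omega>\<bar> \<le> w \<omega>" using le by (simp add: AE_all_countable)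
      with lim show ?thesis
      proof eventually_elim
        case (elim \<omega>)
        have "\<bar>f \<omega>\<bar> \<le> w \<omega>"
          using elim tendsto_rabs[OF elim(1)] by (intro LIMSEQ_le_const2) auto
        with elim have "\<bar>s i \<omega> - f \<omega>\<bar> \<le> 2 * \<bar>w \<omega>\<bar>" using elim(2)[rule_format, of i] by linarith
        then show ?case using p by (simp add: powr_mono2)
      qed
    qed
  qed (use s f in measurable)
  then have "(\<lambda>i. (LINT \<omega>|mu. \<bar>s i \<omega> - f \<omega>\<bar> powr p) powr (1 / p)) \<longlonglongrightarrow> 0 powr (1 / p)"
    using p by (intro tendsto_powr2) auto
  then show ?thesis using s f p by (simp add: cls_diff Lp_norm_cls)
qed

lemma normed_subspace_Lp:
  assumes p: "1 \<le> p"
  shows "normed_subspace (Lp p) (Lp_norm p)"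
proof
  have zero: "0 \<in> Lp p" by (simp add: zero_L0_def cls_in_Lp)
  have scale: "c *\<^sub>R F \<in> Lp p" "Lp_norm p (c *\<^sub>R F) = \<bar>c\<bar> * Lp_norm p F" if F: "F \<in> Lp p" for F :: "'g L0" and c
  proof -
    obtain f where f: "f \<in> borel_measurable mu" "F = cls f" by (rule L0_cases)
    then show "c *\<^sub>R F \<in> Lp p" "Lp_norm p (c *\<^sub>R F) = \<bar>c\<bar> * Lp_norm p F"
      using F p by (simp_all add: cls_scaleR cls_in_Lp Lp_norm_cls abs_mult powr_mult powr_powr)
  qed
  show "subspace (Lp p :: 'g L0 set)"
    unfolding subspace_def
  proof (intro conjI ballI allI)
    fix F G :: "'g L0" assume "F \<in> Lp p" "G \<in> Lp p"
    then show "F + G \<in> Lp p" using Lp_Minkowski[OF _ _ _ _ p] by (metis L0_ex_cls)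
  qed (use zero scale in auto)
  show "Lp_norm p (F + G) \<le> Lp_norm p F + Lp_norm p G" if "F \<in> Lp p" "G \<in> Lp p" for F G :: "'g L0"
    using that Lp_Minkowski[OF _ _ _ _ p] by (metis L0_ex_cls)
  show "Lp_norm p (c *\<^sub>R F) = \<bar>c\<bar> * Lp_norm p F" if "F \<in> Lp p" for F :: "'g L0" and c
    using that by (rule scale)
  show "F = 0" if "F \<in> Lp p" "Lp_norm p F = 0" for F :: "'g L0"
    using that Lp_norm_eq_0[OF _ _ p] by (metis L0_ex_cls)
qed

text \<open>The theorem of Riesz and Fischer. By Minkowski's inequality and monotone convergence, the sum \<open>w\<close> of the
\<open>|f i|\<close> is p-integrable and so finite almost everywhere. Hence the series converges almost everywhere, and
\<open>w\<close> dominates its partial sums.\<close>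

theorem banach_subspace_Lp:
  assumes p: "1 \<le> p"
  shows "banach_subspace (Lp p :: 'g L0 set) (Lp_norm p)"
proof -
  interpret normed_subspace "Lp p :: 'g L0 set" "Lp_norm p" by (rule normed_subspace_Lp[OF p])
  show ?thesis
  proof
    fix y :: "nat \<Rightarrow> 'g L0"
    assume y: "range y \<subseteq> Lp p" and sm: "summable (\<lambda>n. Lp_norm p (y n))"
    have "\<forall>n. \<exists>f. f \<in> borel_measurable mu \<and> y n = cls f" by (simp add: L0_ex_cls)
    then obtain f where f [measurable]: "\<And>n. f n \<in> borel_measurable mu" and yf: "\<And>n. y n = cls (f n)"
      by metis
    have fL: "cls (f n) \<in> Lp p" for n using y by (auto simp: yf[symmetric])
    define A where "A = (\<Sum>n. Lp_norm p (y n))"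
    have absL: "cls (\<lambda>\<omega>. \<bar>f n \<omega>\<bar>) \<in> Lp p" "Lp_norm p (cls (\<lambda>\<omega>. \<bar>f n \<omega>\<bar>)) = Lp_norm p (y n)" for n
      using fL[of n] by (simp_all add: cls_in_Lp Lp_norm_cls yf)
    define g where "g k \<omega> = (\<Sum>i<k. \<bar>f i \<omega>\<bar>)" for k :: nat and \<omega>
    have gm [measurable]: "g k \<in> borel_measurable mu" for k unfolding g_def by measurable
    have g_cls: "cls (g k) = (\<Sum>i<k. cls (\<lambda>\<omega>. \<bar>f i \<omega>\<bar>))" for k
      by (subst cls_sum) (simp_all add: g_def[abs_def])
    have gL: "cls (g k) \<in> Lp p" for k unfolding g_cls by (intro X_sum absL)
    have g0: "0 \<le> g k \<omega>" for k \<omega> by (simp add: g_def sum_nonneg)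
    have A0: "0 \<le> A" unfolding A_def by (intro suminf_nonneg sm Lp_norm_nonneg')
    have gA: "Lp_norm p (cls (g k)) \<le> A" for k
    proof -
      have "Lp_norm p (cls (g k)) \<le> (\<Sum>i<k. Lp_norm p (y i))"
        unfolding g_cls absL(2)[symmetric] by (intro N_sum absL)
      also have "\<dots> \<le> A" unfolding A_def by (intro sum_le_suminf sm) (auto simp: Lp_norm_nonneg')
      finally show ?thesis .
    qed
    have int: "integrable mu (\<lambda>\<omega>. g k \<omega> powr p)" "(LINT \<omega>|mu. g k \<omega> powr p) \<le> A powr p" for k
      using gL[of k] gA[of k] A0 p g0 by (simp_all add: cls_in_Lp Lp_norm_le_iff)
    have SUP: "(\<integral>\<^sup>+ \<omega>. (SUP k. ennreal (g k \<omega> powr p)) \<partial>mu) \<le> ennreal (A powr p)"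
    proof (subst nn_integral_monotone_convergence_SUP)
      show "incseq (\<lambda>k \<omega>. ennreal (g k \<omega> powr p))"
        using p by (intro incseq_SucI le_funI ennreal_leI powr_mono2) (simp_all add: g_def sum_nonneg)
      show "(SUP k. \<integral>\<^sup>+ \<omega>. ennreal (g k \<omega> powr p) \<partial>mu) \<le> ennreal (A powr p)"
        using int by (intro SUP_least) (simp add: nn_integral_eq_integral ennreal_leI)
    qed simp
    then have "(\<integral>\<^sup>+ \<omega>. (SUP k. ennreal (g k \<omega> powr p)) \<partial>mu) \<noteq> \<infinity>"
      using ennreal_less_top[of "A powr p"] by (auto simp: top_unique)
    then have fin: "AE \<omega> in mu. (SUP k. ennreal (g k \<omega> powr p)) \<noteq> \<infinity>"
      by (intro nn_integral_PInf_AE) auto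
    define w where "w \<omega> = (\<Sum>i. \<bar>f i \<omega>\<bar>)" for \<omega>
    have wm [measurable]: "w \<in> borel_measurable mu" unfolding w_def by measurable
    have conv: "AE \<omega> in mu. summable (\<lambda>i. \<bar>f i \<omega>\<bar>)"
      using fin
    proof eventually_elim
      case (elim \<omega>)
      then obtain C where C: "(SUP k. ennreal (g k \<omega> powr p)) = ennreal C" "0 \<le> C"
        by (metis ennreal_cases infinity_ennreal_def)
      have "g k \<omega> \<le> C powr (1 / p)" for k
      proof -
        have "ennreal (g k \<omega> powr p) \<le> ennreal C" unfolding C(1)[symmetric] by (rule SUP_upper) simp
        then have "g k \<omega> powr p \<le> C" using C(2) by simp
        then have "(g k \<omega> powr p) powr (1 / p) \<le> C powr (1 / p)" using p by (intro powr_mono2) auto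
        then show ?thesis using p g0[of k \<omega>] by (simp add: powr_powr)
      qed
      then show ?case by (intro summableI_nonneg_bounded[of _ "C powr (1 / p)"]) (auto simp: g_def)
    qed
    have wL: "cls w \<in> Lp p"
    proof -
      have "AE \<omega> in mu. ennreal (\<bar>w \<omega>\<bar> powr p) \<le> (SUP k. ennreal (g k \<omega> powr p))"
        using conv
      proof eventually_elim
        case (elim \<omega>)
        have "(\<lambda>k. g k \<omega>) \<longlonglongrightarrow> w \<omega>"
          using summable_LIMSEQ[OF elim] by (simp add: g_def w_def)
        then have "(\<lambda>k. ennreal (g k \<omega> powr p)) \<longlonglongrightarrow> ennreal (w \<omega> powr p)"
          using p by (intro tendsto_ennrealI tendsto_powr2) (auto simp: g0)
        then have "ennreal (w \<omega> powr p) \<le> (SUP k. ennreal (g k \<omega> powr p))"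
          by (rule LIMSEQ_le_const2) (auto intro!: SUP_upper)
        moreover have "0 \<le> w \<omega>" unfolding w_def using elim by (intro suminf_nonneg) auto
        ultimately show ?case by simp
      qed
      then have "(\<integral>\<^sup>+ \<omega>. ennreal (\<bar>w \<omega>\<bar> powr p) \<partial>mu) \<le> ennreal (A powr p)"
        by (rule order_trans[OF nn_integral_mono_AE SUP])
      then have "integrable mu (\<lambda>\<omega>. \<bar>w \<omega>\<bar> powr p)"
        by (intro integrableI_bounded) (auto intro: le_less_trans)
      then show ?thesis by (simp add: cls_in_Lp)
    qed
    define F where "F \<omega> = (\<Sum>i. f i \<omega>)" for \<omega>
    have Fm [measurable]: "F \<in> borel_measurable mu" unfolding F_def by measurable
    have le: "AE \<omega> in mu. \<bar>\<Sum>i<n. f i \<omega>\<bar> \<le> w \<omega>" for n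
      using conv
    proof eventually_elim
      case (elim \<omega>)
      have "\<bar>\<Sum>i<n. f i \<omega>\<bar> \<le> (\<Sum>i<n. \<bar>f i \<omega>\<bar>)" by (rule sum_abs)
      also have "\<dots> \<le> w \<omega>" unfolding w_def by (intro sum_le_suminf elim) auto
      finally show ?case .
    qed
    have lim: "AE \<omega> in mu. (\<lambda>n. \<Sum>i<n. f i \<omega>) \<longlonglongrightarrow> F \<omega>"
      using conv unfolding F_def by eventually_elim (rule summable_LIMSEQ[OF summable_rabs_cancel])
    have "AE \<omega> in mu. \<bar>F \<omega>\<bar> \<le> 1 * \<bar>w \<omega>\<bar>"
      using conv
    proof eventually_elim
      case (elim \<omega>)
      then show ?case using summable_rabs[OF elim] by (simp add: F_def w_def)
    qed
    then have FL: "cls F \<in> Lp p" by (rule Lp_bounded_by(1)[OF Fm wm wL p]) simp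
    have "(\<lambda>n. Lp_norm p (cls (\<lambda>\<omega>. \<Sum>i<n. f i \<omega>) - cls F)) \<longlonglongrightarrow> 0"
      by (rule Lp_dominated_convergence[OF p _ _ wm wL le lim]) measurable
    then have "(\<lambda>n. Lp_norm p (cls F - (\<Sum>i<n. y i))) \<longlonglongrightarrow> 0"
      using FL fL by (subst N_diff_commute) (auto simp: yf cls_sum[symmetric] intro!: X_sum)
    with FL show "\<exists>x\<in>Lp p. (\<lambda>n. Lp_norm p (x - (\<Sum>i<n. y i))) \<longlonglongrightarrow> 0" by blast
  qed
qed

text \<open>Translation permutes the sections \<open>A\<^sub>x\<close> and preserves the Lebesgue measure of the sections \<open>A\<^sup>\<gamma>\<close>; what
leaves \<open>(0, 1)\<close> is lost. This is why translation is a contraction.\<close>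

lemma emeasure_shift_set_le:
  assumes A: "A \<in> Asets"
  shows "emeasure mu (shift_set t A) \<le> emeasure mu A"
proof -
  have out: "xsec A x = {}" if "x \<notin> {0<..<1}" for x
    using A that by (auto simp: Asets_def Omega_def xsec_def)
  have "val1 (shift_set t A) = (\<Sum>\<^sub>\<infinity>x\<in>{0<..<1}. nu (xsec A (x - t)))"
    unfolding val1_def by (intro infsum_cong) (simp add: xsec_shift_set)
  also have "\<dots> = (\<Sum>\<^sub>\<infinity>x\<in>(\<lambda>x. x - t) ` {0<..<1}. nu (xsec A x))"
    by (subst infsum_reindex) (auto simp: inj_on_def o_def)
  also have "\<dots> \<le> (\<Sum>\<^sub>\<infinity>x\<in>{0<..<1}. nu (xsec A x))"
    by (rule infsum_mono_neutral) (auto intro!: nonneg_summable_on_complete simp: out nu_def)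
  finally have 1: "val1 (shift_set t A) \<le> val1 A" by (simp add: val1_def)
  have "emeasure lborel (gsec (shift_set t A) \<gamma>) \<le> emeasure lborel (gsec A \<gamma>)" for \<gamma>
  proof -
    have B: "gsec A \<gamma> \<in> sets borel" using A by (simp add: Asets_def)
    have "emeasure lborel (gsec A \<gamma>) = emeasure (distr lborel borel ((+) (- t))) (gsec A \<gamma>)"
      by (simp add: lborel_distr_plus)
    also have "\<dots> = emeasure lborel ((+) (- t) -` gsec A \<gamma>)"
      using B by (subst emeasure_distr) auto
    also have "(+) (- t) = (\<lambda>x. x - t)" by auto
    finally have "emeasure lborel (gsec A \<gamma>) = emeasure lborel ((\<lambda>x. x - t) -` gsec A \<gamma>)" .
    moreover have "(\<lambda>x. x - t) -` gsec A \<gamma> \<in> sets lborel"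
      using B measurable_sets[of "\<lambda>x. x - t" borel borel "gsec A \<gamma>"] by simp
    ultimately show ?thesis unfolding gsec_shift_set by (simp add: emeasure_mono)
  qed
  then have "val2 (shift_set t A) \<le> val2 A"
    unfolding val2_def by (intro infsum_mono nonneg_summable_on_complete) auto
  with 1 show ?thesis
    using A shift_set_Asets[OF A, of t] by (simp add: emeasure_mu emeasure_mu1 emeasure_mu2 add_mono)
qed

lemma nn_integral_shift_fun_le:
  fixes g :: "real \<times> 'g \<Rightarrow> real"
  assumes g [measurable]: "g \<in> borel_measurable mu"
  shows "(\<integral>\<^sup>+ \<omega>. ennreal (shift_fun t g \<omega>) \<partial>mu) \<le> (\<integral>\<^sup>+ \<omega>. ennreal (g \<omega>) \<partial>mu)"
proof -
  define D where "D = shift_set t (Omega :: (real \<times> 'g) set)"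
  define \<phi> where "\<phi> = (\<lambda>(x, \<gamma>::'g). (x - t, \<gamma>))"
  let ?R = "restrict_space mu D"
  have D: "D \<in> Asets" "D \<subseteq> Omega"
    unfolding D_def by (intro shift_set_Asets Asets.top) (auto simp: shift_set_def Omega_def)
  have space: "space ?R = D" using D by (auto simp: space_restrict_space)
  have pre: "\<phi> -` A \<inter> D = shift_set t A" if "A \<subseteq> Omega" for A
    using that by (auto simp: \<phi>_def D_def shift_set_def Omega_def)
  have shiftD: "shift_set t A \<subseteq> D" if "A \<in> Asets" for A
    using that by (auto simp: D_def shift_set_def Omega_def Asets_def)
  have sub: "A \<subseteq> Omega" if "A \<in> Asets" for A :: "(real \<times> 'g) set" using that by (simp add: Asets_def)
  have \<phi>: "\<phi> \<in> measurable ?R mu"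
  proof (rule measurableI)
    show "\<phi> x \<in> space mu" if "x \<in> space ?R" for x
      using that unfolding space by (auto simp: D_def \<phi>_def shift_set_def Omega_def)
    fix A :: "(real \<times> 'g) set" assume A: "A \<in> sets mu"
    then have "\<phi> -` A \<inter> D \<in> sets mu" by (simp add: pre[OF sub] shift_set_Asets)
    then show "\<phi> -` A \<inter> space ?R \<in> sets ?R"
      unfolding space using D by (subst sets_restrict_space_iff) auto
  qed
  have le: "distr ?R mu \<phi> \<le> mu"
  proof -
    have "emeasure (distr ?R mu \<phi>) A \<le> emeasure mu A" for A
    proof (cases "A \<in> Asets")
      case True
      then have "emeasure (distr ?R mu \<phi>) A = emeasure mu (shift_set t A)"
        using D \<phi> by (subst emeasure_distr) (auto simp: space pre[OF sub] emeasure_restrict_space shiftD)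
      then show ?thesis using emeasure_shift_set_le[OF True] by simp
    next
      case False
      then show ?thesis by (simp add: emeasure_notin_sets)
    qed
    then show ?thesis by (simp add: le_measure_iff le_fun_def)
  qed
  have "(\<integral>\<^sup>+ \<omega>. ennreal (shift_fun t g \<omega>) \<partial>mu) = (\<integral>\<^sup>+ \<omega>. ennreal (g (\<phi> \<omega>)) * indicator D \<omega> \<partial>mu)"
    by (intro nn_integral_cong)
      (auto simp: shift_fun_def \<phi>_def D_def shift_set_def Omega_def split: split_indicator if_splits)
  also have "\<dots> = (\<integral>\<^sup>+ \<omega>. ennreal (g (\<phi> \<omega>)) \<partial>?R)"
    using D by (subst nn_integral_restrict_space) auto
  also have "\<dots> = (\<integral>\<^sup>+ \<omega>. ennreal (g \<omega>) \<partial>distr ?R mu \<phi>)"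
    using \<phi> by (subst nn_integral_distr) auto
  also have "\<dots> \<le> (\<integral>\<^sup>+ \<omega>. ennreal (g \<omega>) \<partial>mu)"
    by (rule nn_integral_mono_measure) (use le in auto)
  finally show ?thesis .
qed

lemma Lp_norm_shift_le:
  assumes p: "1 \<le> p" and F: "F \<in> Lp p"
  shows "shift t F \<in> Lp p" "Lp_norm p (shift t F) \<le> Lp_norm p F"
proof -
  obtain f where f [measurable]: "f \<in> borel_measurable mu" and Ff: "F = cls f" by (rule L0_cases)
  have int: "integrable mu (\<lambda>\<omega>. \<bar>f \<omega>\<bar> powr p)" using F Ff f by (simp add: cls_in_Lp)
  have sm [measurable]: "shift_fun t f \<in> borel_measurable mu" by (rule shift_fun_measurable[OF f])
  have "\<bar>shift_fun t f \<omega>\<bar> powr p = shift_fun t (\<lambda>\<omega>. \<bar>f \<omega>\<bar> powr p) \<omega>" for \<omega>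
    by (auto simp: shift_fun_def split: prod.splits)
  then have le: "(\<integral>\<^sup>+ \<omega>. ennreal (\<bar>shift_fun t f \<omega>\<bar> powr p) \<partial>mu) \<le> (\<integral>\<^sup>+ \<omega>. ennreal (\<bar>f \<omega>\<bar> powr p) \<partial>mu)"
    using nn_integral_shift_fun_le[of "\<lambda>\<omega>. \<bar>f \<omega>\<bar> powr p" t] by simp
  also have fin: "\<dots> = ennreal (LINT \<omega>|mu. \<bar>f \<omega>\<bar> powr p)"
    by (rule nn_integral_eq_integral[OF int]) simp
  finally have "(\<integral>\<^sup>+ \<omega>. ennreal (\<bar>shift_fun t f \<omega>\<bar> powr p) \<partial>mu) < \<infinity>"
    by (simp add: le_less_trans)
  then have int': "integrable mu (\<lambda>\<omega>. \<bar>shift_fun t f \<omega>\<bar> powr p)"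
    by (intro integrableI_bounded) auto
  then show "shift t F \<in> Lp p" by (simp add: Ff cls_shift cls_in_Lp)
  have "(LINT \<omega>|mu. \<bar>shift_fun t f \<omega>\<bar> powr p) \<le> (LINT \<omega>|mu. \<bar>f \<omega>\<bar> powr p)"
    using le unfolding fin by (simp add: nn_integral_eq_integral[OF int'])
  then show "Lp_norm p (shift t F) \<le> Lp_norm p F"
    using p by (simp add: Ff cls_shift Lp_norm_cls powr_mono2)
qed

section \<open>The two bands\<close>

lemma AE_mu1: "AE \<omega> in mu. P \<omega> \<Longrightarrow> AE \<omega> in mu1. P \<omega>"
  by (rule absolutely_continuous_AE[of mu1 mu])
    (auto simp: absolutely_continuous_def null_sets_def emeasure_mu)

lemma AE_mu_iff: "(AE \<omega> in mu. P \<omega>) \<longleftrightarrow> (AE \<omega> in mu1. P \<omega>) \<and> (AE \<omega> in mu2. P \<omega>)"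
proof (intro iffI conjI AE_mu1 AE_mu2; (elim conjE)?)
  assume "AE \<omega> in mu1. P \<omega>" "AE \<omega> in mu2. P \<omega>"
  then obtain A B where A: "A \<in> null_sets mu1" "{\<omega> \<in> Omega. \<not> P \<omega>} \<subseteq> A"
    and B: "B \<in> null_sets mu2" "{\<omega> \<in> Omega. \<not> P \<omega>} \<subseteq> B"
    by (auto simp: eventually_ae_filter)
  have "A \<inter> B \<in> sets mu1" using A B by (intro sets.Int) (auto simp: null_sets_def)
  then have AB: "A \<inter> B \<in> Asets" by simp
  have "emeasure mu1 (A \<inter> B) = 0" "emeasure mu2 (A \<inter> B) = 0"
    using A B AB emeasure_mono[of "A \<inter> B" A mu1] emeasure_mono[of "A \<inter> B" B mu2]
    by (auto simp: null_sets_def)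
  then have "A \<inter> B \<in> null_sets mu" using AB by (simp add: null_sets_def emeasure_mu)
  then show "AE \<omega> in mu. P \<omega>" by (rule AE_I') (use A B in auto)
qed

lift_definition zero_AE_mu1 :: "'g L0 \<Rightarrow> bool" is "\<lambda>f. AE \<omega> in mu1. f \<omega> = 0"
  unfolding ae_eq_def
  by (elim conjE, rule eventually_subst, drule AE_mu1, erule eventually_mono, simp)

text \<open>This is \<open>M\<^sup>\<bottom>\<close>, as shown in \<open>disj_compl_bandM\<close> below.\<close>

definition bandN :: "real \<Rightarrow> 'g L0 set" where
  "bandN p = {f \<in> Lp p. zero_AE_mu1 f}"

lemma zero_AE_mu1_cls: "f \<in> borel_measurable mu \<Longrightarrow> zero_AE_mu1 (cls f) \<longleftrightarrow> (AE \<omega> in mu1. f \<omega> = 0)"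
  and zero_AE_mu2_cls: "f \<in> borel_measurable mu \<Longrightarrow> zero_AE_mu2 (cls f) \<longleftrightarrow> (AE \<omega> in mu2. f \<omega> = 0)"
  by (simp_all add: zero_AE_mu1.abs_eq zero_AE_mu2.abs_eq ae_eq_refl)

lemma cls_in_bandM: "f \<in> borel_measurable mu \<Longrightarrow> cls f \<in> bandM p \<longleftrightarrow> cls f \<in> Lp p \<and> (AE \<omega> in mu2. f \<omega> = 0)"
  and cls_in_bandN: "f \<in> borel_measurable mu \<Longrightarrow> cls f \<in> bandN p \<longleftrightarrow> cls f \<in> Lp p \<and> (AE \<omega> in mu1. f \<omega> = 0)"
  by (auto simp: bandM_def bandN_def zero_AE_mu1_cls zero_AE_mu2_cls)

lemma AE_mu1_I:
  assumes "\<And>x. x \<in> {0<..<1} \<Longrightarrow> countable {\<gamma>. \<not> P (x, \<gamma>)}" "{\<omega> \<in> Omega. \<not> P \<omega>} \<in> Asets"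
  shows "AE \<omega> in mu1. P \<omega>"
proof (rule AE_I)
  show "{\<omega> \<in> space mu1. \<not> P \<omega>} \<subseteq> {\<omega> \<in> Omega. \<not> P \<omega>}" by simp
  show "{\<omega> \<in> Omega. \<not> P \<omega>} \<in> sets mu1" using assms by simp
  have "countable (xsec {\<omega> \<in> Omega. \<not> P \<omega>} x)" if "x \<in> {0<..<1}" for x
    by (rule countable_subset[OF _ assms(1)[OF that]]) (auto simp: xsec_def)
  then show "emeasure mu1 {\<omega> \<in> Omega. \<not> P \<omega>} = 0"
    using assms(2) by (auto simp: emeasure_mu1 val1_def infsum_eq_0_iff_ennreal nu_def)
qed

lemma AE_mu2_I:
  assumes "\<And>\<gamma>. emeasure lborel {x\<in>{0<..<1}. \<not> P (x, \<gamma>)} = 0" "{\<omega> \<in> Omega. \<not> P \<omega>} \<in> Asets"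
  shows "AE \<omega> in mu2. P \<omega>"
proof (rule AE_I)
  show "{\<omega> \<in> space mu2. \<not> P \<omega>} \<subseteq> {\<omega> \<in> Omega. \<not> P \<omega>}" by simp
  show "{\<omega> \<in> Omega. \<not> P \<omega>} \<in> sets mu2" using assms by simp
  have "gsec {\<omega> \<in> Omega. \<not> P \<omega>} \<gamma> = {x\<in>{0<..<1}. \<not> P (x, \<gamma>)}" for \<gamma>
    by (auto simp: gsec_def Omega_def)
  then show "emeasure mu2 {\<omega> \<in> Omega. \<not> P \<omega>} = 0"
    using assms by (auto simp: emeasure_mu2 val2_def infsum_eq_0_iff_ennreal)
qed

text \<open>A finite sum has only finitely many terms above each bound \<open>1 / (n + 1)\<close>.\<close>

lemma countable_support_infsum:
  fixes f :: "'b \<Rightarrow> ennreal"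
  assumes fin: "(\<Sum>\<^sub>\<infinity>x\<in>X. f x) < \<infinity>"
  shows "countable {x\<in>X. f x \<noteq> 0}"
proof -
  have "finite {x\<in>X. f x \<ge> ennreal (1 / real (Suc n))}" for n
  proof (rule ccontr)
    let ?Y = "{x\<in>X. f x \<ge> ennreal (1 / real (Suc n))}"
    assume inf: "infinite ?Y"
    obtain C where C: "(\<Sum>\<^sub>\<infinity>x\<in>X. f x) = ennreal C" "0 \<le> C"
      using fin by (cases "\<Sum>\<^sub>\<infinity>x\<in>X. f x") auto
    obtain k :: nat where k: "C * real (Suc n) < real k" using reals_Archimedean2 by blast
    obtain F where F: "finite F" "card F = k" "F \<subseteq> ?Y"
      using infinite_arbitrarily_large[OF inf] by blast
    have "ennreal (real k * (1 / real (Suc n))) = (\<Sum>x\<in>F. ennreal (1 / real (Suc n)))"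
      using F by (subst sum_ennreal) simp_all
    also have "\<dots> \<le> sum f F" using F by (intro sum_mono) auto
    also have "\<dots> \<le> (\<Sum>\<^sub>\<infinity>x\<in>X. f x)"
      using F by (subst nonneg_infsum_complete) (simp, intro SUP_upper, auto)
    finally have "real k * (1 / real (Suc n)) \<le> C"
      using C by (simp add: ennreal_le_iff)
    then show False using k by (simp add: field_simps)
  qed
  then have "countable (\<Union>n. {x\<in>X. f x \<ge> ennreal (1 / real (Suc n))})"
    by (intro countable_UN) (auto intro: countable_finite)
  moreover have "{x\<in>X. f x \<noteq> 0} \<subseteq> (\<Union>n. {x\<in>X. f x \<ge> ennreal (1 / real (Suc n))})"
  proof safe
    fix x assume x: "x \<in> X" "f x \<noteq> 0"
    show "x \<in> (\<Union>n. {x\<in>X. f x \<ge> ennreal (1 / real (Suc n))})"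
    proof (cases "f x = \<infinity>")
      case False
      then obtain r where r: "f x = ennreal r" "r > 0" using x by (cases "f x") (auto simp: less_le)
      then obtain n where "1 / real (Suc n) < r" using nat_approx_posE by blast
      then show ?thesis using x r by (auto intro!: exI[of _ n] ennreal_leI)
    qed (use x in auto)
  qed
  ultimately show ?thesis by (rule countable_subset[rotated])
qed

lemma Lp_level_set:
  assumes f [measurable]: "f \<in> borel_measurable mu" and fL: "cls f \<in> Lp p" and p: "1 \<le> p"
  shows "{\<omega> \<in> Omega. \<bar>f \<omega>\<bar> \<ge> 1 / real (Suc k)} \<in> Asets"
    "emeasure mu {\<omega> \<in> Omega. \<bar>f \<omega>\<bar> \<ge> 1 / real (Suc k)} < \<infinity>"
proof -
  let ?A = "{\<omega> \<in> Omega. \<bar>f \<omega>\<bar> \<ge> 1 / real (Suc k)}"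
  have "?A = {\<omega> \<in> space mu. \<bar>f \<omega>\<bar> \<ge> 1 / real (Suc k)}" by simp
  also have "\<dots> \<in> sets mu" by measurable
  finally show A: "?A \<in> Asets" by simp
  have int: "integrable mu (\<lambda>\<omega>. \<bar>f \<omega>\<bar> powr p)" using fL by (simp add: cls_in_Lp)
  define c where "c = (1 / real (Suc k)) powr p"
  have c: "c > 0" by (simp add: c_def)
  have "?A \<subseteq> {\<omega> \<in> space mu. c \<le> \<bar>f \<omega>\<bar> powr p}"
    using p by (auto simp: c_def intro!: powr_mono2)
  moreover have "{\<omega> \<in> space mu. c \<le> \<bar>f \<omega>\<bar> powr p} \<in> sets mu" by measurable
  ultimately have "emeasure mu ?A \<le> emeasure mu {\<omega> \<in> space mu. c \<le> \<bar>f \<omega>\<bar> powr p}"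
    by (rule emeasure_mono)
  also have "\<dots> < \<infinity>"
  proof -
    have "emeasure mu {\<omega> \<in> space mu. c \<le> \<bar>f \<omega>\<bar> powr p} \<le> ennreal ((1 / c) * (LINT \<omega>|mu. \<bar>f \<omega>\<bar> powr p))"
      by (rule integral_Markov_inequality[OF int]) (use c in auto)
    also have "\<dots> < \<infinity>" by simp
    finally show ?thesis .
  qed
  finally show "emeasure mu ?A < \<infinity>" .
qed

text \<open>Each level set of \<open>|f|\<close> has finite measure for \<open>\<mu>'\<close> and \<open>\<mu>''\<close>, which are sums over the sections.
So only countably many sections contribute. The first claim yields the component in \<open>M\<close>; the second
one reduces questions about \<open>M\<^sup>\<bottom>\<close> to single fibres.\<close>

lemma Lp_countable_sections:
  assumes f [measurable]: "f \<in> borel_measurable mu" and fL: "cls f \<in> Lp p" and p: "1 \<le> p"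
  shows "countable {x\<in>{0<..<1}. uncountable {\<gamma>. f (x, \<gamma>) \<noteq> 0}}"
    "countable {\<gamma>. emeasure lborel {x\<in>{0<..<1}. f (x, \<gamma>) \<noteq> 0} \<noteq> 0}"
proof -
  define A where "A k = {\<omega> \<in> Omega. \<bar>f \<omega>\<bar> \<ge> 1 / real (Suc k)}" for k :: nat
  have A: "A k \<in> Asets" "emeasure mu (A k) < \<infinity>" for k
    unfolding A_def using Lp_level_set[OF assms, of k] by auto
  have fin: "val1 (A k) < \<infinity>" "val2 (A k) < \<infinity>" for k
    using A[of k] by (simp_all add: emeasure_mu emeasure_mu1 emeasure_mu2)
  have UN: "f \<omega> \<noteq> 0 \<longleftrightarrow> (\<exists>k. \<omega> \<in> A k)" if "\<omega> \<in> Omega" for \<omega>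
  proof
    assume "f \<omega> \<noteq> 0"
    then obtain k where "1 / real (Suc k) < \<bar>f \<omega>\<bar>" using nat_approx_posE[of "\<bar>f \<omega>\<bar>"] by auto
    then show "\<exists>k. \<omega> \<in> A k" using that by (auto simp: A_def intro!: exI[of _ k])
  qed (auto simp: A_def)
  have xs: "{\<gamma>. f (x, \<gamma>) \<noteq> 0} = (\<Union>k. xsec (A k) x)" if "x \<in> {0<..<1}" for x
    using that UN by (auto simp: xsec_def Omega_def)
  have gs: "{x\<in>{0<..<1}. f (x, \<gamma>) \<noteq> 0} = (\<Union>k. gsec (A k) \<gamma>)" for \<gamma>
    using UN by (auto simp: gsec_def Omega_def A_def)
  have "{x\<in>{0<..<1}. uncountable {\<gamma>. f (x, \<gamma>) \<noteq> 0}} \<subseteq> (\<Union>k. {x\<in>{0<..<1}. nu (xsec (A k) x) \<noteq> 0})"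
  proof (rule subsetI, rule ccontr)
    fix x
    assume 1: "x \<in> {x\<in>{0<..<1}. uncountable {\<gamma>. f (x, \<gamma>) \<noteq> 0}}"
      and 2: "x \<notin> (\<Union>k. {x\<in>{0<..<1}. nu (xsec (A k) x) \<noteq> 0})"
    then have "countable (xsec (A k) x)" for k by (auto simp: nu_def split: if_splits)
    with 1 xs[of x] show False by simp
  qed
  moreover have "countable (\<Union>k. {x\<in>{0<..<1}. nu (xsec (A k) x) \<noteq> 0})"
    using fin by (intro countable_UN countable_support_infsum) (auto simp: val1_def)
  ultimately show "countable {x\<in>{0<..<1}. uncountable {\<gamma>. f (x, \<gamma>) \<noteq> 0}}"
    by (rule countable_subset)
  have "{\<gamma>. emeasure lborel {x\<in>{0<..<1}. f (x, \<gamma>) \<noteq> 0} \<noteq> 0} \<subseteq>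
      (\<Union>k. {\<gamma>\<in>UNIV. emeasure lborel (gsec (A k) \<gamma>) \<noteq> 0})"
  proof (rule subsetI, rule ccontr)
    fix \<gamma>
    assume 1: "\<gamma> \<in> {\<gamma>. emeasure lborel {x\<in>{0<..<1}. f (x, \<gamma>) \<noteq> 0} \<noteq> 0}"
      and 2: "\<gamma> \<notin> (\<Union>k. {\<gamma>\<in>UNIV. emeasure lborel (gsec (A k) \<gamma>) \<noteq> 0})"
    have "gsec (A k) \<gamma> \<in> null_sets lborel" for k
      using 2 A(1)[of k] by (auto simp: null_sets_def Asets_def)
    then have "(\<Union>k. gsec (A k) \<gamma>) \<in> null_sets lborel" by (intro null_sets_UN)
    then have "emeasure lborel {x\<in>{0<..<1}. f (x, \<gamma>) \<noteq> 0} = 0"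
      unfolding gs by (simp add: null_sets_def)
    with 1 show False by simp
  qed
  moreover have "countable (\<Union>k. {\<gamma>\<in>UNIV. emeasure lborel (gsec (A k) \<gamma>) \<noteq> 0})"
    using fin by (intro countable_UN countable_support_infsum) (auto simp: val2_def)
  ultimately show "countable {\<gamma>. emeasure lborel {x\<in>{0<..<1}. f (x, \<gamma>) \<noteq> 0} \<noteq> 0}"
    by (rule countable_subset)
qed

lemma measurable_mu_sections:
  fixes f :: "real \<times> 'g \<Rightarrow> real"
  assumes f: "f \<in> borel_measurable mu"
  shows "{\<omega> \<in> Omega. f \<omega> \<noteq> 0} \<in> Asets" "(\<lambda>x. if x \<in> {0<..<1} then f (x, \<gamma>) else 0) \<in> borel_measurable borel"
proof -
  have pre: "f -` B \<inter> Omega \<in> Asets" if "B \<in> sets borel" for B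
    using measurable_sets[OF f that] by simp
  have "{\<omega> \<in> Omega. f \<omega> \<noteq> 0} = f -` (- {0}) \<inter> Omega" by auto
  moreover have "- {0::real} \<in> sets borel" by (intro borel_comp) simp
  ultimately show "{\<omega> \<in> Omega. f \<omega> \<noteq> 0} \<in> Asets" by (simp only: pre)
  show "(\<lambda>x. if x \<in> {0<..<1} then f (x, \<gamma>) else 0) \<in> borel_measurable borel"
  proof (rule measurableI)
    fix B :: "real set" assume B: "B \<in> sets borel"
    have "(\<lambda>x. if x \<in> {0<..<1} then f (x, \<gamma>) else 0) -` B \<inter> space borel =
        gsec (f -` B \<inter> Omega) \<gamma> \<union> (if 0 \<in> B then - {0<..<1} else {})"
      by (auto simp: gsec_def Omega_def split: if_splits)
    moreover have "gsec (f -` B \<inter> Omega) \<gamma> \<in> sets borel" using pre[OF B] by (simp add: Asets_def)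
    moreover have "- {0<..<1::real} \<in> sets borel" by (intro borel_comp) simp
    ultimately show "(\<lambda>x. if x \<in> {0<..<1} then f (x, \<gamma>) else 0) -` B \<inter> space borel \<in> sets borel"
      by auto
  qed simp
qed

text \<open>A function with Borel sections \<open>f (\<cdot>, \<gamma>)\<close> is measurable if each \<open>f (x, \<cdot>)\<close> equals a constant \<open>c x\<close>
up to countably many points. With \<open>c = 0\<close> this covers functions on a fibre, and without exceptional
points it covers functions of \<open>x\<close>.\<close>

lemma measurable_muI:
  fixes f :: "real \<times> 'g \<Rightarrow> real"
  assumes meas: "\<And>\<gamma>. (\<lambda>x. if x \<in> {0<..<1} then f (x, \<gamma>) else 0) \<in> borel_measurable borel"
    and cnt: "\<And>x. x \<in> {0<..<1} \<Longrightarrow> countable {\<gamma>. f (x, \<gamma>) \<noteq> c x}"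
  shows "f \<in> borel_measurable mu"
proof (rule measurableI)
  fix B :: "real set" assume B: "B \<in> sets borel"
  have "f -` B \<inter> Omega \<in> Asets"
    unfolding Asets_def
  proof (intro CollectI conjI ballI allI)
    show "f -` B \<inter> Omega \<subseteq> Omega" by simp
    fix x :: real assume x: "x \<in> {0<..<1}"
    then have sec: "xsec (f -` B \<inter> Omega) x = {\<gamma>. f (x, \<gamma>) \<in> B}" by (auto simp: xsec_def Omega_def)
    show "countable (xsec (f -` B \<inter> Omega) x) \<or> countable (- xsec (f -` B \<inter> Omega) x)"
    proof (cases "c x \<in> B")
      case True
      then have "- {\<gamma>. f (x, \<gamma>) \<in> B} \<subseteq> {\<gamma>. f (x, \<gamma>) \<noteq> c x}" by auto
      then show ?thesis unfolding sec using cnt[OF x] countable_subset by blast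
    next
      case False
      then have "{\<gamma>. f (x, \<gamma>) \<in> B} \<subseteq> {\<gamma>. f (x, \<gamma>) \<noteq> c x}" by auto
      then show ?thesis unfolding sec using cnt[OF x] countable_subset by blast
    qed
  next
    fix \<gamma>
    have "gsec (f -` B \<inter> Omega) \<gamma> = {0<..<1} \<inter> ((\<lambda>x. if x \<in> {0<..<1} then f (x, \<gamma>) else 0) -` B \<inter> space borel)"
      by (auto simp: gsec_def Omega_def)
    also have "\<dots> \<in> sets borel" using measurable_sets[OF meas B] by (intro sets.Int) auto
    finally show "gsec (f -` B \<inter> Omega) \<gamma> \<in> sets borel" .
  qed
  then show "f -` B \<inter> space mu \<in> sets mu" by simp
qed simp

lemma measurable_mu_fst:
  fixes \<phi> :: "real \<Rightarrow> real"
  shows "(\<lambda>x. if x \<in> {0<..<1} then \<phi> x else 0) \<in> borel_measurable borel \<Longrightarrow> (\<lambda>(x, \<gamma>). \<phi> x) \<in> borel_measurable mu"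
  by (rule measurable_muI[where c = \<phi>]) auto

lemma Lp_indicator_times:
  assumes p: "1 \<le> p" and f: "f \<in> borel_measurable mu" "cls f \<in> Lp p" and A: "A \<in> Asets"
  shows "(\<lambda>\<omega>. indicator A \<omega> * f \<omega>) \<in> borel_measurable mu"
    "cls (\<lambda>\<omega>. indicator A \<omega> * f \<omega>) \<in> Lp p"
    "Lp_norm p (cls (\<lambda>\<omega>. indicator A \<omega> * f \<omega>)) \<le> Lp_norm p (cls f)"
proof -
  have A': "A \<in> sets mu" using A by simp
  show m: "(\<lambda>\<omega>. indicator A \<omega> * f \<omega>) \<in> borel_measurable mu" using A' f by measurable
  have le: "AE \<omega> in mu. \<bar>indicator A \<omega> * f \<omega>\<bar> \<le> 1 * \<bar>f \<omega>\<bar>"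
    by (auto split: split_indicator)
  show "cls (\<lambda>\<omega>. indicator A \<omega> * f \<omega>) \<in> Lp p"
    "Lp_norm p (cls (\<lambda>\<omega>. indicator A \<omega> * f \<omega>)) \<le> Lp_norm p (cls f)"
    using Lp_bounded_by[OF m f p le] by simp_all
qed

text \<open>Let \<open>S\<close> be the countable set of all \<open>x\<close> for which \<open>f (x, \<cdot>)\<close> is nonzero at uncountably many points.
On \<open>S \<times> \<Gamma>\<close> the function vanishes \<open>\<mu>''\<close>-almost everywhere, because \<open>S\<close> is a Lebesgue null set; off
\<open>S \<times> \<Gamma>\<close> it vanishes \<open>\<mu>'\<close>-almost everywhere, by the choice of \<open>S\<close>.\<close>

lemma Lp_band_decomposition:
  assumes p: "1 \<le> p" and F: "F \<in> Lp p"
  obtains F1 F2 where "F = F1 + F2" "F1 \<in> bandM p" "F2 \<in> bandN p"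
    "Lp_norm p F1 \<le> Lp_norm p F" "Lp_norm p F2 \<le> Lp_norm p F"
proof -
  obtain f where f: "f \<in> borel_measurable mu" and Ff: "F = cls f" by (rule L0_cases)
  have fL: "cls f \<in> Lp p" using F Ff by simp
  define S where "S = {x\<in>{0<..<1}. uncountable {\<gamma>. f (x, \<gamma>) \<noteq> 0}}"
  have S: "countable S" "S \<subseteq> {0<..<1}"
    unfolding S_def using Lp_countable_sections(1)[OF f fL p] by auto
  define A where "A = S \<times> (UNIV :: 'a set)"
  have xA: "xsec A x = (if x \<in> S then UNIV else {})" and gA: "gsec A \<gamma> = S" for x \<gamma>
    by (auto simp: A_def xsec_def gsec_def)
  have Sb: "S \<in> sets borel" "emeasure lborel S = 0"
    using countable_imp_null_set_lborel[OF S(1)] by (auto simp: null_sets_def)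
  have A: "A \<in> Asets" "Omega - A \<in> Asets"
  proof -
    show "A \<in> Asets" using S Sb by (auto simp: Asets_def xA gA) (auto simp: A_def Omega_def)
    then show "Omega - A \<in> Asets" using sets.compl_sets[of A mu] by simp
  qed
  let ?f1 = "\<lambda>\<omega>. indicator A \<omega> * f \<omega>" and ?f2 = "\<lambda>\<omega>. indicator (Omega - A) \<omega> * f \<omega>"
  note f1 = Lp_indicator_times[OF p f fL A(1)] and f2 = Lp_indicator_times[OF p f fL A(2)]
  show ?thesis
  proof (rule that[of "cls ?f1" "cls ?f2"])
    have "AE \<omega> in mu. f \<omega> = ?f1 \<omega> + ?f2 \<omega>" by (rule AE_I2) (auto split: split_indicator)
    then show "F = cls ?f1 + cls ?f2" using f f1(1) f2(1) by (simp add: Ff cls_plus cls_eq_iff)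
    have "AE \<omega> in mu2. ?f1 \<omega> = 0"
    proof (rule AE_mu2_I)
      show "{\<omega> \<in> Omega. ?f1 \<omega> \<noteq> 0} \<in> Asets" by (rule measurable_mu_sections[OF f1(1)])
      show "emeasure lborel {x\<in>{0<..<1}. ?f1 (x, \<gamma>) \<noteq> 0} = 0" for \<gamma>
      proof -
        have "emeasure lborel {x\<in>{0<..<1}. ?f1 (x, \<gamma>) \<noteq> 0} \<le> emeasure lborel S"
          using Sb by (intro emeasure_mono) (auto simp: A_def split: split_indicator_asm)
        then show ?thesis using Sb by simp
      qed
    qed
    then show "cls ?f1 \<in> bandM p" using f1 by (simp add: cls_in_bandM)
    have "AE \<omega> in mu1. ?f2 \<omega> = 0"
    proof (rule AE_mu1_I)
      show "{\<omega> \<in> Omega. ?f2 \<omega> \<noteq> 0} \<in> Asets" by (rule measurable_mu_sections[OF f2(1)])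
      fix x :: real assume x: "x \<in> {0<..<1}"
      show "countable {\<gamma>. ?f2 (x, \<gamma>) \<noteq> 0}"
      proof (cases "x \<in> S")
        case True
        then have "{\<gamma>. ?f2 (x, \<gamma>) \<noteq> 0} = {}" by (auto simp: A_def)
        then show ?thesis by (simp only: countable_empty)
      next
        case False
        then have "countable {\<gamma>. f (x, \<gamma>) \<noteq> 0}" using x by (auto simp: S_def)
        then show ?thesis by (rule countable_subset[rotated]) auto
      qed
    qed
    then show "cls ?f2 \<in> bandN p" using f2 by (simp add: cls_in_bandN)
    show "Lp_norm p (cls ?f1) \<le> Lp_norm p F" "Lp_norm p (cls ?f2) \<le> Lp_norm p F"
      using f1 f2 Ff by simp_all
  qed
qed

lemma bandM_inter_bandN: "F \<in> bandM p \<Longrightarrow> F \<in> bandN p \<Longrightarrow> F = 0"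
  by (cases F rule: L0_cases) (auto simp: cls_in_bandM cls_in_bandN zero_L0_def cls_eq_iff AE_mu_iff)

lemma bands_subset: "F \<in> bandM p \<Longrightarrow> F \<in> Lp p" "F \<in> bandN p \<Longrightarrow> F \<in> Lp p"
  by (auto simp: bandM_def bandN_def)

lemma subspace_bands:
  assumes p: "1 \<le> p"
  shows "subspace (bandM p :: 'g L0 set)" "subspace (bandN p :: 'g L0 set)"
proof -
  interpret normed_subspace "Lp p :: 'g L0 set" "Lp_norm p" by (rule normed_subspace_Lp[OF p])
  have "zero_AE_mu1 (0 :: 'g L0)" "zero_AE_mu2 (0 :: 'g L0)" by (simp_all add: zero_L0_def zero_AE_mu1_cls zero_AE_mu2_cls)
  moreover have "zero_AE_mu1 F \<Longrightarrow> zero_AE_mu1 G \<Longrightarrow> zero_AE_mu1 (F + G)"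
    "zero_AE_mu2 F \<Longrightarrow> zero_AE_mu2 G \<Longrightarrow> zero_AE_mu2 (F + G)" for F G :: "'g L0"
    by (transfer; auto elim!: eventually_elim2)+
  moreover have "zero_AE_mu1 F \<Longrightarrow> zero_AE_mu1 (c *\<^sub>R F)"
    "zero_AE_mu2 F \<Longrightarrow> zero_AE_mu2 (c *\<^sub>R F)" for F :: "'g L0" and c
    by (transfer; auto elim!: eventually_mono)+
  ultimately show "subspace (bandM p :: 'g L0 set)" "subspace (bandN p :: 'g L0 set)"
    by (auto simp: subspace_def bandM_def bandN_def)
qed

lemma bands_closed:
  assumes p: "1 \<le> p"
  shows "0 \<in> bandM p" "F \<in> bandM p \<Longrightarrow> G \<in> bandM p \<Longrightarrow> F + G \<in> bandM p"
    "F \<in> bandM p \<Longrightarrow> G \<in> bandM p \<Longrightarrow> F - G \<in> bandM p" "F \<in> bandM p \<Longrightarrow> c *\<^sub>R F \<in> bandM p"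
    "0 \<in> bandN p" "F \<in> bandN p \<Longrightarrow> G \<in> bandN p \<Longrightarrow> F + G \<in> bandN p"
    "F \<in> bandN p \<Longrightarrow> G \<in> bandN p \<Longrightarrow> F - G \<in> bandN p" "F \<in> bandN p \<Longrightarrow> c *\<^sub>R F \<in> bandN p"
  by (rule subspace_0 subspace_add subspace_diff subspace_scale, rule subspace_bands[OF p], assumption?, assumption?)+

lemma inf_eq_0_bands:
  assumes "F \<in> bandN p" "G \<in> bandM p"
  shows "inf \<bar>F\<bar> \<bar>G\<bar> = 0"
proof -
  obtain f g where f: "f \<in> borel_measurable mu" "F = cls f" and g: "g \<in> borel_measurable mu" "G = cls g"
    by (metis L0_ex_cls)
  have "AE \<omega> in mu1. min \<bar>f \<omega>\<bar> \<bar>g \<omega>\<bar> = 0" "AE \<omega> in mu2. min \<bar>f \<omega>\<bar> \<bar>g \<omega>\<bar> = 0"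
    using assms f g by (auto simp: cls_in_bandM cls_in_bandN elim!: eventually_mono)
  then have "cls (\<lambda>\<omega>. min \<bar>f \<omega>\<bar> \<bar>g \<omega>\<bar>) = cls (\<lambda>_. 0)"
    using f g by (subst cls_eq_iff) (auto simp: AE_mu_iff)
  then show ?thesis
    using f g by (simp add: abs_L0.abs_eq inf_L0.abs_eq ae_eq_refl zero_L0_def)
qed

text \<open>If \<open>F = F1 + F2\<close> is disjoint from \<open>F1 \<in> M\<close>, then \<open>F1\<close> vanishes also \<open>\<mu>'\<close>-almost everywhere, because
there \<open>F\<close> and \<open>F1\<close> agree.\<close>

theorem disj_compl_bandM:
  assumes p: "1 \<le> p"
  shows "disj_compl (Lp p) (bandM p) = bandN p"
proof (intro equalityI subsetI)
  fix F :: "'a L0" assume F: "F \<in> disj_compl (Lp p) (bandM p)"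
  then have FL: "F \<in> Lp p" by (simp add: disj_compl_def)
  obtain F1 F2 where d: "F = F1 + F2" "F1 \<in> bandM p" "F2 \<in> bandN p"
    using Lp_band_decomposition[OF p FL] by metis
  obtain f g where f: "f \<in> borel_measurable mu" "F1 = cls f" and g: "g \<in> borel_measurable mu" "F2 = cls g"
    by (metis L0_ex_cls)
  have "inf \<bar>F\<bar> \<bar>F1\<bar> = 0" using F d by (simp add: disj_compl_def)
  then have 0: "AE \<omega> in mu. min \<bar>f \<omega> + g \<omega>\<bar> \<bar>f \<omega>\<bar> = 0"
    using f g d by (simp add: cls_plus abs_L0.abs_eq inf_L0.abs_eq ae_eq_refl zero_L0_def cls_eq_iff)
  have "AE \<omega> in mu1. f \<omega> = 0"
  proof -
    have "AE \<omega> in mu1. g \<omega> = 0" using d g by (simp add: cls_in_bandN)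
    with AE_mu1[OF 0] show ?thesis by eventually_elim simp
  qed
  then have "F1 \<in> bandN p" using d f by (simp add: cls_in_bandM cls_in_bandN)
  then have "F1 = 0" using d bandM_inter_bandN by blast
  then show "F \<in> bandN p" using d by simp
next
  fix F :: "'a L0" assume "F \<in> bandN p"
  then show "F \<in> disj_compl (Lp p) (bandM p)"
    using inf_eq_0_bands[of F p] by (auto simp: disj_compl_def bandN_def)
qed

abbreviation projM :: "real \<Rightarrow> 'g L0 \<Rightarrow> 'g L0" where
  "projM p \<equiv> band_proj (Lp p) (bandM p)"

lemma projM_eq:
  assumes p: "1 \<le> p" and "F1 \<in> bandM p" "F2 \<in> bandN p"
  shows "projM p (F1 + F2) = F1"
  unfolding band_proj_def disj_compl_bandM[OF p]
proof (rule the_equality)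
  show "F1 \<in> bandM p \<and> F1 + F2 - F1 \<in> bandN p" using assms by simp
  fix G assume G: "G \<in> bandM p \<and> F1 + F2 - G \<in> bandN p"
  have "G - F1 \<in> bandM p" using G assms by (simp add: bands_closed)
  moreover have "F2 - (F1 + F2 - G) \<in> bandN p"
    using bands_closed(7)[OF p, of F2 "F1 + F2 - G"] G assms by blast
  ultimately have "G - F1 = 0" by (intro bandM_inter_bandN[of _ p]) auto
  then show "G = F1" by simp
qed

lemma projM:
  assumes p: "1 \<le> p" and F: "F \<in> Lp p"
  shows "projM p F \<in> bandM p" "F - projM p F \<in> bandN p"
    "Lp_norm p (projM p F) \<le> Lp_norm p F" "Lp_norm p (F - projM p F) \<le> Lp_norm p F"
proof -
  obtain F1 F2 where d: "F = F1 + F2" "F1 \<in> bandM p" "F2 \<in> bandN p"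
    "Lp_norm p F1 \<le> Lp_norm p F" "Lp_norm p F2 \<le> Lp_norm p F"
    using Lp_band_decomposition[OF p F] by metis
  have "projM p F = F1" unfolding d(1) by (rule projM_eq[OF p d(2,3)])
  then show "projM p F \<in> bandM p" "F - projM p F \<in> bandN p"
    "Lp_norm p (projM p F) \<le> Lp_norm p F" "Lp_norm p (F - projM p F) \<le> Lp_norm p F"
    using d by auto
qed

lemma projM_add:
  assumes p: "1 \<le> p" and "F \<in> Lp p" "G \<in> Lp p"
  shows "projM p (F + G) = projM p F + projM p G"
proof -
  have "projM p ((projM p F + projM p G) + ((F - projM p F) + (G - projM p G))) = projM p F + projM p G"
    using projM[OF p assms(2)] projM[OF p assms(3)]
    by (intro projM_eq p) (auto intro: bands_closed[OF p])
  then show ?thesis by (simp add: algebra_simps)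
qed

lemma projM_scaleR:
  assumes p: "1 \<le> p" and "F \<in> Lp p"
  shows "projM p (c *\<^sub>R F) = c *\<^sub>R projM p F"
proof -
  have "projM p (c *\<^sub>R projM p F + c *\<^sub>R (F - projM p F)) = c *\<^sub>R projM p F"
    using projM[OF p assms(2)] by (intro projM_eq p) (auto intro: bands_closed[OF p])
  then show ?thesis by (simp add: algebra_simps)
qed

lemma projM_id: "1 \<le> p \<Longrightarrow> F \<in> bandM p \<Longrightarrow> projM p F = F"
  using projM_eq[of p F 0] by (simp add: bands_closed)

lemma projM_0: "1 \<le> p \<Longrightarrow> F \<in> bandN p \<Longrightarrow> projM p F = 0"
  using projM_eq[of p 0 F] by (simp add: bands_closed)

lemma mult_bounded_Lp:
  assumes p: "1 \<le> p" and h: "h \<in> borel_measurable mu" and le: "AE \<omega> in mu. \<bar>h \<omega>\<bar> \<le> c" and c: "0 \<le> c"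
    and F: "F \<in> Lp p"
  shows "cls h * F \<in> Lp p" "Lp_norm p (cls h * F) \<le> c * Lp_norm p F"
    "F \<in> bandM p \<Longrightarrow> cls h * F \<in> bandM p" "F \<in> bandN p \<Longrightarrow> cls h * F \<in> bandN p"
proof -
  obtain f where f: "f \<in> borel_measurable mu" and Ff: "F = cls f" by (rule L0_cases)
  have m: "(\<lambda>\<omega>. h \<omega> * f \<omega>) \<in> borel_measurable mu" using h f by measurable
  have "AE \<omega> in mu. \<bar>h \<omega> * f \<omega>\<bar> \<le> c * \<bar>f \<omega>\<bar>"
    using le by eventually_elim (simp add: abs_mult mult_right_mono)
  note b = Lp_bounded_by[OF m f F[unfolded Ff] p this c]
  then show L: "cls h * F \<in> Lp p" "Lp_norm p (cls h * F) \<le> c * Lp_norm p F"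
    using h f by (simp_all add: Ff cls_times)
  show "F \<in> bandM p \<Longrightarrow> cls h * F \<in> bandM p" "F \<in> bandN p \<Longrightarrow> cls h * F \<in> bandN p"
    using L h f m by (auto simp: Ff cls_times cls_in_bandM cls_in_bandN elim!: eventually_mono)
qed

lemma shift_bandN:
  assumes p: "1 \<le> p" and F: "F \<in> bandN p"
  shows "shift t F \<in> bandN p"
proof -
  obtain f where f: "f \<in> borel_measurable mu" and Ff: "F = cls f" by (rule L0_cases)
  note sm = shift_fun_measurable[OF f, of t]
  have f0: "AE \<omega> in mu1. f \<omega> = 0" using F f by (simp add: Ff cls_in_bandN)
  then obtain A where A: "A \<in> null_sets mu1" "{\<omega> \<in> Omega. f \<omega> \<noteq> 0} \<subseteq> A"
    by (auto simp: eventually_ae_filter)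
  have "(\<Sum>\<^sub>\<infinity>x\<in>{0<..<1}. nu (xsec A x)) = 0"
    using A(1) by (auto simp: null_sets_def emeasure_mu1 val1_def)
  then have cA: "countable (xsec A x)" if "x \<in> {0<..<1}" for x
    using that by (auto simp: infsum_eq_0_iff_ennreal nu_def split: if_splits)
  have "AE \<omega> in mu1. shift_fun t f \<omega> = 0"
  proof (rule AE_mu1_I)
    show "{\<omega> \<in> Omega. shift_fun t f \<omega> \<noteq> 0} \<in> Asets" by (rule measurable_mu_sections[OF sm])
    fix x :: real
    show "countable {\<gamma>. shift_fun t f (x, \<gamma>) \<noteq> 0}"
    proof (cases "x - t \<in> {0<..<1}")
      case True
      show ?thesis
        by (rule countable_subset[OF _ cA[OF True]])
          (use A(2) True in \<open>auto simp: shift_fun_def xsec_def Omega_def\<close>)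
    next
      case False
      then have "{\<gamma>. shift_fun t f (x, \<gamma>) \<noteq> 0} = {}" by (auto simp: shift_fun_def)
      then show ?thesis by (simp only: countable_empty)
    qed
  qed
  then show ?thesis
    using Lp_norm_shift_le(1)[OF p bands_subset(2)[OF F], of t] f sm
    by (simp add: Ff cls_shift cls_in_bandN)
qed

section \<open>Functions on one fibre\<close>

definition fibre :: "'g \<Rightarrow> (real \<Rightarrow> real) \<Rightarrow> real \<times> 'g \<Rightarrow> real" where
  "fibre \<gamma> \<phi> = (\<lambda>(x, \<gamma>'). if \<gamma>' = \<gamma> then \<phi> x else 0)"

lemma fibre_apply: "fibre \<gamma> \<phi> (x, \<gamma>') = (if \<gamma>' = \<gamma> then \<phi> x else 0)"
  by (simp add: fibre_def)

lemma fibre_measurable [measurable]: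
  assumes [measurable]: "\<phi> \<in> borel_measurable borel"
  shows "fibre \<gamma> \<phi> \<in> borel_measurable mu"
proof (rule measurable_muI[where c = "\<lambda>_. 0"])
  show "(\<lambda>x. if x \<in> {0<..<1} then fibre \<gamma> \<phi> (x, \<gamma>') else 0) \<in> borel_measurable borel" for \<gamma>'
    unfolding fibre_apply by (cases "\<gamma>' = \<gamma>") simp_all
  show "countable {\<gamma>'. fibre \<gamma> \<phi> (x, \<gamma>') \<noteq> 0}" for x
    by (rule countable_subset[of _ "{\<gamma>}"]) (auto simp: fibre_apply)
qed

text \<open>On a single fibre \<open>\<mu>'\<close> vanishes, and \<open>\<mu>''\<close> is the image of the Lebesgue measure.\<close>

lemma nn_integral_fibre:
  fixes f :: "real \<times> 'g \<Rightarrow> ennreal"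
  assumes f [measurable]: "f \<in> borel_measurable mu"
  shows "(\<integral>\<^sup>+\<omega>. indicator ({0<..<1} \<times> {\<gamma>}) \<omega> * f \<omega> \<partial>mu) = (\<integral>\<^sup>+x. f (x, \<gamma>) * indicator {0<..<1} x \<partial>lborel)"
proof -
  define D where "D = {0<..<1::real} \<times> {\<gamma>}"
  let ?L = "restrict_space lborel {0<..<1::real}"
  define \<iota> where "\<iota> x = (x, \<gamma>)" for x :: real
  have D: "D \<in> Asets"
    by (auto simp: Asets_def D_def Omega_def xsec_def gsec_def)
  then have D' [measurable]: "D \<in> sets mu" by simp
  have spL: "space ?L = {0<..<1}" by (simp add: space_restrict_space)
  have pre: "\<iota> -` A \<inter> {0<..<1} = gsec A \<gamma>" if "A \<in> Asets" for A
    using that by (auto simp: \<iota>_def gsec_def Asets_def Omega_def)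
  have gb: "gsec A \<gamma> \<in> sets borel" "gsec A \<gamma> \<subseteq> {0<..<1}" if "A \<in> Asets" for A
    using that by (auto simp: gsec_def Asets_def Omega_def)
  have \<iota>: "\<iota> \<in> measurable ?L mu"
  proof (rule measurableI)
    show "\<iota> x \<in> space mu" if "x \<in> space ?L" for x
      using that by (simp add: spL \<iota>_def Omega_def)
    show "\<iota> -` A \<inter> space ?L \<in> sets ?L" if "A \<in> sets mu" for A
      using that gb[of A] by (simp add: spL pre sets_restrict_space_iff)
  qed
  have eq: "density mu (indicator D) = distr ?L mu \<iota>"
  proof (rule measure_eqI)
    fix A :: "(real \<times> 'g) set" assume "A \<in> sets (density mu (indicator D))"
    then have A: "A \<in> Asets" "A \<in> sets mu" by simp_all
    have AD: "A \<inter> D \<in> Asets" using A D' sets.Int[of A mu D] by simp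
    have "emeasure (density mu (indicator D)) A = emeasure mu (A \<inter> D)"
      using A AD by (subst emeasure_density) (auto simp: indicator_inter_arith[symmetric] Int_commute)
    also have "\<dots> = val1 (A \<inter> D) + val2 (A \<inter> D)"
      using AD by (simp add: emeasure_mu emeasure_mu1 emeasure_mu2)
    also have "val1 (A \<inter> D) = 0"
    proof -
      have "countable (xsec (A \<inter> D) x)" for x
        by (rule countable_subset[of _ "{\<gamma>}"]) (auto simp: D_def xsec_def)
      then show ?thesis by (simp add: val1_def nu_def)
    qed
    also have "val2 (A \<inter> D) = (\<Sum>\<^sub>\<infinity>\<gamma>'\<in>{\<gamma>}. emeasure lborel (gsec A \<gamma>'))"
    proof -
      have "gsec (A \<inter> D) \<gamma>' = (if \<gamma>' = \<gamma> then gsec A \<gamma> else {})" for \<gamma>'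
        using A by (auto simp: gsec_def D_def Asets_def Omega_def)
      then show ?thesis unfolding val2_def by (intro infsum_cong_neutral) auto
    qed
    also have "0 + (\<Sum>\<^sub>\<infinity>\<gamma>'\<in>{\<gamma>}. emeasure lborel (gsec A \<gamma>')) = emeasure lborel (gsec A \<gamma>)" by simp
    also have "\<dots> = emeasure (distr ?L mu \<iota>) A"
      using A gb[OF A(1)] by (subst emeasure_distr[OF \<iota> A(2)]) (simp add: spL pre emeasure_restrict_space)
    finally show "emeasure (density mu (indicator D)) A = emeasure (distr ?L mu \<iota>) A" .
  qed simp
  have "(\<integral>\<^sup>+\<omega>. indicator D \<omega> * f \<omega> \<partial>mu) = (\<integral>\<^sup>+\<omega>. f \<omega> \<partial>density mu (indicator D))"
    by (subst nn_integral_density) auto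
  also have "\<dots> = (\<integral>\<^sup>+x. f (x, \<gamma>) \<partial>?L)"
    unfolding eq by (subst nn_integral_distr[OF \<iota>]) (auto simp: \<iota>_def)
  also have "\<dots> = (\<integral>\<^sup>+x. f (x, \<gamma>) * indicator {0<..<1} x \<partial>lborel)"
    by (subst nn_integral_restrict_space) auto
  finally show ?thesis by (simp add: D_def)
qed

lemma nn_integral_fibre_fun:
  assumes [measurable]: "\<phi> \<in> borel_measurable borel"
  shows "(\<integral>\<^sup>+\<omega>. ennreal (fibre \<gamma> \<phi> \<omega>) \<partial>mu) = (\<integral>\<^sup>+x. ennreal (\<phi> x) * indicator {0<..<1} x \<partial>lborel)"
proof -
  have "(\<integral>\<^sup>+\<omega>. ennreal (fibre \<gamma> \<phi> \<omega>) \<partial>mu) = (\<integral>\<^sup>+\<omega>. indicator ({0<..<1} \<times> {\<gamma>}) \<omega> * ennreal (fibre \<gamma> \<phi> \<omega>) \<partial>mu)"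
    by (intro nn_integral_cong) (auto simp: Omega_def fibre_apply split: split_indicator if_splits)
  also have "\<dots> = (\<integral>\<^sup>+x. ennreal (fibre \<gamma> \<phi> (x, \<gamma>)) * indicator {0<..<1} x \<partial>lborel)"
    by (rule nn_integral_fibre) measurable
  finally show ?thesis by (simp add: fibre_apply)
qed

lemma fibre_powr: "\<bar>fibre \<gamma> \<phi> \<omega>\<bar> powr p = fibre \<gamma> (\<lambda>x. \<bar>\<phi> x\<bar> powr p) \<omega>"
  by (simp add: fibre_def split: prod.splits)

lemma fibre_AE_mu1:
  assumes "\<phi> \<in> borel_measurable borel"
  shows "AE \<omega> in mu1. fibre \<gamma> \<phi> \<omega> = 0"
proof (rule AE_mu1_I)
  show "countable {\<gamma>'. fibre \<gamma> \<phi> (x, \<gamma>') \<noteq> 0}" for x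
    by (rule countable_subset[of _ "{\<gamma>}"]) (auto simp: fibre_apply)
  show "{\<omega> \<in> Omega. fibre \<gamma> \<phi> \<omega> \<noteq> 0} \<in> Asets"
    by (rule measurable_mu_sections[OF fibre_measurable[OF assms]])
qed

lemma Lp_fibre_bounded:
  assumes p: "1 \<le> p" and \<phi> [measurable]: "\<phi> \<in> borel_measurable borel"
    and B [measurable]: "B \<in> sets borel" and m: "emeasure lborel B \<le> ennreal m" "0 \<le> m" and c: "0 \<le> c"
    and le: "\<And>x. x \<in> {0<..<1} \<Longrightarrow> \<bar>\<phi> x\<bar> \<le> c * indicator B x"
  shows "cls (fibre \<gamma> \<phi>) \<in> bandN p" "Lp_norm p (cls (fibre \<gamma> \<phi>)) \<le> c * m powr (1 / p)"
proof -
  have "(\<integral>\<^sup>+\<omega>. ennreal (\<bar>fibre \<gamma> \<phi> \<omega>\<bar> powr p) \<partial>mu) = (\<integral>\<^sup>+x. ennreal (\<bar>\<phi> x\<bar> powr p) * indicator {0<..<1} x \<partial>lborel)"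
    unfolding fibre_powr by (rule nn_integral_fibre_fun) measurable
  also have "\<dots> \<le> (\<integral>\<^sup>+x. ennreal (c powr p) * indicator B x \<partial>lborel)"
  proof (intro nn_integral_mono)
    fix x :: real
    show "ennreal (\<bar>\<phi> x\<bar> powr p) * indicator {0<..<1} x \<le> ennreal (c powr p) * indicator B x"
    proof (cases "x \<in> {0<..<1}")
      case True
      have "\<bar>\<phi> x\<bar> powr p \<le> (c * indicator B x) powr p" using le[OF True] p by (intro powr_mono2) auto
      then show ?thesis using True c p by (cases "x \<in> B") (auto intro!: ennreal_leI)
    qed simp
  qed
  also have "\<dots> = ennreal (c powr p) * emeasure lborel B" by (simp add: nn_integral_cmult_indicator)
  also have "\<dots> \<le> ennreal (c powr p) * ennreal m" by (intro mult_left_mono m) simp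
  finally have *: "(\<integral>\<^sup>+\<omega>. ennreal (\<bar>fibre \<gamma> \<phi> \<omega>\<bar> powr p) \<partial>mu) \<le> ennreal (c powr p * m)"
    by (simp add: ennreal_mult' m)
  then have int: "integrable mu (\<lambda>\<omega>. \<bar>fibre \<gamma> \<phi> \<omega>\<bar> powr p)"
    by (intro integrableI_bounded) (auto intro: le_less_trans)
  then show "cls (fibre \<gamma> \<phi>) \<in> bandN p"
    by (simp add: cls_in_bandN cls_in_Lp fibre_AE_mu1)
  have "(LINT \<omega>|mu. \<bar>fibre \<gamma> \<phi> \<omega>\<bar> powr p) \<le> c powr p * m"
    using * by (subst (asm) nn_integral_eq_integral[OF int]) (auto simp: m)
  also have "\<dots> = (c * m powr (1 / p)) powr p" using p c m by (simp add: powr_mult powr_powr)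
  finally show "Lp_norm p (cls (fibre \<gamma> \<phi>)) \<le> c * m powr (1 / p)"
    using p c by (subst Lp_norm_le_iff) auto
qed

lemma fibre_indicator_bandN:
  assumes "1 \<le> p" "B \<in> sets borel"
  shows "cls (fibre \<gamma> (indicator B)) \<in> bandN p"
proof -
  have [measurable]: "B \<in> sets borel" by fact
  have "cls (fibre \<gamma> (\<lambda>x. indicator B x)) \<in> bandN p"
    by (rule Lp_fibre_bounded(1)[where B = "{0<..<1}" and c = 1 and m = 1])
      (use assms in \<open>auto split: split_indicator\<close>)
  then show ?thesis by simp
qed

lemma sum_additive_property:
  fixes G :: "'i \<Rightarrow> 'a::comm_monoid_add"
  assumes "P 0" "\<And>F G. P F \<Longrightarrow> P G \<Longrightarrow> P (F + G)" "\<And>i. i \<in> I \<Longrightarrow> P (G i)"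
  shows "P (\<Sum>i\<in>I. G i)"
  using assms(3) by (induction I rule: infinite_finite_induct) (auto intro: assms(1,2))

text \<open>The intervals \<open>(a, 1)\<close> form an intersection-stable generator of the Borel sets of \<open>(0, 1)\<close>; a Dynkin
argument leads to the indicators of all Borel sets on a fibre, approximation by simple functions to
all functions on a fibre, and finally a function in \<open>M\<^sup>\<bottom>\<close> is the sum of its restrictions to
countably many fibres. Every step stays within a closed subspace by dominated convergence.\<close>

theorem bandN_closed_subspace_induct [consumes 2, case_names add scale lim base]:
  fixes Q :: "'g L0 \<Rightarrow> bool"
  assumes p: "1 \<le> p" and F: "F \<in> bandN p"
    and add: "\<And>F G. F \<in> bandN p \<Longrightarrow> G \<in> bandN p \<Longrightarrow> Q F \<Longrightarrow> Q G \<Longrightarrow> Q (F + G)"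
    and scale: "\<And>F c. F \<in> bandN p \<Longrightarrow> Q F \<Longrightarrow> Q (c *\<^sub>R F)"
    and lim: "\<And>s F. (\<And>i::nat. s i \<in> bandN p) \<Longrightarrow> (\<And>i. Q (s i)) \<Longrightarrow> F \<in> bandN p \<Longrightarrow>
      (\<lambda>i. Lp_norm p (s i - F)) \<longlonglongrightarrow> 0 \<Longrightarrow> Q F"
    and base: "\<And>a \<gamma>. 0 \<le> a \<Longrightarrow> a < 1 \<Longrightarrow> Q (cls (fibre \<gamma> (indicator {a<..})))"
  shows "Q F"
proof -
  have Q0: "Q 0"
    using scale[of "cls (fibre undefined (indicator {0<..}))" 0] base[of 0 undefined]
      fibre_indicator_bandN[OF p, of "{0<..}" undefined] by simp
  have Q0N: "Q 0 \<and> 0 \<in> bandN p" using Q0 bands_closed(5)[OF p] by blast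
  have QaddN: "\<And>F G. Q F \<and> F \<in> bandN p \<Longrightarrow> Q G \<and> G \<in> bandN p \<Longrightarrow> Q (F + G) \<and> F + G \<in> bandN p"
    using add bands_closed(6)[OF p] by blast
  note Qsum = sum_additive_property[where P = "\<lambda>F. Q F \<and> F \<in> bandN p", OF Q0N QaddN]
  have QB: "Q (cls (fibre \<gamma> (indicator B)))" if "B \<in> sets borel" for B \<gamma>
  proof -
    have "B \<in> sigma_sets UNIV (range greaterThan :: real set set)"
      using that by (simp add: borel_Ioi)
    then show ?thesis
    proof (induction rule: sigma_sets_induct_disjoint[rotated 2, consumes 1])
      show "Int_stable (range greaterThan :: real set set)"
      proof (rule Int_stableI)
        fix A B :: "real set" assume "A \<in> range greaterThan" "B \<in> range greaterThan"
        then obtain a b where "A = {a<..}" "B = {b<..}" by auto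
        then have "A \<inter> B = {max a b<..}" by auto
        then show "A \<inter> B \<in> range greaterThan" by simp
      qed
    next
      fix A :: "real set" assume "A \<in> range greaterThan"
      then obtain a where A: "A = {a<..}" by auto
      consider "a < 0" | "0 \<le> a" "a < 1" | "1 \<le> a" by linarith
      then show "Q (cls (fibre \<gamma> (indicator A)))"
      proof cases
        case 1
        then have "cls (fibre \<gamma> (indicator A)) = cls (fibre \<gamma> (indicator {0<..}))"
          unfolding A by (subst cls_eq_iff) (auto intro!: AE_I2 simp: Omega_def fibre_apply split: split_indicator)
        then show ?thesis using base[of 0 \<gamma>] by simp
      next
        case 2
        then show ?thesis using base by (simp add: A)
      next
        case 3
        then have "cls (fibre \<gamma> (indicator A)) = 0"
          unfolding A zero_L0_def by (subst cls_eq_iff) (auto intro!: AE_I2 simp: Omega_def fibre_apply split: split_indicator)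
        then show ?thesis using Q0 by simp
      qed
    next
      have "cls (fibre \<gamma> (indicator {})) = 0"
        unfolding zero_L0_def by (subst cls_eq_iff, measurable) (auto simp: fibre_def)
      then show "Q (cls (fibre \<gamma> (indicator {})))" using Q0 by simp
    next
      fix A :: "real set" assume "A \<in> sigma_sets UNIV (range greaterThan)" and Q: "Q (cls (fibre \<gamma> (indicator A)))"
      then have A [measurable]: "A \<in> sets borel" by (simp add: borel_Ioi)
      have e: "(-1) *\<^sub>R cls (fibre \<gamma> (indicator A)) \<in> bandN p" "cls (fibre \<gamma> (indicator {0<..})) \<in> bandN p"
        by (intro bands_closed[OF p] fibre_indicator_bandN[OF p] A; simp)+
      have "cls (fibre \<gamma> (indicator (UNIV - A))) = cls (fibre \<gamma> (indicator {0<..})) + (-1) *\<^sub>R cls (fibre \<gamma> (indicator A))"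
        by (subst cls_scaleR, simp, subst cls_plus, simp, simp, subst cls_eq_iff)
          (auto intro!: AE_I2 simp: Omega_def fibre_apply split: split_indicator)
      moreover have "Q \<dots>"
        using e base[of 0 \<gamma>] Q fibre_indicator_bandN[OF p A, of \<gamma>] by (intro add scale) auto
      ultimately show "Q (cls (fibre \<gamma> (indicator (UNIV - A))))" by simp
    next
      fix A :: "nat \<Rightarrow> real set"
      assume disj: "disjoint_family A" and "range A \<subseteq> sigma_sets UNIV (range greaterThan)"
        and Q: "\<And>i. Q (cls (fibre \<gamma> (indicator (A i))))"
      then have A [measurable]: "A i \<in> sets borel" for i by (auto simp: borel_Ioi)
      have AU [measurable]: "(\<Union>i. A i) \<in> sets borel" by measurable
      show "Q (cls (fibre \<gamma> (indicator (\<Union>i. A i))))"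
      proof (rule lim[of "\<lambda>n. \<Sum>i<n. cls (fibre \<gamma> (indicator (A i)))"])
        have "Q (\<Sum>i<n. cls (fibre \<gamma> (indicator (A i)))) \<and> (\<Sum>i<n. cls (fibre \<gamma> (indicator (A i)))) \<in> bandN p" for n
          using Q fibre_indicator_bandN[OF p A] by (intro Qsum) auto
        then show "(\<Sum>i<n. cls (fibre \<gamma> (indicator (A i)))) \<in> bandN p" "Q (\<Sum>i<n. cls (fibre \<gamma> (indicator (A i))))" for n
          by auto
        show "cls (fibre \<gamma> (indicator (\<Union>i. A i))) \<in> bandN p" by (rule fibre_indicator_bandN[OF p AU])
        have eq: "(\<Sum>i<n. indicator (A i) x) = (indicator (\<Union>i<n. A i) x :: real)" for n x
          using disj by (subst indicator_UN_disjoint) (auto simp: disjoint_family_on_def)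
        have sum: "(\<Sum>i<n. fibre \<gamma> (indicator (A i)) \<omega>) = fibre \<gamma> (indicator (\<Union>i<n. A i)) \<omega>" for n \<omega>
          by (cases \<omega>) (simp add: fibre_apply eq[symmetric])
        have "(\<lambda>n. Lp_norm p (cls (\<lambda>\<omega>. \<Sum>i<n. fibre \<gamma> (indicator (A i)) \<omega>) - cls (fibre \<gamma> (indicator (\<Union>i. A i))))) \<longlonglongrightarrow> 0"
        proof (rule Lp_dominated_convergence[OF p])
          show "cls (fibre \<gamma> (indicator UNIV)) \<in> Lp p" by (intro bands_subset fibre_indicator_bandN p) simp
          show "AE \<omega> in mu. \<bar>\<Sum>i<n. fibre \<gamma> (indicator (A i)) \<omega>\<bar> \<le> fibre \<gamma> (indicator UNIV) \<omega>" for n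
            unfolding sum by (intro AE_I2) (auto simp: fibre_def split: split_indicator)
          show "AE \<omega> in mu. (\<lambda>n. \<Sum>i<n. fibre \<gamma> (indicator (A i)) \<omega>) \<longlonglongrightarrow> fibre \<gamma> (indicator (\<Union>i. A i)) \<omega>"
          proof (intro AE_I2)
            fix \<omega> :: "real \<times> 'g"
            show "(\<lambda>n. \<Sum>i<n. fibre \<gamma> (indicator (A i)) \<omega>) \<longlonglongrightarrow> fibre \<gamma> (indicator (\<Union>i. A i)) \<omega>"
              unfolding sum by (cases \<omega>) (simp add: fibre_apply LIMSEQ_indicator_UN)
          qed
        qed measurable
        then show "(\<lambda>n. Lp_norm p ((\<Sum>i<n. cls (fibre \<gamma> (indicator (A i)))) - cls (fibre \<gamma> (indicator (\<Union>i. A i))))) \<longlonglongrightarrow> 0"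
          by (subst cls_sum) auto
      qed
    qed auto
  qed
  have Qfib: "Q (cls (fibre \<gamma> \<phi>))" if \<phi> [measurable]: "\<phi> \<in> borel_measurable borel" and L: "cls (fibre \<gamma> \<phi>) \<in> Lp p" for \<gamma> \<phi>
  proof -
    obtain s where s: "\<And>i. simple_function borel (s i)" "\<And>x. (\<lambda>i. s i x) \<longlonglongrightarrow> \<phi> x"
        "\<And>i x. \<bar>s i x\<bar> \<le> 2 * \<bar>\<phi> x\<bar>"
      using borel_measurable_implies_sequence_metric[OF \<phi>, of 0] by (auto simp: dist_real_def)
    have sm [measurable]: "s i \<in> borel_measurable borel" for i by (rule borel_measurable_simple_function[OF s(1)])
    have Qs: "Q (cls (fibre \<gamma> (s i))) \<and> cls (fibre \<gamma> (s i)) \<in> bandN p" for i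
    proof -
      have fin: "finite (range (s i))" using simple_functionD(1)[OF s(1)[of i]] by simp
      have lev [measurable]: "s i -` {y} \<in> sets borel" for y
        using simple_functionD(2)[OF s(1)[of i], of "{y}"] by simp
      have "fibre \<gamma> (s i) \<omega> = (\<Sum>y\<in>range (s i). y * fibre \<gamma> (indicator (s i -` {y})) \<omega>)" for \<omega>
      proof (cases \<omega>)
        case (Pair x \<gamma>')
        have "(\<Sum>y\<in>range (s i). y * indicator (s i -` {y}) x) = (\<Sum>y\<in>range (s i). if y = s i x then y else 0)"
          by (intro sum.cong) (auto split: split_indicator)
        also have "\<dots> = s i x" using fin by simp
        finally show ?thesis using Pair by (simp add: fibre_apply)
      qed
      then have "fibre \<gamma> (s i) = (\<lambda>\<omega>. \<Sum>y\<in>range (s i). y * fibre \<gamma> (indicator (s i -` {y})) \<omega>)" by auto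
      then have eq: "cls (fibre \<gamma> (s i)) = (\<Sum>y\<in>range (s i). y *\<^sub>R cls (fibre \<gamma> (indicator (s i -` {y}))))"
        by (simp add: cls_scaleR cls_sum)
      show ?thesis
        unfolding eq
        by (rule Qsum, assumption, assumption)
          (intro conjI scale bands_closed(8)[OF p] QB fibre_indicator_bandN[OF p] lev)
    qed
    show ?thesis
    proof (rule lim[of "\<lambda>i. cls (fibre \<gamma> (s i))"])
      show "cls (fibre \<gamma> (s i)) \<in> bandN p" "Q (cls (fibre \<gamma> (s i)))" for i using Qs by auto
      show "cls (fibre \<gamma> \<phi>) \<in> bandN p" using L by (simp add: cls_in_bandN fibre_AE_mu1)
      show "(\<lambda>i. Lp_norm p (cls (fibre \<gamma> (s i)) - cls (fibre \<gamma> \<phi>))) \<longlonglongrightarrow> 0"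
      proof (rule Lp_dominated_convergence[OF p, where w = "\<lambda>\<omega>. 2 * \<bar>fibre \<gamma> \<phi> \<omega>\<bar>"])
        show "cls (\<lambda>\<omega>. 2 * \<bar>fibre \<gamma> \<phi> \<omega>\<bar>) \<in> Lp p"
          using L by (simp add: cls_in_Lp abs_mult powr_mult)
        show "AE \<omega> in mu. \<bar>fibre \<gamma> (s i) \<omega>\<bar> \<le> 2 * \<bar>fibre \<gamma> \<phi> \<omega>\<bar>" for i
          using s(3) by (intro AE_I2) (auto simp: fibre_def)
        show "AE \<omega> in mu. (\<lambda>i. fibre \<gamma> (s i) \<omega>) \<longlonglongrightarrow> fibre \<gamma> \<phi> \<omega>"
          using s(2) by (intro AE_I2) (auto simp: fibre_def)
      qed measurable
    qed
  qed
  obtain f where f [measurable]: "f \<in> borel_measurable mu" and Ff: "F = cls f" by (rule L0_cases)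
  have fL: "cls f \<in> Lp p" and f0: "AE \<omega> in mu1. f \<omega> = 0" using F f by (simp_all add: Ff cls_in_bandN)
  let ?Z = "{\<gamma>. emeasure lborel {x\<in>{0<..<1}. f (x, \<gamma>) \<noteq> 0} \<noteq> 0}"
  obtain g :: "nat \<Rightarrow> 'g" where g: "?Z \<subseteq> range g"
    using Lp_countable_sections(2)[OF f fL p] uncountable_def[of ?Z] by (cases "?Z = {}") blast+
  define \<phi> where "\<phi> \<gamma> x = (if x \<in> {0<..<1} then f (x, \<gamma>) else 0)" for \<gamma> x
  have \<phi>m [measurable]: "\<phi> \<gamma> \<in> borel_measurable borel" for \<gamma>
    unfolding \<phi>_def by (rule measurable_mu_sections[OF f])
  have \<phi>L: "cls (fibre \<gamma> (\<phi> \<gamma>)) \<in> Lp p" for \<gamma>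
  proof (rule Lp_bounded_by(1)[OF _ f fL p])
    show "AE \<omega> in mu. \<bar>fibre \<gamma> (\<phi> \<gamma>) \<omega>\<bar> \<le> 1 * \<bar>f \<omega>\<bar>"
      by (intro AE_I2) (auto simp: fibre_def \<phi>_def)
  qed simp_all
  have \<phi>N: "cls (fibre \<gamma> (\<phi> \<gamma>)) \<in> bandN p" for \<gamma>
    using \<phi>L by (simp add: cls_in_bandN fibre_AE_mu1)
  define h where "h n \<omega> = (\<Sum>\<gamma>\<in>g ` {..<n}. fibre \<gamma> (\<phi> \<gamma>) \<omega>)" for n :: nat and \<omega>
  have hm [measurable]: "h n \<in> borel_measurable mu" for n unfolding h_def by measurable
  have h_cls: "cls (h n) = (\<Sum>\<gamma>\<in>g ` {..<n}. cls (fibre \<gamma> (\<phi> \<gamma>)))" for n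
    by (simp add: cls_sum h_def[abs_def])
  have h_eq: "h n (x, \<gamma>) = (if \<gamma> \<in> g ` {..<n} then f (x, \<gamma>) else 0)" if "x \<in> {0<..<1}" for n x \<gamma>
    using that by (simp add: h_def fibre_apply \<phi>_def)
  have hN: "Q (cls (h n)) \<and> cls (h n) \<in> bandN p" for n
    unfolding h_cls by (rule Qsum, assumption, assumption) (intro conjI \<phi>N Qfib[OF \<phi>m \<phi>L])
  show "Q F"
    unfolding Ff
  proof (rule lim[of "\<lambda>n. cls (h n)"])
    show "cls (h n) \<in> bandN p" "Q (cls (h n))" for n using hN by auto
    show "cls f \<in> bandN p" using F by (simp add: Ff)
    show "(\<lambda>n. Lp_norm p (cls (h n) - cls f)) \<longlonglongrightarrow> 0"
    proof (rule Lp_dominated_convergence[OF p, where w = "\<lambda>\<omega>. \<bar>f \<omega>\<bar>"])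
      show "cls (\<lambda>\<omega>. \<bar>f \<omega>\<bar>) \<in> Lp p" using fL by (simp add: cls_in_Lp)
      show "AE \<omega> in mu. \<bar>h n \<omega>\<bar> \<le> \<bar>f \<omega>\<bar>" for n
        by (intro AE_I2) (auto simp: Omega_def h_eq)
      have "AE \<omega> in mu2. f \<omega> = 0 \<or> snd \<omega> \<in> range g"
      proof (rule AE_mu2_I)
        have "{\<omega> \<in> Omega. \<not> (f \<omega> = 0 \<or> snd \<omega> \<in> range g)} = {\<omega> \<in> Omega. f \<omega> \<noteq> 0} - (\<Union>i. {0<..<1} \<times> {g i})"
          by (auto simp: Omega_def)
        moreover have "{0<..<1} \<times> {g i} \<in> sets mu" for i
          by (auto simp: Asets_def Omega_def xsec_def gsec_def)
        then have "(\<Union>i. {0<..<1} \<times> {g i}) \<in> sets mu" by blast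
        moreover have "{\<omega> \<in> Omega. f \<omega> \<noteq> 0} \<in> sets mu" using measurable_mu_sections(1)[OF f] by simp
        ultimately show "{\<omega> \<in> Omega. \<not> (f \<omega> = 0 \<or> snd \<omega> \<in> range g)} \<in> Asets"
          using sets.Diff[of "{\<omega> \<in> Omega. f \<omega> \<noteq> 0}" mu "\<Union>i. {0<..<1} \<times> {g i}"] by simp
        show "emeasure lborel {x\<in>{0<..<1}. \<not> (f (x, \<gamma>) = 0 \<or> snd (x, \<gamma>) \<in> range g)} = 0" for \<gamma>
        proof (cases "\<gamma> \<in> range g")
          case False
          then have "\<gamma> \<notin> ?Z" using g by blast
          then show ?thesis using False by auto
        qed auto
      qed
      then have "AE \<omega> in mu. f \<omega> = 0 \<or> snd \<omega> \<in> range g"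
        unfolding AE_mu_iff using f0 by (auto elim!: eventually_mono)
      with AE_space show "AE \<omega> in mu. (\<lambda>n. h n \<omega>) \<longlonglongrightarrow> f \<omega>"
      proof eventually_elim
        case (elim \<omega>)
        obtain x \<gamma> where \<omega>: "\<omega> = (x, \<gamma>)" "x \<in> {0<..<1}" using elim(1) by (auto simp: Omega_def)
        show ?case
        proof (cases "f \<omega> = 0")
          case True
          then have "h n \<omega> = 0" for n using \<omega> by (auto simp: h_eq)
          then show ?thesis using True by simp
        next
          case False
          then obtain k where k: "\<gamma> = g k" using elim(2) \<omega> by auto
          have "h n \<omega> = f \<omega>" if "n > k" for n using that \<omega> k by (auto simp: h_eq)
          then have "\<forall>\<^sub>F n in sequentially. h n \<omega> = f \<omega>"
            by (auto simp: eventually_sequentially intro!: exI[of _ "Suc k"])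
          then show ?thesis by (rule tendsto_eventually)
        qed
      qed
    qed measurable
  qed
qed

section \<open>Generators\<close>

context normed_subspace
begin

lemma N_tendsto_0_add:
  assumes "((\<lambda>h. N (a h)) \<longlongrightarrow> 0) F" "((\<lambda>h. N (b h)) \<longlongrightarrow> 0) F"
    and "\<forall>\<^sub>F h in F. a h \<in> X \<and> b h \<in> X"
  shows "((\<lambda>h. N (a h + b h)) \<longlongrightarrow> 0) F"
proof (rule tendsto_sandwich[OF _ _ tendsto_const])
  show "((\<lambda>h. N (a h) + N (b h)) \<longlongrightarrow> 0) F" using tendsto_add[OF assms(1,2)] by simp
  show "\<forall>\<^sub>F h in F. 0 \<le> N (a h + b h)" using assms(3) by eventually_elim simp
  show "\<forall>\<^sub>F h in F. N (a h + b h) \<le> N (a h) + N (b h)"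
    using assms(3) by eventually_elim (simp add: N_triangle)
qed

lemma N_tendsto_0_scaleR:
  assumes "((\<lambda>h. N (a h)) \<longlongrightarrow> 0) F" "\<forall>\<^sub>F h in F. a h \<in> X"
  shows "((\<lambda>h. N (c *\<^sub>R a h)) \<longlongrightarrow> 0) F"
proof (rule Lim_transform_eventually)
  show "((\<lambda>h. \<bar>c\<bar> * N (a h)) \<longlongrightarrow> 0) F" using tendsto_mult[OF tendsto_const assms(1), of "\<bar>c\<bar>"] by simp
  show "\<forall>\<^sub>F h in F. \<bar>c\<bar> * N (a h) = N (c *\<^sub>R a h)"
    using assms(2) by eventually_elim (simp add: N_scaleR)
qed

lemma generator_add:
  assumes S: "C0_semigroup X N S" and "(f, f') \<in> generator X N S" "(g, g') \<in> generator X N S"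
  shows "(f + g, f' + g') \<in> generator X N S"
proof -
  have X: "f \<in> X" "g \<in> X" "f' \<in> X" "g' \<in> X" using assms by (auto simp: generator_def)
  have B: "bounded_op X N (S h)" if "h > 0" for h using S that by (simp add: C0_semigroup_def)
  have "((\<lambda>h. N (((1 / h) *\<^sub>R (S h f - f) - f') + ((1 / h) *\<^sub>R (S h g - g) - g'))) \<longlongrightarrow> 0) (at_right 0)"
  proof (rule N_tendsto_0_add)
    show "\<forall>\<^sub>F h in at_right 0. (1 / h) *\<^sub>R (S h f - f) - f' \<in> X \<and> (1 / h) *\<^sub>R (S h g - g) - g' \<in> X"
      using eventually_at_right_less[of 0]
      by eventually_elim (simp add: X bounded_op_closed[OF B])
  qed (use assms in \<open>auto simp: generator_def\<close>)
  moreover have "\<forall>\<^sub>F h in at_right 0. N (((1 / h) *\<^sub>R (S h f - f) - f') + ((1 / h) *\<^sub>R (S h g - g) - g')) =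
      N ((1 / h) *\<^sub>R (S h (f + g) - (f + g)) - (f' + g'))"
    using eventually_at_right_less[of 0]
    by eventually_elim (simp add: X bounded_op_add[OF B] algebra_simps)
  ultimately show ?thesis using X by (auto simp: generator_def elim: Lim_transform_eventually)
qed

lemma generator_scaleR:
  assumes S: "C0_semigroup X N S" and "(f, f') \<in> generator X N S"
  shows "(c *\<^sub>R f, c *\<^sub>R f') \<in> generator X N S"
proof -
  have X: "f \<in> X" "f' \<in> X" using assms by (auto simp: generator_def)
  have B: "bounded_op X N (S h)" if "h > 0" for h using S that by (simp add: C0_semigroup_def)
  have "((\<lambda>h. N (c *\<^sub>R ((1 / h) *\<^sub>R (S h f - f) - f'))) \<longlongrightarrow> 0) (at_right 0)"
  proof (rule N_tendsto_0_scaleR)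
    show "\<forall>\<^sub>F h in at_right 0. (1 / h) *\<^sub>R (S h f - f) - f' \<in> X"
      using eventually_at_right_less[of 0]
      by eventually_elim (simp add: X bounded_op_closed[OF B])
  qed (use assms in \<open>auto simp: generator_def\<close>)
  moreover have "\<forall>\<^sub>F h in at_right 0. N (c *\<^sub>R ((1 / h) *\<^sub>R (S h f - f) - f')) =
      N ((1 / h) *\<^sub>R (S h (c *\<^sub>R f) - c *\<^sub>R f) - c *\<^sub>R f')"
    using eventually_at_right_less[of 0]
    by eventually_elim (simp add: X bounded_op_scaleR[OF B] algebra_simps)
  ultimately show ?thesis using X by (auto simp: generator_def elim: Lim_transform_eventually)
qed

text \<open>If \<open>(S h f - T h f) / h\<close> converges to \<open>- B f\<close> for every \<open>f\<close>, then the difference quotients of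
\<open>S\<close> and \<open>T\<close> converge for the same vectors.\<close>

lemma generator_of_perturbation:
  assumes S: "C0_semigroup X N S" and T: "C0_semigroup X N T"
    and B: "\<And>f. f \<in> X \<Longrightarrow> B f \<in> X"
    and diff: "\<And>f. f \<in> X \<Longrightarrow> ((\<lambda>h. N ((1 / h) *\<^sub>R (S h f - T h f) + B f)) \<longlongrightarrow> 0) (at_right 0)"
  shows "generator X N S = {(f, g - B f) | f g. (f, g) \<in> generator X N T}"
proof -
  have cl: "S h f \<in> X" "T h f \<in> X" if "h > 0" "f \<in> X" for h f
    using S T that by (simp_all add: C0_semigroup_def bounded_op_def)
  have iff: "(f, g - B f) \<in> generator X N S \<longleftrightarrow> (f, g) \<in> generator X N T" for f g
  proof
    assume *: "(f, g - B f) \<in> generator X N S"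
    then have f: "f \<in> X" "g - B f \<in> X" by (simp_all add: generator_def)
    have g: "g \<in> X" using X_add[OF f(2) B[OF f(1)]] by simp
    have "((\<lambda>h. N (((1 / h) *\<^sub>R (S h f - f) - (g - B f)) + (-1) *\<^sub>R ((1 / h) *\<^sub>R (S h f - T h f) + B f))) \<longlongrightarrow> 0) (at_right 0)"
    proof (rule N_tendsto_0_add[OF _ N_tendsto_0_scaleR[OF diff[OF f(1)]]])
      show "\<forall>\<^sub>F h in at_right 0. (1 / h) *\<^sub>R (S h f - T h f) + B f \<in> X"
        using eventually_at_right_less[of 0] by eventually_elim (simp add: f B cl)
      show "\<forall>\<^sub>F h in at_right 0. (1 / h) *\<^sub>R (S h f - f) - (g - B f) \<in> X \<and>
          (-1) *\<^sub>R ((1 / h) *\<^sub>R (S h f - T h f) + B f) \<in> X"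
        using eventually_at_right_less[of 0] by eventually_elim (use f B cl in \<open>auto intro!: X_add X_diff X_minus X_scaleR\<close>)
    qed (use * in \<open>simp add: generator_def\<close>)
    then have "((\<lambda>h. N ((1 / h) *\<^sub>R (T h f - f) - g)) \<longlongrightarrow> 0) (at_right 0)"
      by (simp add: algebra_simps)
    then show "(f, g) \<in> generator X N T" using f g by (simp add: generator_def)
  next
    assume *: "(f, g) \<in> generator X N T"
    then have f: "f \<in> X" "g \<in> X" by (simp_all add: generator_def)
    have "((\<lambda>h. N (((1 / h) *\<^sub>R (T h f - f) - g) + ((1 / h) *\<^sub>R (S h f - T h f) + B f))) \<longlongrightarrow> 0) (at_right 0)"
    proof (rule N_tendsto_0_add[OF _ diff[OF f(1)]])
      show "\<forall>\<^sub>F h in at_right 0. (1 / h) *\<^sub>R (T h f - f) - g \<in> X \<and> (1 / h) *\<^sub>R (S h f - T h f) + B f \<in> X"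
        using eventually_at_right_less[of 0] by eventually_elim (simp add: f B cl)
    qed (use * in \<open>simp add: generator_def\<close>)
    then have "((\<lambda>h. N ((1 / h) *\<^sub>R (S h f - f) - (g - B f))) \<longlongrightarrow> 0) (at_right 0)"
      by (simp add: algebra_simps)
    then show "(f, g - B f) \<in> generator X N S" using f B by (simp add: generator_def)
  qed
  show ?thesis
  proof (intro equalityI subsetI)
    fix z assume "z \<in> generator X N S"
    then have "z = (fst z, (snd z + B (fst z)) - B (fst z))" "(fst z, (snd z + B (fst z)) - B (fst z)) \<in> generator X N S"
      by simp_all
    then show "z \<in> {(f, g - B f) | f g. (f, g) \<in> generator X N T}" unfolding iff by blast
  qed (use iff in auto)
qed

end

section \<open>The semigroup T\<close>

lemma shift_add: "shift t (F + G) = shift t F + shift t G"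
proof -
  obtain f g where f: "f \<in> borel_measurable mu" "F = cls f" and g: "g \<in> borel_measurable mu" "G = cls g"
    by (metis L0_ex_cls)
  have "shift_fun t (\<lambda>\<omega>. f \<omega> + g \<omega>) = (\<lambda>\<omega>. shift_fun t f \<omega> + shift_fun t g \<omega>)"
    by (auto simp: shift_fun_def)
  then show ?thesis using f g by (simp add: cls_plus cls_shift shift_fun_measurable)
qed

lemma shift_scaleR: "shift t (c *\<^sub>R F) = c *\<^sub>R shift t F"
proof -
  obtain f where f: "f \<in> borel_measurable mu" "F = cls f" by (rule L0_cases)
  have "shift_fun t (\<lambda>\<omega>. c * f \<omega>) = (\<lambda>\<omega>. c * shift_fun t f \<omega>)"
    by (auto simp: shift_fun_def)
  then show ?thesis using f by (simp add: cls_scaleR cls_shift shift_fun_measurable)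
qed

lemma shift_0: "shift 0 F = F"
proof -
  obtain f where f: "f \<in> borel_measurable mu" "F = cls f" by (rule L0_cases)
  have "shift_fun 0 f \<omega> = f \<omega>" if "\<omega> \<in> Omega" for \<omega>
    using that by (cases \<omega>) (simp add: shift_fun_def Omega_def)
  then show ?thesis using f
    by (auto simp: cls_shift cls_eq_iff shift_fun_measurable intro!: AE_I2)
qed

lemma shift_shift: "0 \<le> s \<Longrightarrow> 0 \<le> t \<Longrightarrow> shift s (shift t F) = shift (s + t) F"
proof -
  assume st: "0 \<le> s" "0 \<le> t"
  obtain f where f: "f \<in> borel_measurable mu" "F = cls f" by (rule L0_cases)
  have "shift_fun s (shift_fun t f) \<omega> = shift_fun (s + t) f \<omega>" if "\<omega> \<in> Omega" for \<omega>
    using that st by (auto simp: shift_fun_def Omega_def diff_diff_eq)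
  then show ?thesis using f
    by (auto simp: cls_shift cls_eq_iff shift_fun_measurable intro!: AE_I2)
qed

lemma shift_fibre_indicator:
  assumes "0 \<le> a" "0 \<le> h"
  shows "shift h (cls (fibre \<gamma> (indicator {a<..}))) = cls (fibre \<gamma> (indicator {a + h<..}))"
proof -
  have m: "fibre \<gamma> (indicator {b<..}) \<in> borel_measurable mu" for b :: real by measurable
  have "shift_fun h (fibre \<gamma> (indicator {a<..})) \<omega> = fibre \<gamma> (indicator {a + h<..}) \<omega>" if "\<omega> \<in> Omega" for \<omega>
    using that assms by (auto simp: shift_fun_def fibre_def Omega_def split: split_indicator)
  then show ?thesis
    using m by (auto simp: cls_shift cls_eq_iff shift_fun_measurable intro!: AE_I2)
qed

lemma tendsto_powr_at_right_0:
  assumes "1 \<le> p" "0 \<le> k"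
  shows "((\<lambda>h. c * (k * h) powr (1 / p)) \<longlongrightarrow> (0::real)) (at_right 0)"
proof -
  have "((\<lambda>h. c * (k * h) powr (1 / p)) \<longlongrightarrow> c * (k * 0) powr (1 / p)) (at_right 0)"
    using assms by (intro tendsto_intros tendsto_powr2)
      (auto intro!: eventually_mono[OF eventually_at_right_less])
  then show ?thesis by simp
qed

text \<open>By uniform boundedness and linearity, convergence to 0 on the indicators of the sets \<open>(a, 1) \<times> {\<gamma>}\<close>
spreads to all of \<open>M\<^sup>\<bottom>\<close>.\<close>

lemma bandN_family_tendsto_0:
  fixes B :: "real \<Rightarrow> 'g L0 \<Rightarrow> 'g L0"
  assumes p: "1 \<le> p" and F: "F \<in> bandN p"
    and closed: "\<And>h F. 0 < h \<Longrightarrow> F \<in> bandN p \<Longrightarrow> B h F \<in> Lp p"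
    and B_add: "\<And>h F G. B h (F + G) = B h F + B h G"
    and B_scaleR: "\<And>h c F. B h (c *\<^sub>R F) = c *\<^sub>R B h F"
    and bound: "\<And>h F. 0 < h \<Longrightarrow> F \<in> bandN p \<Longrightarrow> Lp_norm p (B h F) \<le> C * Lp_norm p F"
    and base: "\<And>a \<gamma>. 0 \<le> a \<Longrightarrow> a < 1 \<Longrightarrow>
      ((\<lambda>h. Lp_norm p (B h (cls (fibre \<gamma> (indicator {a<..}))))) \<longlongrightarrow> 0) (at_right 0)"
  shows "((\<lambda>h. Lp_norm p (B h F)) \<longlongrightarrow> 0) (at_right 0)"
proof -
  interpret normed_subspace "Lp p :: 'g L0 set" "Lp_norm p" by (rule normed_subspace_Lp[OF p])
  have ev: "\<forall>\<^sub>F h in at_right 0. B h F \<in> Lp p" if "F \<in> bandN p" for F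
    using eventually_at_right_less[of 0] by eventually_elim (rule closed[OF _ that])
  show ?thesis
    using p F
  proof (induction rule: bandN_closed_subspace_induct)
    case (add F G)
    then show ?case unfolding B_add by (intro N_tendsto_0_add eventually_conj ev)
  next
    case (scale F c)
    then show ?case unfolding B_scaleR by (intro N_tendsto_0_scaleR ev)
  next
    case (lim s F)
    have B_diff: "B h (F - G) = B h F - B h G" for h F G
      using B_add[of h F "(-1) *\<^sub>R G"] B_scaleR[of h "-1" G] by simp
    show ?case
    proof (rule tendsto_0_closed[where B = B and Y = "bandN p" and s = s and C = C])
      show "bandN p \<subseteq> Lp p" by (auto intro: bands_subset)
    qed (simp_all add: closed B_diff bound lim bands_closed(7)[OF p])
  qed (rule base)
qed

text \<open>Translation by \<open>h\<close> changes the indicator of \<open>(a, 1)\<close> only on \<open>(a, a + h]\<close>.\<close>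

lemma shift_strongly_continuous:
  fixes F :: "'g L0"
  assumes p: "1 \<le> p" and F: "F \<in> bandN p"
  shows "((\<lambda>h. Lp_norm p (shift h F - F)) \<longlongrightarrow> 0) (at_right 0)"
proof -
  interpret normed_subspace "Lp p :: 'g L0 set" "Lp_norm p" by (rule normed_subspace_Lp[OF p])
  show ?thesis
  proof (rule bandN_family_tendsto_0[OF p F, where B = "\<lambda>h F. shift h F - F" and C = 2])
    fix h :: real and F :: "'g L0" assume "F \<in> bandN p"
    then have FL: "F \<in> Lp p" by (rule bands_subset)
    note sL = Lp_norm_shift_le[OF p FL, of h]
    show "shift h F - F \<in> Lp p" by (intro X_diff sL FL)
    show "Lp_norm p (shift h F - F) \<le> 2 * Lp_norm p F"
      using N_diff_le[OF sL(1) FL] sL(2) by simp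
  next
    fix a :: real and \<gamma> :: 'g assume base: "0 \<le> a" "a < 1"
    have le: "Lp_norm p (shift h (cls (fibre \<gamma> (indicator {a<..}))) - cls (fibre \<gamma> (indicator {a<..}))) \<le> 1 * (1 * h) powr (1 / p)"
      if h: "h > 0" for h
    proof -
      have "shift h (cls (fibre \<gamma> (indicator {a<..}))) - cls (fibre \<gamma> (indicator {a<..})) =
          cls (fibre \<gamma> (\<lambda>x. - indicator {a<..a + h} x))"
      proof -
        have "(\<lambda>\<omega>. fibre \<gamma> (indicator {a + h<..}) \<omega> - fibre \<gamma> (indicator {a<..}) \<omega>) =
            fibre \<gamma> (\<lambda>x. - indicator {a<..a + h} x)"
          using h by (auto simp: fun_eq_iff fibre_def split: split_indicator)
        then show ?thesis using h base by (simp add: shift_fibre_indicator cls_diff)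
      qed
      also have "Lp_norm p \<dots> \<le> 1 * h powr (1 / p)"
        by (rule Lp_fibre_bounded(2)[OF p _ , where B = "{a<..a+h}"]) (use h in auto)
      finally show ?thesis by simp
    qed
    show "((\<lambda>h. Lp_norm p (shift h (cls (fibre \<gamma> (indicator {a<..}))) - cls (fibre \<gamma> (indicator {a<..})))) \<longlongrightarrow> 0) (at_right 0)"
    proof (rule tendsto_sandwich[OF _ _ tendsto_const tendsto_powr_at_right_0[OF p, of 1 1]])
      show "\<forall>\<^sub>F h in at_right 0. Lp_norm p (shift h (cls (fibre \<gamma> (indicator {a<..}))) - cls (fibre \<gamma> (indicator {a<..}))) \<le> 1 * (1 * h) powr (1 / p)"
        using eventually_at_right_less[of 0] by eventually_elim (rule le)
    qed (simp_all add: Lp_norm_nonneg')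
  qed (simp_all add: shift_add shift_scaleR scaleR_diff_right)
qed

lemma C0_semigroup_direct_sum:
  fixes K R :: "real \<Rightarrow> 'g L0 \<Rightarrow> 'g L0"
  assumes p: "1 \<le> p" and K: "C0_semigroup (bandM p) (Lp_norm p) K" and R: "C0_semigroup (bandN p) (Lp_norm p) R"
  shows "C0_semigroup (Lp p) (Lp_norm p) (\<lambda>t F. K t (projM p F) + R t (F - projM p F))"
proof -
  interpret normed_subspace "Lp p :: 'g L0 set" "Lp_norm p" by (rule normed_subspace_Lp[OF p])
  note P = projM[OF p]
  have Kcl: "K t F \<in> bandM p" if "0 \<le> t" "F \<in> bandM p" for t F
    using K that by (simp add: C0_semigroup_def bounded_op_def)
  have Rcl: "R t F \<in> bandN p" if "0 \<le> t" "F \<in> bandN p" for t F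
    using R that by (simp add: C0_semigroup_def bounded_op_def)
  have PN: "F - projM p F + (G - projM p G) = (F + G) - projM p (F + G)" if "F \<in> Lp p" "G \<in> Lp p" for F G
    using that by (simp add: projM_add[OF p])
  show ?thesis
    unfolding C0_semigroup_def
  proof (intro conjI allI ballI impI)
    fix t :: real assume t: "0 \<le> t"
    have Kadd: "K t (F + G) = K t F + K t G" "K t (c *\<^sub>R F) = c *\<^sub>R K t F" if "F \<in> bandM p" "G \<in> bandM p" for F G c
      using K t that by (simp_all add: C0_semigroup_def bounded_op_def)
    have Radd: "R t (F + G) = R t F + R t G" "R t (c *\<^sub>R F) = c *\<^sub>R R t F" if "F \<in> bandN p" "G \<in> bandN p" for F G c
      using R t that by (simp_all add: C0_semigroup_def bounded_op_def)
    have "\<exists>C. \<forall>F\<in>bandM p. Lp_norm p (K t F) \<le> C * Lp_norm p F" "\<exists>C. \<forall>F\<in>bandN p. Lp_norm p (R t F) \<le> C * Lp_norm p F"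
      using K R t by (simp_all add: C0_semigroup_def bounded_op_def)
    then obtain C1 C2 where C1: "\<And>F. F \<in> bandM p \<Longrightarrow> Lp_norm p (K t F) \<le> C1 * Lp_norm p F"
      and C2: "\<And>F. F \<in> bandN p \<Longrightarrow> Lp_norm p (R t F) \<le> C2 * Lp_norm p F"
      by metis
    show "bounded_op (Lp p) (Lp_norm p) (\<lambda>F. K t (projM p F) + R t (F - projM p F))"
      unfolding bounded_op_def
    proof (intro conjI ballI allI)
      fix F G :: "'g L0" and c :: real assume F: "F \<in> Lp p"
      show "K t (projM p F) + R t (F - projM p F) \<in> Lp p"
        using Kcl[OF t P(1)[OF F]] Rcl[OF t P(2)[OF F]] by (intro X_add bands_subset)
      have "c *\<^sub>R F - projM p (c *\<^sub>R F) = c *\<^sub>R (F - projM p F)"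
        using F by (simp add: projM_scaleR[OF p] algebra_simps)
      then show "K t (projM p (c *\<^sub>R F)) + R t (c *\<^sub>R F - projM p (c *\<^sub>R F)) =
          c *\<^sub>R (K t (projM p F) + R t (F - projM p F))"
        using F P[OF F] by (simp add: projM_scaleR[OF p] Kadd Radd scaleR_add_right)
      assume G: "G \<in> Lp p"
      show "K t (projM p (F + G)) + R t (F + G - projM p (F + G)) =
          K t (projM p F) + R t (F - projM p F) + (K t (projM p G) + R t (G - projM p G))"
        unfolding PN[OF F G, symmetric] using P[OF F] P[OF G] F G by (simp add: projM_add[OF p] Kadd Radd)
    next
      show "\<exists>C. \<forall>F\<in>Lp p. Lp_norm p (K t (projM p F) + R t (F - projM p F)) \<le> C * Lp_norm p F"
      proof (intro exI ballI)
        fix F :: "'g L0" assume F: "F \<in> Lp p"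
        have "Lp_norm p (K t (projM p F) + R t (F - projM p F)) \<le>
            Lp_norm p (K t (projM p F)) + Lp_norm p (R t (F - projM p F))"
          using Kcl[OF t P(1)[OF F]] Rcl[OF t P(2)[OF F]] by (intro N_triangle bands_subset)
        also have "\<dots> \<le> C1 * Lp_norm p (projM p F) + C2 * Lp_norm p (F - projM p F)"
          by (intro add_mono C1 C2 P F)
        also have "\<dots> \<le> \<bar>C1\<bar> * Lp_norm p F + \<bar>C2\<bar> * Lp_norm p F"
          by (intro add_mono mult_mono P F) (auto simp: Lp_norm_nonneg')
        finally show "Lp_norm p (K t (projM p F) + R t (F - projM p F)) \<le> (\<bar>C1\<bar> + \<bar>C2\<bar>) * Lp_norm p F"
          by (simp add: algebra_simps)
      qed
    qed
  next
    fix F :: "'g L0" assume F: "F \<in> Lp p"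
    show "K 0 (projM p F) + R 0 (F - projM p F) = F"
      using K R P[OF F] by (simp add: C0_semigroup_def)
    have "((\<lambda>t. Lp_norm p ((K t (projM p F) - projM p F) + (R t (F - projM p F) - (F - projM p F)))) \<longlongrightarrow> 0) (at_right 0)"
    proof (rule N_tendsto_0_add)
      show "((\<lambda>t. Lp_norm p (K t (projM p F) - projM p F)) \<longlongrightarrow> 0) (at_right 0)"
        using K P[OF F] by (simp add: C0_semigroup_def)
      show "((\<lambda>t. Lp_norm p (R t (F - projM p F) - (F - projM p F))) \<longlongrightarrow> 0) (at_right 0)"
        using R P[OF F] by (simp add: C0_semigroup_def)
      show "\<forall>\<^sub>F t in at_right 0. K t (projM p F) - projM p F \<in> Lp p \<and> R t (F - projM p F) - (F - projM p F) \<in> Lp p"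
        using eventually_at_right_less[of 0]
      proof eventually_elim
        case (elim t)
        then have "K t (projM p F) \<in> Lp p" "projM p F \<in> Lp p" "R t (F - projM p F) \<in> Lp p" "F - projM p F \<in> Lp p"
          using Kcl[OF _ P(1)[OF F]] Rcl[OF _ P(2)[OF F]] P[OF F] by (auto intro: bands_subset)
        then show ?case by (intro conjI X_diff F)
      qed
    qed
    then show "((\<lambda>t. Lp_norm p (K t (projM p F) + R t (F - projM p F) - F)) \<longlongrightarrow> 0) (at_right 0)"
      by (simp add: algebra_simps)
  next
    fix s t :: real and F :: "'g L0" assume s: "0 \<le> s" and t: "0 \<le> t" and F: "F \<in> Lp p"
    have "projM p (K t (projM p F) + R t (F - projM p F)) = K t (projM p F)"
      by (intro projM_eq p Kcl Rcl t P F)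
    then show "K (s + t) (projM p F) + R (s + t) (F - projM p F) =
        K s (projM p (K t (projM p F) + R t (F - projM p F))) +
        R s (K t (projM p F) + R t (F - projM p F) - projM p (K t (projM p F) + R t (F - projM p F)))"
      using K R P[OF F] s t by (simp add: C0_semigroup_def)
  qed
qed

lemma C0_semigroup_shift:
  assumes p: "1 \<le> p"
  shows "C0_semigroup (bandN p) (Lp_norm p) shift"
  unfolding C0_semigroup_def bounded_op_def
  using shift_strongly_continuous[OF p]
  by (auto simp: shift_bandN[OF p] shift_add shift_scaleR shift_0 shift_shift
      intro!: exI[of _ 1] Lp_norm_shift_le[OF p] bands_subset)

theorem C0_semigroup_T:
  assumes p: "1 \<le> p"
  shows "C0_semigroup (Lp p) (Lp_norm p) (T_sg p)"
proof -
  interpret normed_subspace "Lp p" "Lp_norm p" by (rule normed_subspace_Lp[OF p])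
  have "C0_semigroup (bandM p) (Lp_norm p) (\<lambda>_ F. F)"
    by (auto simp: C0_semigroup_def bounded_op_def intro!: exI[of _ 1])
  from C0_semigroup_direct_sum[OF p this C0_semigroup_shift[OF p]]
  show ?thesis by (simp add: T_sg_def[abs_def])
qed

text \<open>The ramps \<open>r\<close> that increase from 0 to 1 on \<open>[a, a + e]\<close> are Lipschitz continuous and vanish at the left
end of the interval, where the translation inserts zeros. Their difference quotients agree with the
derivative except on the intervals of length \<open>h\<close> to the right of the two kinks.\<close>

lemma ramp_in_generator:
  fixes a e :: real
  assumes p: "1 \<le> p" and a: "0 \<le> a" and e: "0 < e"
  defines "r \<equiv> \<lambda>x. min 1 (max 0 ((x - a) / e))"
  shows "(cls (fibre \<gamma> r), cls (fibre \<gamma> (\<lambda>x. - indicator {a<..a + e} x / e))) \<in> generator (Lp p) (Lp_norm p) (T_sg p)"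
proof -
  interpret normed_subspace "Lp p" "Lp_norm p" by (rule normed_subspace_Lp[OF p])
  let ?G = "cls (fibre \<gamma> r)" and ?G' = "cls (fibre \<gamma> (\<lambda>x. - indicator {a<..a + e} x / e))"
  have rm [measurable]: "r \<in> borel_measurable borel" unfolding r_def by measurable
  have GN: "?G \<in> bandN p"
    by (rule Lp_fibre_bounded(1)[OF p rm, where B = "{0<..<1}" and m = 1 and c = 1]) (auto simp: r_def)
  have G'N: "?G' \<in> bandN p"
    by (rule Lp_fibre_bounded(1)[OF p _, where B = "{0<..<1}" and m = 1 and c = "1 / e"])
      (use e in \<open>auto split: split_indicator\<close>)
  have le: "Lp_norm p ((1 / h) *\<^sub>R (T_sg p h ?G - ?G) - ?G') \<le> (2 / e) * (2 * h) powr (1 / p)" if h: "h > 0" for h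
  proof -
    define d where "d x = (1 / h) * (r (x - h) - r x) + indicator {a<..a + e} x / e" for x
    have dm [measurable]: "d \<in> borel_measurable borel" unfolding d_def by measurable
    have "shift h ?G = cls (fibre \<gamma> (\<lambda>x. r (x - h)))"
    proof -
      have "shift_fun h (fibre \<gamma> r) \<omega> = fibre \<gamma> (\<lambda>x. r (x - h)) \<omega>" if "\<omega> \<in> Omega" for \<omega>
      proof (cases \<omega>)
        case (Pair x \<gamma>')
        have "r (x - h) = 0" if "x - h \<le> 0"
        proof -
          have "(x - h - a) / e \<le> 0" using that a e by (simp add: divide_le_0_iff)
          then show ?thesis by (simp add: r_def)
        qed
        then show ?thesis using Pair that h by (auto simp: shift_fun_def fibre_apply Omega_def)
      qed
      then show ?thesis by (auto simp: cls_shift cls_eq_iff shift_fun_measurable intro!: AE_I2)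
    qed
    then have "T_sg p h ?G = cls (fibre \<gamma> (\<lambda>x. r (x - h)))"
      using projM_0[OF p GN] by (simp add: T_sg_def)
    then have "(1 / h) *\<^sub>R (T_sg p h ?G - ?G) - ?G' = cls (\<lambda>\<omega>. (1 / h) * (fibre \<gamma> (\<lambda>x. r (x - h)) \<omega> - fibre \<gamma> r \<omega>) - fibre \<gamma> (\<lambda>x. - indicator {a<..a + e} x / e) \<omega>)"
      by (simp add: cls_diff cls_scaleR)
    also have "(\<lambda>\<omega>. (1 / h) * (fibre \<gamma> (\<lambda>x. r (x - h)) \<omega> - fibre \<gamma> r \<omega>) - fibre \<gamma> (\<lambda>x. - indicator {a<..a + e} x / e) \<omega>) = fibre \<gamma> d"
      by (auto simp: fibre_def d_def)
    also have "Lp_norm p (cls (fibre \<gamma> d)) \<le> (2 / e) * (2 * h) powr (1 / p)"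
    proof (rule Lp_fibre_bounded(2)[OF p dm, where B = "{a<..a + h} \<union> {a + e<..a + e + h}"])
      have "emeasure lborel ({a<..a + h} \<union> {a + e<..a + e + h}) \<le> emeasure lborel {a<..a + h} + emeasure lborel {a + e<..a + e + h}"
        by (intro emeasure_subadditive) auto
      also have "\<dots> = ennreal (2 * h)" using h by (simp flip: ennreal_plus)
      finally show "emeasure lborel ({a<..a + h} \<union> {a + e<..a + e + h}) \<le> ennreal (2 * h)" .
      fix x :: real
      show "\<bar>d x\<bar> \<le> 2 / e * indicator ({a<..a + h} \<union> {a + e<..a + e + h}) x"
      proof (cases "x \<in> {a<..a + h} \<union> {a + e<..a + e + h}")
        case True
        have "\<bar>min 1 (max 0 u) - min 1 (max 0 v)\<bar> \<le> \<bar>u - v\<bar>" for u v :: real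
          by (auto simp: min_def max_def)
        then have "\<bar>r (x - h) - r x\<bar> \<le> \<bar>(x - h - a) / e - (x - a) / e\<bar>" unfolding r_def .
        also have "\<dots> = h / e" using h e by (simp add: field_simps abs_if)
        finally have "(1 / h) * \<bar>r (x - h) - r x\<bar> \<le> (1 / h) * (h / e)"
          using h by (intro mult_left_mono) auto
        then have "\<bar>(1 / h) * (r (x - h) - r x)\<bar> \<le> (1 / h) * (h / e)"
          using h by (simp add: abs_mult)
        then have "\<bar>(1 / h) * (r (x - h) - r x)\<bar> \<le> 1 / e" using h by simp
        moreover have "\<bar>indicator {a<..a + e} x / e\<bar> \<le> 1 / e" using e by (auto split: split_indicator)
        ultimately have "\<bar>d x\<bar> \<le> 1 / e + 1 / e" unfolding d_def by linarith
        then show ?thesis using True by simp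
      next
        case False
        consider "x \<le> a" | "a + h < x" "x \<le> a + e" | "a + e + h < x" using False h by fastforce
        then have "d x = 0"
        proof cases
          case 1
          then have "(x - a) / e \<le> 0" "(x - h - a) / e \<le> 0" using e h by (simp_all add: divide_le_0_iff)
          then show ?thesis using 1 by (simp add: d_def r_def)
        next
          case 2
          then have "0 \<le> (x - a) / e" "(x - a) / e \<le> 1" "0 \<le> (x - h - a) / e" "(x - h - a) / e \<le> 1"
            using e h by (simp_all add: field_simps)
          then have "r x = (x - a) / e" "r (x - h) = (x - h - a) / e" by (simp_all add: r_def)
          then show ?thesis using 2 h e by (simp add: d_def field_simps)
        next
          case 3
          then have "1 \<le> (x - a) / e" "1 \<le> (x - h - a) / e" using e h by (simp_all add: field_simps)
          then show ?thesis using 3 h by (simp add: d_def r_def)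
        qed
        then show ?thesis using e by simp
      qed
    qed (use h e in auto)
    finally show ?thesis .
  qed
  have "((\<lambda>h. Lp_norm p ((1 / h) *\<^sub>R (T_sg p h ?G - ?G) - ?G')) \<longlongrightarrow> 0) (at_right 0)"
  proof (rule tendsto_sandwich[OF _ _ tendsto_const tendsto_powr_at_right_0[OF p, of 2 "2 / e"]])
    show "\<forall>\<^sub>F h in at_right 0. Lp_norm p ((1 / h) *\<^sub>R (T_sg p h ?G - ?G) - ?G') \<le> (2 / e) * (2 * h) powr (1 / p)"
      using eventually_at_right_less[of 0] by eventually_elim (rule le)
  qed (simp_all add: Lp_norm_nonneg')
  then show ?thesis using GN G'N by (simp add: generator_def bands_subset)
qed

text \<open>On \<open>M\<close> the semigroup is constant, so \<open>M\<close> is contained in the domain. On \<open>M\<^sup>\<bottom>\<close>, the indicator of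
\<open>(a, 1)\<close> on a fibre is approximated by ramps.\<close>

theorem generator_T_dense:
  fixes F :: "'g L0"
  assumes p: "1 \<le> p" and F: "F \<in> Lp p" and e: "0 < e"
  shows "\<exists>G\<in>Domain (generator (Lp p) (Lp_norm p) (T_sg p)). Lp_norm p (F - G) < e"
proof -
  interpret normed_subspace "Lp p :: 'g L0 set" "Lp_norm p" by (rule normed_subspace_Lp[OF p])
  let ?A = "generator (Lp p) (Lp_norm p) (T_sg p) :: ('g L0 \<times> 'g L0) set"
  note T = C0_semigroup_T[OF p, where ?'a = 'g]
  have DX: "G \<in> Lp p" if "G \<in> Domain ?A" for G using that by (auto simp: generator_def)
  have Dadd: "G + H \<in> Domain ?A" if "G \<in> Domain ?A" "H \<in> Domain ?A" for G H
    using that generator_add[OF T] by blast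
  have Dscale: "c *\<^sub>R G \<in> Domain ?A" if "G \<in> Domain ?A" for G c
    using that generator_scaleR[OF T] by blast
  have M: "G \<in> Domain ?A" if G: "G \<in> bandM p" for G
  proof -
    have "T_sg p h G = G" for h
      using projM_id[OF p G] shift_scaleR[of h 0 0] by (simp add: T_sg_def)
    then have "(G, 0) \<in> ?A" using G by (simp add: generator_def bands_subset)
    then show ?thesis by blast
  qed
  have N: "\<forall>e>0. \<exists>G\<in>Domain ?A. Lp_norm p (F - G) < e" if F: "F \<in> bandN p" for F
    using p F
  proof (induction rule: bandN_closed_subspace_induct)
    case (add F G)
    show ?case
    proof (intro allI impI)
      fix e :: real assume "e > 0"
      then obtain F' G' where FG: "F' \<in> Domain ?A" "Lp_norm p (F - F') < e / 2" "G' \<in> Domain ?A" "Lp_norm p (G - G') < e / 2"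
        using add by (meson half_gt_zero)
      have "F \<in> Lp p" "G \<in> Lp p" using add(1,2) by (simp_all only: bands_subset(2))
      with DX[OF FG(1)] DX[OF FG(3)] have X: "F - F' \<in> Lp p" "G - G' \<in> Lp p" by simp_all
      have "Lp_norm p ((F - F') + (G - G')) < e" using N_triangle[OF X] FG by linarith
      then show "\<exists>G''\<in>Domain ?A. Lp_norm p (F + G - G'') < e"
        using Dadd[OF FG(1,3)] by (intro bexI[of _ "F' + G'"]) (simp_all add: algebra_simps)
    qed
  next
    case (scale F c)
    show ?case
    proof (intro allI impI)
      fix e :: real assume e: "e > 0"
      then obtain F' where F': "F' \<in> Domain ?A" "Lp_norm p (F - F') < e / (\<bar>c\<bar> + 1)"
        using scale by (meson abs_ge_zero add_nonneg_pos divide_pos_pos zero_less_one)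
      have "F \<in> Lp p" using scale(1) by (simp only: bands_subset(2))
      with DX[OF F'(1)] have X: "F - F' \<in> Lp p" by simp
      have "Lp_norm p (c *\<^sub>R (F - F')) = \<bar>c\<bar> * Lp_norm p (F - F')" using X by (rule N_scaleR)
      also have "\<dots> \<le> (\<bar>c\<bar> + 1) * Lp_norm p (F - F')" using X by (intro mult_right_mono) auto
      also have "\<dots> < e" using F'(2) by (simp add: field_simps)
      finally show "\<exists>G\<in>Domain ?A. Lp_norm p (c *\<^sub>R F - G) < e"
        using Dscale[OF F'(1), of c] by (intro bexI[of _ "c *\<^sub>R F'"]) (simp_all add: algebra_simps)
    qed
  next
    case (lim s F)
    show ?case
    proof (intro allI impI)
      fix e :: real assume e: "e > 0"
      have "\<forall>\<^sub>F i in sequentially. Lp_norm p (s i - F) < e / 2" using e by (intro order_tendstoD[OF lim(3)]) simp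
      then obtain i where i: "Lp_norm p (s i - F) < e / 2" by (auto simp: eventually_sequentially)
      obtain G where G: "G \<in> Domain ?A" "Lp_norm p (s i - G) < e / 2" using lim(4)[of i] e by (meson half_gt_zero)
      have X: "F \<in> Lp p" "s i \<in> Lp p" "G \<in> Lp p" using lim(1,2) DX[OF G(1)] by (simp_all only: bands_subset(2))
      have "Lp_norm p (F - G) < e"
        using N_diff_triangle[OF X] i G(2) X by (simp add: N_diff_commute)
      with G(1) show "\<exists>G\<in>Domain ?A. Lp_norm p (F - G) < e" by blast
    qed
  next
    case (base a \<gamma>)
    show ?case
    proof (intro allI impI)
      fix e :: real assume e: "e > 0"
      have "\<forall>\<^sub>F h in at_right 0. 1 * (1 * h) powr (1 / p) < e"
        using e by (intro order_tendstoD[OF tendsto_powr_at_right_0[OF p]]) auto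
      then obtain b where b: "b > 0" "\<And>h. 0 < h \<Longrightarrow> h < b \<Longrightarrow> h powr (1 / p) < e"
        by (auto simp: eventually_at_right_field)
      define h where "h = b / 2"
      have h: "h > 0" "h powr (1 / p) < e" using b by (auto simp: h_def)
      define r where "r x = min 1 (max 0 ((x - a) / h))" for x :: real
      have rm [measurable]: "r \<in> borel_measurable borel" unfolding r_def by measurable
      have D: "cls (fibre \<gamma> r) \<in> Domain ?A"
        using ramp_in_generator[OF p base(1) h(1), of \<gamma>] unfolding r_def[abs_def] by blast
      have "cls (fibre \<gamma> (indicator {a<..})) - cls (fibre \<gamma> r) = cls (fibre \<gamma> (\<lambda>x. indicator {a<..} x - r x))"
      proof -
        have "(\<lambda>\<omega>. fibre \<gamma> (indicator {a<..}) \<omega> - fibre \<gamma> r \<omega>) = fibre \<gamma> (\<lambda>x. indicator {a<..} x - r x)"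
          by (auto simp: fun_eq_iff fibre_def)
        then show ?thesis by (simp add: cls_diff)
      qed
      also have "Lp_norm p \<dots> \<le> 1 * h powr (1 / p)"
      proof (rule Lp_fibre_bounded(2)[OF p, where B = "{a<..a + h}"])
        fix x :: real
        consider "x \<le> a" | "a < x" "x \<le> a + h" | "a + h < x" by linarith
        then show "\<bar>indicator {a<..} x - r x\<bar> \<le> 1 * indicator {a<..a + h} x"
        proof cases
          case 1
          then have "(x - a) / h \<le> 0" using h by (simp add: divide_le_0_iff)
          then show ?thesis using 1 by (simp add: r_def)
        next
          case 2
          then show ?thesis by (simp add: r_def min_def max_def)
        next
          case 3
          then have "1 \<le> (x - a) / h" using h by (simp add: field_simps)
          then show ?thesis using 3 h by (simp add: r_def)
        qed
      qed (use h in auto)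
      finally show "\<exists>G\<in>Domain ?A. Lp_norm p (cls (fibre \<gamma> (indicator {a<..})) - G) < e"
        using D h by (intro bexI[of _ "cls (fibre \<gamma> r)"]) auto
    qed
  qed
  obtain G where G: "G \<in> Domain ?A" "Lp_norm p ((F - projM p F) - G) < e"
    using N[OF projM(2)[OF p F]] e by blast
  have "projM p F + G \<in> Domain ?A" by (intro Dadd M projM p F G)
  moreover have "F - (projM p F + G) = (F - projM p F) - G" by simp
  ultimately show ?thesis using G(2) by metis
qed

section \<open>Perturbation by a bounded potential\<close>

lemma exp_minus_bounds:
  fixes a :: real
  assumes "0 \<le> a"
  shows "\<bar>exp (- a) - 1 + a\<bar> \<le> a\<^sup>2" "\<bar>exp (- a) - 1\<bar> \<le> a"
proof -
  have lo: "1 - a \<le> exp (- a)" using exp_ge_add_one_self[of "- a"] by simp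
  have "exp (- a) = 1 / exp a" by (simp add: exp_minus inverse_eq_divide)
  also have "\<dots> \<le> 1 / (1 + a)" using assms exp_ge_add_one_self[of a] by (intro divide_left_mono) auto
  also have "\<dots> \<le> 1 - a + a\<^sup>2"
  proof -
    have "1 \<le> (1 - a + a\<^sup>2) * (1 + a)" using assms by (simp add: algebra_simps power2_eq_square)
    then show ?thesis using assms by (simp add: divide_le_eq)
  qed
  finally have "exp (- a) \<le> 1 - a + a\<^sup>2" .
  with lo show "\<bar>exp (- a) - 1 + a\<bar> \<le> a\<^sup>2" by simp
  have "exp (- a) \<le> 1" using assms by simp
  with lo show "\<bar>exp (- a) - 1\<bar> \<le> a" by simp
qed

lemma Lp_norm_fibre_le:
  assumes p: "1 \<le> p" and \<phi> [measurable]: "\<phi> \<in> borel_measurable borel" and r: "0 \<le> r"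
    and le: "(\<integral>\<^sup>+x. ennreal (\<bar>\<phi> x\<bar> powr p) * indicator {0<..<1} x \<partial>lborel) \<le> ennreal (r powr p)"
  shows "Lp_norm p (cls (fibre \<gamma> \<phi>)) \<le> r"
proof -
  have *: "(\<integral>\<^sup>+\<omega>. ennreal (\<bar>fibre \<gamma> \<phi> \<omega>\<bar> powr p) \<partial>mu) \<le> ennreal (r powr p)"
    unfolding fibre_powr using le by (subst nn_integral_fibre_fun) measurable
  then have int: "integrable mu (\<lambda>\<omega>. \<bar>fibre \<gamma> \<phi> \<omega>\<bar> powr p)"
    by (intro integrableI_bounded) (auto intro: le_less_trans)
  have "(LINT \<omega>|mu. \<bar>fibre \<gamma> \<phi> \<omega>\<bar> powr p) \<le> r powr p"
    using * by (subst (asm) nn_integral_eq_integral[OF int]) auto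
  then show ?thesis using p r by (subst Lp_norm_le_iff) auto
qed

lemma L1_norm_fibre:
  assumes \<phi> [measurable]: "\<phi> \<in> borel_measurable borel" and L: "cls (fibre \<gamma> \<phi>) \<in> Lp 1"
  shows "(\<integral>\<^sup>+x. ennreal \<bar>\<phi> x\<bar> * indicator {0<..<1} x \<partial>lborel) = ennreal (Lp_norm 1 (cls (fibre \<gamma> \<phi>)))"
proof -
  have [simp]: "\<bar>y\<bar> powr 1 = \<bar>y\<bar>" for y :: real by simp
  have int: "integrable mu (\<lambda>\<omega>. \<bar>fibre \<gamma> \<phi> \<omega>\<bar> powr 1)" using L by (subst (asm) cls_in_Lp) auto
  have "(\<integral>\<^sup>+x. ennreal (\<bar>\<phi> x\<bar> powr 1) * indicator {0<..<1} x \<partial>lborel) =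
      (\<integral>\<^sup>+\<omega>. ennreal (\<bar>fibre \<gamma> \<phi> \<omega>\<bar> powr 1) \<partial>mu)"
    unfolding fibre_powr by (rule nn_integral_fibre_fun[symmetric]) measurable
  also have "\<dots> = ennreal (LINT \<omega>|mu. \<bar>fibre \<gamma> \<phi> \<omega>\<bar> powr 1)"
    by (rule nn_integral_eq_integral[OF int]) simp
  also have "(LINT \<omega>|mu. \<bar>fibre \<gamma> \<phi> \<omega>\<bar> powr 1) = Lp_norm 1 (cls (fibre \<gamma> \<phi>))"
    using Lp_norm_powr[of "fibre \<gamma> \<phi>" 1] Lp_norm_nonneg'[of 1 "cls (fibre \<gamma> \<phi>)"] by simp
  finally show ?thesis by simp
qed

lemma times_scaleR_L0: "F * (c *\<^sub>R G) = c *\<^sub>R (F * G)" for F G :: "'g L0"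
  by transfer (auto simp: ae_eq_def algebra_simps)

lemma mult_one: "cls (\<lambda>_. 1) * F = F"
  by (cases F rule: L0_cases) (simp add: cls_times)

text \<open>The potential \<open>w\<close> will be \<open>min(W, n)\<close> on \<open>(0, 1)\<close>, extended by 0.\<close>

locale bounded_potential =
  fixes w :: "real \<Rightarrow> real" and c :: real
  assumes w_meas [measurable]: "w \<in> borel_measurable borel"
    and w_nonneg: "0 \<le> w x" and w_le: "w x \<le> c" and c_pos: "0 < c"
begin

text \<open>A primitive of \<open>w\<close>: a particle that moves from \<open>a\<close> to \<open>b\<close> is damped by \<open>exp(-(G b - G a))\<close>.\<close>

definition G :: "real \<Rightarrow> real" where
  "G x = (LINT y|lborel. indicator {0<..x} y * w y)"

lemma integrable_interval: "integrable lborel (\<lambda>y. indicator {a<..b} y * w y)"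
proof (rule Bochner_Integration.integrable_bound)
  show "integrable lborel (\<lambda>y. c * indicator {a<..b} y)" by (cases "a \<le> b") auto
  show "AE y in lborel. norm (indicator {a<..b} y * w y) \<le> norm (c * indicator {a<..b} y)"
    using w_nonneg w_le c_pos by (intro AE_I2) (auto split: split_indicator)
qed measurable

lemma G_diff:
  assumes "0 \<le> a" "a \<le> b"
  shows "G b - G a = (LINT y|lborel. indicator {a<..b} y * w y)"
proof -
  have "G b = (LINT y|lborel. indicator {0<..a} y * w y + indicator {a<..b} y * w y)"
    unfolding G_def using assms by (intro Bochner_Integration.integral_cong) (auto split: split_indicator)
  also have "\<dots> = G a + (LINT y|lborel. indicator {a<..b} y * w y)"
    unfolding G_def by (rule Bochner_Integration.integral_add; rule integrable_interval)
  finally show ?thesis by simp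
qed

lemma G_neg: "x \<le> 0 \<Longrightarrow> G x = 0"
  by (simp add: G_def)

lemma G_diff_bounds:
  assumes "0 \<le> a" "a \<le> b"
  shows "0 \<le> G b - G a" "G b - G a \<le> c * (b - a)"
proof -
  show "0 \<le> G b - G a" unfolding G_diff[OF assms] using w_nonneg by (intro integral_nonneg_AE) auto
  have "(LINT y|lborel. indicator {a<..b} y * w y) \<le> (LINT y|lborel. c * indicator {a<..b} y)"
    using w_le w_nonneg c_pos assms
    by (intro integral_mono integrable_interval) (auto split: split_indicator)
  also have "\<dots> = c * (b - a)" using assms by simp
  finally show "G b - G a \<le> c * (b - a)" unfolding G_diff[OF assms] .
qed

lemma G_mono: "mono G"
proof (rule monoI)
  fix x y :: real assume "x \<le> y"
  then show "G x \<le> G y"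
    using G_diff_bounds(1)[of x y] G_diff_bounds(1)[of 0 y] G_neg[of x] G_neg[of y] G_neg[of 0]
    by (cases "0 \<le> x"; cases "0 \<le> y") auto
qed

lemma G_meas [measurable]: "G \<in> borel_measurable borel"
  by (rule borel_measurable_mono[OF G_mono])

lemma G_bounds:
  assumes "0 \<le> x" "x \<le> 1"
  shows "0 \<le> G x \<and> G x \<le> c"
proof -
  have "c * x \<le> c" using assms c_pos mult_left_mono[of x 1 c] by linarith
  then show ?thesis using G_diff_bounds[of 0 x] G_neg[of 0] assms by simp
qed

lemma measurable_fst_mu:
  fixes \<phi> :: "real \<Rightarrow> real"
  assumes [measurable]: "\<phi> \<in> borel_measurable borel"
  shows "(\<lambda>\<omega>. \<phi> (fst \<omega>)) \<in> borel_measurable mu"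
proof -
  have "(\<lambda>x. if x \<in> {0<..<1} then \<phi> x else 0) \<in> borel_measurable borel" by measurable
  from measurable_mu_fst[OF this] show ?thesis by (simp add: case_prod_beta')
qed

definition eG :: "real \<Rightarrow> 'g L0" where
  "eG s = cls (\<lambda>\<omega>. exp (s * G (fst \<omega>)))"

lemma eG_meas: "(\<lambda>\<omega>. exp (s * G (fst \<omega>))) \<in> borel_measurable mu"
  by (rule measurable_fst_mu) measurable

lemma eG_bounded: "\<bar>s\<bar> \<le> 1 \<Longrightarrow> AE \<omega> in mu. \<bar>exp (s * G (fst \<omega>))\<bar> \<le> exp c"
proof (rule AE_I2)
  fix \<omega> :: "real \<times> 'g" assume s: "\<bar>s\<bar> \<le> 1" and "\<omega> \<in> space mu"
  then have "0 \<le> G (fst \<omega>)" "G (fst \<omega>) \<le> c" using G_bounds[of "fst \<omega>"] by (auto simp: Omega_def)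
  then have "\<bar>s * G (fst \<omega>)\<bar> \<le> 1 * c" unfolding abs_mult using s by (intro mult_mono) auto
  then show "\<bar>exp (s * G (fst \<omega>))\<bar> \<le> exp c" by simp
qed

lemma eG_inverse: "eG 1 * (eG (-1) * F) = F" "eG (-1) * (eG 1 * F) = F"
proof -
  have "eG 1 * eG (-1) = cls (\<lambda>_. 1)"
    unfolding eG_def by (subst cls_times[OF eG_meas eG_meas]) (simp flip: exp_add)
  then show "eG 1 * (eG (-1) * F) = F" "eG (-1) * (eG 1 * F) = F"
    by (metis mult.assoc mult.commute mult_one)+
qed

lemma eG_mult:
  assumes p: "1 \<le> p" and s: "\<bar>s\<bar> \<le> 1" and F: "F \<in> bandN p"
  shows "eG s * F \<in> bandN p" "Lp_norm p (eG s * F) \<le> exp c * Lp_norm p F"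
  unfolding eG_def
  using mult_bounded_Lp[OF p eG_meas eG_bounded[OF s] _ bands_subset(2)[OF F]] F by auto

text \<open>Damping along the way from \<open>x - t\<close> to \<open>x\<close> means multiplying by \<open>exp(G(x - t) - G(x))\<close>. In the form
\<open>exp(-G) shift(t) exp(G)\<close>, the semigroup law and the strong continuity are inherited from the
translation.\<close>

definition R :: "real \<Rightarrow> 'g L0 \<Rightarrow> 'g L0" where
  "R t F = eG (-1) * shift t (eG 1 * F)"

definition K :: "real \<Rightarrow> 'g L0 \<Rightarrow> 'g L0" where
  "K t F = cls (\<lambda>\<omega>. exp (- t * w (fst \<omega>))) * F"

definition V :: "'g L0 \<Rightarrow> 'g L0" where
  "V F = cls (\<lambda>\<omega>. w (fst \<omega>)) * F"

text \<open>The operator \<open>R t\<close> in terms of representatives. Since \<open>G\<close> is increasing, the exponential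
factor is at most 1 for \<open>t \<ge> 0\<close>.\<close>

definition R_fun :: "real \<Rightarrow> (real \<times> 'g \<Rightarrow> real) \<Rightarrow> real \<times> 'g \<Rightarrow> real" where
  "R_fun t f \<omega> = exp (G (fst \<omega> - t) - G (fst \<omega>)) * shift_fun t f \<omega>"

lemma R_fun_meas:
  assumes f: "f \<in> borel_measurable mu"
  shows "R_fun t f \<in> borel_measurable mu"
proof -
  have "(\<lambda>\<omega>::real \<times> 'g. exp (G (fst \<omega> - t) - G (fst \<omega>))) \<in> borel_measurable mu"
    by (rule measurable_fst_mu) measurable
  then show ?thesis unfolding R_fun_def using shift_fun_measurable[OF f, of t] by (rule borel_measurable_times)
qed

lemma R_cls:
  assumes f: "f \<in> borel_measurable mu"
  shows "R t (cls f) = cls (R_fun t f)"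
proof -
  have "eG 1 * cls f = cls (\<lambda>\<omega>. exp (1 * G (fst \<omega>)) * f \<omega>)"
    unfolding eG_def by (rule cls_times[OF eG_meas f])
  moreover have m: "(\<lambda>\<omega>. exp (1 * G (fst \<omega>)) * f \<omega>) \<in> borel_measurable mu"
    by (rule borel_measurable_times[OF eG_meas f])
  ultimately have "R t (cls f) = eG (-1) * cls (shift_fun t (\<lambda>\<omega>. exp (1 * G (fst \<omega>)) * f \<omega>))"
    unfolding R_def by (simp only: cls_shift[OF m])
  also have "\<dots> = cls (\<lambda>\<omega>. exp (-1 * G (fst \<omega>)) * shift_fun t (\<lambda>\<omega>. exp (1 * G (fst \<omega>)) * f \<omega>) \<omega>)"
    unfolding eG_def by (rule cls_times[OF eG_meas shift_fun_measurable[OF m]])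
  also have "(\<lambda>\<omega>. exp (-1 * G (fst \<omega>)) * shift_fun t (\<lambda>\<omega>. exp (1 * G (fst \<omega>)) * f \<omega>) \<omega>) = R_fun t f"
    by (auto simp: R_fun_def shift_fun_def fun_eq_iff exp_diff exp_minus field_simps)
  finally show ?thesis .
qed

lemma R_contraction:
  assumes p: "1 \<le> p" and t: "0 \<le> t" and F: "F \<in> bandN p"
  shows "R t F \<in> bandN p" "Lp_norm p (R t F) \<le> Lp_norm p F"
proof -
  show "R t F \<in> bandN p" unfolding R_def by (intro eG_mult p shift_bandN F) auto
  obtain f where f: "f \<in> borel_measurable mu" and Ff: "F = cls f" by (rule L0_cases)
  have FL: "F \<in> Lp p" by (rule bands_subset(2)[OF F])
  have "AE \<omega> in mu. \<bar>R_fun t f \<omega>\<bar> \<le> 1 * \<bar>shift_fun t f \<omega>\<bar>"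
  proof (rule AE_I2)
    fix \<omega> :: "real \<times> 'a"
    have "G (fst \<omega> - t) \<le> G (fst \<omega>)" using t by (intro monoD[OF G_mono]) simp
    then show "\<bar>R_fun t f \<omega>\<bar> \<le> 1 * \<bar>shift_fun t f \<omega>\<bar>"
      unfolding R_fun_def abs_mult by (intro mult_right_mono) auto
  qed
  then have "Lp_norm p (cls (R_fun t f)) \<le> 1 * Lp_norm p (cls (shift_fun t f))"
    using Lp_norm_shift_le(1)[OF p FL, of t] f
    by (intro Lp_bounded_by(2) R_fun_meas shift_fun_measurable p) (simp_all add: Ff cls_shift)
  then show "Lp_norm p (R t F) \<le> Lp_norm p F"
    using Lp_norm_shift_le(2)[OF p FL, of t] f by (simp add: Ff R_cls cls_shift)
qed

lemma C0_semigroup_R: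
  assumes p: "1 \<le> p"
  shows "C0_semigroup (bandN p) (Lp_norm p) R"
  unfolding C0_semigroup_def bounded_op_def
proof (intro conjI allI ballI impI)
  fix t :: real and F H :: "'g L0" and s :: real
  show "R t (F + H) = R t F + R t H" by (simp add: R_def shift_add distrib_left)
  show "R t (s *\<^sub>R F) = s *\<^sub>R R t F" by (simp add: R_def shift_scaleR times_scaleR_L0)
  show "R 0 F = F" by (simp add: R_def shift_0 eG_inverse)
  show "R (s + t) F = R s (R t F)" if "0 \<le> s" "0 \<le> t"
    using that by (simp add: R_def eG_inverse shift_shift)
next
  show "R t F \<in> bandN p" if "0 \<le> t" "F \<in> bandN p" for t F by (rule R_contraction[OF p that])
  show "\<exists>C. \<forall>F\<in>bandN p. Lp_norm p (R t F) \<le> C * Lp_norm p F" if "0 \<le> t" for t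
    by (intro exI[of _ 1] ballI) (simp add: R_contraction(2)[OF p that])
  fix F :: "'g L0" assume F: "F \<in> bandN p"
  have N: "eG 1 * F \<in> bandN p" by (intro eG_mult p F) simp
  show "((\<lambda>t. Lp_norm p (R t F - F)) \<longlongrightarrow> 0) (at_right 0)"
  proof (rule tendsto_sandwich[OF _ _ tendsto_const])
    show "((\<lambda>t. exp c * Lp_norm p (shift t (eG 1 * F) - eG 1 * F)) \<longlongrightarrow> 0) (at_right 0)"
      using tendsto_mult[OF tendsto_const shift_strongly_continuous[OF p N], of "exp c"] by simp
    have "Lp_norm p (R t F - F) \<le> exp c * Lp_norm p (shift t (eG 1 * F) - eG 1 * F)" for t
    proof -
      have "R t F - F = eG (-1) * (shift t (eG 1 * F) - eG 1 * F)"
        by (simp add: R_def right_diff_distrib eG_inverse)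
      then show ?thesis by (simp only:) (intro eG_mult p bands_closed shift_bandN N, simp)
    qed
    then show "\<forall>\<^sub>F t in at_right 0. Lp_norm p (R t F - F) \<le> exp c * Lp_norm p (shift t (eG 1 * F) - eG 1 * F)"
      by simp
  qed (simp add: Lp_norm_nonneg')
qed

lemma K_meas: "(\<lambda>\<omega>. exp (- t * w (fst \<omega>))) \<in> borel_measurable mu"
  and V_meas: "(\<lambda>\<omega>. w (fst \<omega>)) \<in> borel_measurable mu"
  by (rule measurable_fst_mu; measurable)+

lemma V_bounded:
  assumes p: "1 \<le> p" and F: "F \<in> Lp p"
  shows "V F \<in> Lp p" "Lp_norm p (V F) \<le> c * Lp_norm p F" "F \<in> bandM p \<Longrightarrow> V F \<in> bandM p"
    "F \<in> bandN p \<Longrightarrow> V F \<in> bandN p"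
  unfolding V_def using mult_bounded_Lp[OF p V_meas _ _ F, of c] w_nonneg w_le c_pos by auto

lemma K_bounded:
  assumes p: "1 \<le> p" and t: "0 \<le> t" and F: "F \<in> bandM p"
  shows "K t F \<in> bandM p" "Lp_norm p (K t F) \<le> Lp_norm p F"
  unfolding K_def using mult_bounded_Lp[OF p K_meas[of t] _ _ bands_subset(1)[OF F], of 1] F t w_nonneg
  by auto

lemma C0_semigroup_K:
  assumes p: "1 \<le> p"
  shows "C0_semigroup (bandM p) (Lp_norm p) K"
  unfolding C0_semigroup_def bounded_op_def
proof (intro conjI allI ballI impI)
  fix t :: real and F H :: "'g L0" and s :: real
  show "K t (F + H) = K t F + K t H" by (simp add: K_def distrib_left)
  show "K t (s *\<^sub>R F) = s *\<^sub>R K t F" by (simp add: K_def times_scaleR_L0)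
  show "K 0 F = F" by (simp add: K_def mult_one)
  show "K (s + t) F = K s (K t F)"
  proof -
    have "cls (\<lambda>\<omega>::real \<times> 'g. exp (- s * w (fst \<omega>))) * cls (\<lambda>\<omega>. exp (- t * w (fst \<omega>))) =
        cls (\<lambda>\<omega>. exp (- (s + t) * w (fst \<omega>)))"
      by (subst cls_times[OF K_meas K_meas]) (simp add: algebra_simps flip: exp_add)
    then show ?thesis by (simp add: K_def mult.assoc[symmetric])
  qed
next
  show "K t F \<in> bandM p" if "0 \<le> t" "F \<in> bandM p" for t F by (rule K_bounded[OF p that])
  show "\<exists>C. \<forall>F\<in>bandM p. Lp_norm p (K t F) \<le> C * Lp_norm p F" if "0 \<le> t" for t
    by (intro exI[of _ 1] ballI) (simp add: K_bounded(2)[OF p that])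
  fix F :: "'g L0" assume F: "F \<in> bandM p"
  show "((\<lambda>t. Lp_norm p (K t F - F)) \<longlongrightarrow> 0) (at_right 0)"
  proof (rule tendsto_sandwich[OF _ _ tendsto_const])
    have "((\<lambda>t. (t * c) * Lp_norm p F) \<longlongrightarrow> (0 * c) * Lp_norm p F) (at_right 0)" by (intro tendsto_intros)
    then show "((\<lambda>t. (t * c) * Lp_norm p F) \<longlongrightarrow> 0) (at_right 0)" by simp
    show "\<forall>\<^sub>F t in at_right 0. Lp_norm p (K t F - F) \<le> (t * c) * Lp_norm p F"
      using eventually_at_right_less[of 0]
    proof eventually_elim
      case (elim t)
      have m: "(\<lambda>\<omega>::real \<times> 'g. exp (- t * w (fst \<omega>)) - 1) \<in> borel_measurable mu"
        by (rule borel_measurable_diff[OF K_meas]) simp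
      have "K t F - F = cls (\<lambda>\<omega>. exp (- t * w (fst \<omega>))) * F - cls (\<lambda>_. 1) * F" by (simp add: K_def mult_one)
      also have "\<dots> = cls (\<lambda>\<omega>. exp (- t * w (fst \<omega>)) - 1) * F"
        unfolding left_diff_distrib[symmetric] by (subst cls_diff[OF K_meas]) simp_all
      also have "Lp_norm p \<dots> \<le> (t * c) * Lp_norm p F"
      proof (rule mult_bounded_Lp(2)[OF p m _ _ bands_subset(1)[OF F]])
        show "AE \<omega> :: real \<times> 'g in mu. \<bar>exp (- t * w (fst \<omega>)) - 1\<bar> \<le> t * c"
        proof (rule AE_I2)
          fix \<omega> :: "real \<times> 'g"
          have "\<bar>exp (- (t * w (fst \<omega>))) - 1\<bar> \<le> t * w (fst \<omega>)"
            using elim w_nonneg by (intro exp_minus_bounds) simp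
          also have "\<dots> \<le> t * c" using elim w_le by simp
          finally show "\<bar>exp (- t * w (fst \<omega>)) - 1\<bar> \<le> t * c" by simp
        qed
      qed (use elim c_pos in simp)
      finally show ?case .
    qed
  qed (simp add: Lp_norm_nonneg')
qed

lemma K_derivative:
  fixes F :: "'g L0"
  assumes p: "1 \<le> p" and F: "F \<in> bandM p"
  shows "((\<lambda>h. Lp_norm p ((1 / h) *\<^sub>R (K h F - F) + V F)) \<longlongrightarrow> 0) (at_right 0)"
proof (rule tendsto_sandwich[OF _ _ tendsto_const])
  have "((\<lambda>t. (t * c\<^sup>2) * Lp_norm p F) \<longlongrightarrow> (0 * c\<^sup>2) * Lp_norm p F) (at_right 0)" by (intro tendsto_intros)
  then show "((\<lambda>t. (t * c\<^sup>2) * Lp_norm p F) \<longlongrightarrow> 0) (at_right 0)" by simp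
  show "\<forall>\<^sub>F h in at_right 0. Lp_norm p ((1 / h) *\<^sub>R (K h F - F) + V F) \<le> (h * c\<^sup>2) * Lp_norm p F"
    using eventually_at_right_less[of 0]
  proof eventually_elim
    case (elim h)
    obtain f where f: "f \<in> borel_measurable mu" and Ff: "F = cls f" by (rule L0_cases)
    let ?d = "\<lambda>\<omega> :: real \<times> 'g. (1 / h) * (exp (- h * w (fst \<omega>)) - 1) + w (fst \<omega>)"
    have m: "?d \<in> borel_measurable mu" by (rule measurable_fst_mu) measurable
    have "(1 / h) *\<^sub>R (K h F - F) + V F = cls ?d * F"
    proof -
      have km: "(\<lambda>\<omega>. exp (- h * w (fst \<omega>)) * f \<omega>) \<in> borel_measurable mu" by (rule borel_measurable_times[OF K_meas f])
      have vm: "(\<lambda>\<omega>. w (fst \<omega>) * f \<omega>) \<in> borel_measurable mu" by (rule borel_measurable_times[OF V_meas f])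
      have "K h F = cls (\<lambda>\<omega>. exp (- h * w (fst \<omega>)) * f \<omega>)" "V F = cls (\<lambda>\<omega>. w (fst \<omega>) * f \<omega>)"
        unfolding K_def V_def Ff by (rule cls_times[OF K_meas f] cls_times[OF V_meas f])+
      then have "(1 / h) *\<^sub>R (K h F - F) + V F = (1 / h) *\<^sub>R (cls (\<lambda>\<omega>. exp (- h * w (fst \<omega>)) * f \<omega>) - cls f) + cls (\<lambda>\<omega>. w (fst \<omega>) * f \<omega>)"
        by (simp add: Ff)
      also have "\<dots> = cls (\<lambda>\<omega>. (1 / h) * (exp (- h * w (fst \<omega>)) * f \<omega> - f \<omega>) + w (fst \<omega>) * f \<omega>)"
        using km vm f by (subst cls_diff, simp, simp, subst cls_scaleR, simp, subst cls_plus, simp, simp) (rule refl)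
      also have "\<dots> = cls ?d * F"
        unfolding Ff by (subst cls_times[OF m f]) (simp add: algebra_simps)
      finally show ?thesis .
    qed
    also have "Lp_norm p \<dots> \<le> (h * c\<^sup>2) * Lp_norm p F"
    proof (rule mult_bounded_Lp(2)[OF p m _ _ bands_subset(1)[OF F]])
      show "AE \<omega> in mu. \<bar>?d \<omega>\<bar> \<le> h * c\<^sup>2"
      proof (rule AE_I2)
        fix \<omega> :: "real \<times> 'g"
        have "?d \<omega> = (1 / h) * (exp (- (h * w (fst \<omega>))) - 1 + h * w (fst \<omega>))" using elim by (simp add: field_simps)
        then have "\<bar>?d \<omega>\<bar> = (1 / h) * \<bar>exp (- (h * w (fst \<omega>))) - 1 + h * w (fst \<omega>)\<bar>"
          using elim by (simp add: abs_mult)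
        also have "\<dots> \<le> (1 / h) * (h * w (fst \<omega>))\<^sup>2"
          using elim w_nonneg by (intro mult_left_mono exp_minus_bounds) auto
        also have "\<dots> = h * (w (fst \<omega>))\<^sup>2" using elim by (simp add: power2_eq_square)
        also have "\<dots> \<le> h * c\<^sup>2" using elim w_nonneg w_le by (intro mult_left_mono power_mono) auto
        finally show "\<bar>?d \<omega>\<bar> \<le> h * c\<^sup>2" .
      qed
    qed (use elim in simp)
    finally show ?case .
  qed
qed (simp add: Lp_norm_nonneg')

end

section \<open>The generator of the perturbed semigroup\<close>

context bounded_potential
begin

lemma average_difference_le:
  assumes h: "0 < h" and x: "h < x"
  shows "ennreal \<bar>w x - (G x - G (x - h)) / h\<bar> \<le>
    (\<integral>\<^sup>+s. ennreal (1 / h) * (ennreal \<bar>w x - w (x - s)\<bar> * indicator {0..<h} s) \<partial>lborel)"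
proof -
  have iw: "integrable lborel (\<lambda>s. indicator {0..<h} s * w (x - s))"
  proof (rule Bochner_Integration.integrable_bound)
    show "integrable lborel (\<lambda>s. c * indicator {0..<h} s)" using h by simp
    show "AE s in lborel. norm (indicator {0..<h} s * w (x - s)) \<le> norm (c * indicator {0..<h} s)"
      using w_nonneg w_le c_pos by (intro AE_I2) (auto split: split_indicator)
  qed measurable
  have ic: "integrable lborel (\<lambda>s. indicator {0..<h} s * w x)" using h by simp
  have "G x - G (x - h) = (LINT y|lborel. indicator {x - h<..x} y * w y)"
    using h x by (intro G_diff) auto
  also have "\<dots> = (LINT s|lborel. indicator {x - h<..x} (x + (-1) * s) * w (x + (-1) * s))"
    by (subst lborel_integral_real_affine[where c = "-1" and t = x]) simp_all
  also have "\<dots> = (LINT s|lborel. indicator {0..<h} s * w (x - s))"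
    by (intro Bochner_Integration.integral_cong) (auto split: split_indicator)
  finally have G: "G x - G (x - h) = (LINT s|lborel. indicator {0..<h} s * w (x - s))" .
  have hw: "(LINT s|lborel. indicator {0..<h} s * w x) = h * w x" using h by simp
  have eq: "h * w x - (G x - G (x - h)) = (LINT s|lborel. indicator {0..<h} s * (w x - w (x - s)))"
    by (simp only: right_diff_distrib Bochner_Integration.integral_diff[OF ic iw] G hw)
  have int: "integrable lborel (\<lambda>s. indicator {0..<h} s * (w x - w (x - s)))"
    using Bochner_Integration.integrable_diff[OF ic iw] by (simp add: right_diff_distrib)
  have "w x - (G x - G (x - h)) / h = (1 / h) * (h * w x - (G x - G (x - h)))"
    using h by (simp add: field_simps)
  then have "ennreal \<bar>w x - (G x - G (x - h)) / h\<bar> = ennreal (1 / h) * ennreal \<bar>h * w x - (G x - G (x - h))\<bar>"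
    using h by (simp add: abs_mult flip: ennreal_mult)
  also have "\<dots> \<le> ennreal (1 / h) * (\<integral>\<^sup>+s. ennreal (norm (indicator {0..<h} s * (w x - w (x - s)))) \<partial>lborel)"
    unfolding eq using integral_norm_bound_ennreal[OF int] by (intro mult_left_mono) auto
  also have "\<dots> = (\<integral>\<^sup>+s. ennreal (1 / h) * ennreal (norm (indicator {0..<h} s * (w x - w (x - s)))) \<partial>lborel)"
    by (rule nn_integral_cmult[symmetric]) measurable
  also have "\<dots> = (\<integral>\<^sup>+s. ennreal (1 / h) * (ennreal \<bar>w x - w (x - s)\<bar> * indicator {0..<h} s) \<partial>lborel)"
    by (intro nn_integral_cong) (auto split: split_indicator)
  finally show ?thesis .
qed

text \<open>This is the strong continuity of the translation semigroup for the exponent 1, read off on a single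
fibre. The index set \<open>\<Gamma>\<close> is arbitrary here, so a one-point set is used.\<close>

lemma translation_L1_continuous:
  assumes e: "0 < e"
  obtains d where "0 < d" "\<And>s. 0 \<le> s \<Longrightarrow> s < d \<Longrightarrow>
    (\<integral>\<^sup>+x. ennreal \<bar>w x - w (x - s)\<bar> * indicator {s<..<1} x \<partial>lborel) \<le> ennreal e"
proof -
  define F where "F = cls (fibre () w)"
  have FN: "F \<in> bandN 1"
    unfolding F_def
    by (rule Lp_fibre_bounded(1)[where B = "{0<..<1}" and c = c and m = 1])
      (use w_nonneg w_le c_pos in auto)
  then have "\<forall>\<^sub>F h in at_right 0. Lp_norm 1 (shift h F - F) < e"
    using e by (intro order_tendstoD[OF shift_strongly_continuous]) auto
  then obtain d where d: "0 < d" "\<And>h. 0 < h \<Longrightarrow> h < d \<Longrightarrow> Lp_norm 1 (shift h F - F) < e"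
    by (auto simp: eventually_at_right_field)
  show ?thesis
  proof (rule that[OF d(1)])
    fix s :: real assume s: "0 \<le> s" "s < d"
    define v where "v x = (if s < x then w (x - s) else 0) - w x" for x
    have vm [measurable]: "v \<in> borel_measurable borel" unfolding v_def by measurable
    have "shift s F - F = cls (fibre () v)"
    proof -
      have "shift_fun s (fibre () w) \<omega> - fibre () w \<omega> = fibre () v \<omega>" if "\<omega> \<in> Omega" for \<omega>
        using that s by (auto simp: shift_fun_def fibre_def v_def Omega_def)
      note eq = this
      have m [measurable]: "shift_fun s (fibre () w) \<in> borel_measurable mu"
        by (intro shift_fun_measurable) measurable
      have "shift s F - F = cls (\<lambda>\<omega>. shift_fun s (fibre () w) \<omega> - fibre () w \<omega>)"
        by (simp add: F_def cls_shift cls_diff)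
      also have "\<dots> = cls (fibre () v)"
      proof (subst cls_eq_iff)
        show "AE \<omega> in mu. shift_fun s (fibre () w) \<omega> - fibre () w \<omega> = fibre () v \<omega>"
          by (rule AE_I2, rule eq) simp
      qed measurable
      finally show ?thesis .
    qed
    moreover have "shift s F - F \<in> Lp 1"
      using FN s by (intro bands_subset(2) bands_closed shift_bandN) auto
    ultimately have "(\<integral>\<^sup>+x. ennreal \<bar>v x\<bar> * indicator {0<..<1} x \<partial>lborel) = ennreal (Lp_norm 1 (shift s F - F))"
      using L1_norm_fibre[OF vm, of "()"] by simp
    also have "\<dots> \<le> ennreal e"
    proof (cases "s = 0")
      case True
      then have "Lp_norm 1 (shift s F - F) = 0"
        using normed_subspace.N_zero[OF normed_subspace_Lp[of 1]] by (simp add: shift_0)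
      then show ?thesis by simp
    next
      case False
      then show ?thesis using d(2)[of s] s by (intro ennreal_leI) simp
    qed
    finally have le: "(\<integral>\<^sup>+x. ennreal \<bar>v x\<bar> * indicator {0<..<1} x \<partial>lborel) \<le> ennreal e" .
    have "(\<integral>\<^sup>+x. ennreal \<bar>w x - w (x - s)\<bar> * indicator {s<..<1} x \<partial>lborel) \<le>
        (\<integral>\<^sup>+x. ennreal \<bar>v x\<bar> * indicator {0<..<1} x \<partial>lborel)"
      using s by (intro nn_integral_mono) (auto simp: v_def abs_minus_commute split: split_indicator)
    with le show "(\<integral>\<^sup>+x. ennreal \<bar>w x - w (x - s)\<bar> * indicator {s<..<1} x \<partial>lborel) \<le> ennreal e"
      by (rule order_trans[rotated])
  qed
qed

text \<open>By Fubini's theorem, the mean deviation of the averages is at most the average, over \<open>s < h\<close>, of the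
\<open>L\<^sub>1\<close> distance between \<open>w\<close> and its translate by \<open>s\<close>.\<close>

lemma averages_converge_L1:
  assumes e: "0 < e"
  obtains d where "0 < d" "\<And>h. 0 < h \<Longrightarrow> h < d \<Longrightarrow>
    (\<integral>\<^sup>+x. ennreal \<bar>w x - (G x - G (x - h)) / h\<bar> * indicator {h<..<1} x \<partial>lborel) \<le> ennreal e"
proof -
  obtain d where d: "0 < d" "\<And>s. 0 \<le> s \<Longrightarrow> s < d \<Longrightarrow>
    (\<integral>\<^sup>+x. ennreal \<bar>w x - w (x - s)\<bar> * indicator {s<..<1} x \<partial>lborel) \<le> ennreal e"
    using translation_L1_continuous[OF e] by blast
  show ?thesis
  proof (rule that[OF d(1)])
    fix h assume h: "0 < h" "h < d"
    let ?k = "\<lambda>x s. ennreal (1 / h) * (ennreal \<bar>w x - w (x - s)\<bar> * indicator {0..<h} s) * indicator {h<..<1} x"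
    have km: "case_prod ?k \<in> borel_measurable (lborel \<Otimes>\<^sub>M lborel)" by measurable
    have "(\<integral>\<^sup>+x. ennreal \<bar>w x - (G x - G (x - h)) / h\<bar> * indicator {h<..<1} x \<partial>lborel) \<le>
        (\<integral>\<^sup>+x. (\<integral>\<^sup>+s. ?k x s \<partial>lborel) \<partial>lborel)"
    proof (intro nn_integral_mono)
      fix x :: real
      show "ennreal \<bar>w x - (G x - G (x - h)) / h\<bar> * indicator {h<..<1} x \<le> (\<integral>\<^sup>+s. ?k x s \<partial>lborel)"
        using average_difference_le[OF h(1), of x] by (cases "x \<in> {h<..<1}") auto
    qed
    also have "\<dots> = (\<integral>\<^sup>+s. (\<integral>\<^sup>+x. ?k x s \<partial>lborel) \<partial>lborel)"
      by (rule lborel_pair.Fubini'[OF km, symmetric])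
    also have "\<dots> \<le> (\<integral>\<^sup>+s. ennreal (1 / h) * ennreal e * indicator {0..<h} s \<partial>lborel)"
    proof (intro nn_integral_mono)
      fix s :: real
      show "(\<integral>\<^sup>+x. ?k x s \<partial>lborel) \<le> ennreal (1 / h) * ennreal e * indicator {0..<h} s"
      proof (cases "s \<in> {0..<h}")
        case True
        have "(\<integral>\<^sup>+x. ?k x s \<partial>lborel) \<le> (\<integral>\<^sup>+x. ennreal (1 / h) * (ennreal \<bar>w x - w (x - s)\<bar> * indicator {s<..<1} x) \<partial>lborel)"
          using True by (intro nn_integral_mono) (auto split: split_indicator)
        also have "\<dots> = ennreal (1 / h) * (\<integral>\<^sup>+x. ennreal \<bar>w x - w (x - s)\<bar> * indicator {s<..<1} x \<partial>lborel)"
          by (rule nn_integral_cmult) measurable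
        also have "\<dots> \<le> ennreal (1 / h) * ennreal e" using d(2)[of s] True h by (intro mult_left_mono) auto
        finally show ?thesis using True by simp
      qed simp
    qed
    also have "\<dots> = ennreal (1 / h) * ennreal e * ennreal h"
      using h by (simp add: nn_integral_cmult_indicator)
    also have "\<dots> = ennreal e" using h e by (simp flip: ennreal_mult)
    finally show "(\<integral>\<^sup>+x. ennreal \<bar>w x - (G x - G (x - h)) / h\<bar> * indicator {h<..<1} x \<partial>lborel) \<le> ennreal e" .
  qed
qed

text \<open>Convergence in mean suffices because the deviations are bounded by \<open>c\<close>, so that their \<open>p\<close>-th powers are
at most \<open>c powr (p - 1)\<close> times the deviations.\<close>

lemma averages_converge_Lp:
  assumes p: "1 \<le> p" and a: "0 \<le> a"
  shows "((\<lambda>h. Lp_norm p (cls (fibre \<gamma> (\<lambda>x. indicator {a + h<..} x * (w x - (G x - G (x - h)) / h))))) \<longlongrightarrow> 0) (at_right 0)"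
proof (rule tendstoI)
  fix e :: real assume e: "0 < e"
  \<comment> \<open>Chosen such that \<open>c powr (p - 1) * e' = (e / 2) powr p\<close>.\<close>
  define e' where "e' = (e / 2) powr p / c powr (p - 1)"
  have e': "0 < e'" using e c_pos by (simp add: e'_def)
  obtain d where d: "0 < d" "\<And>h. 0 < h \<Longrightarrow> h < d \<Longrightarrow>
    (\<integral>\<^sup>+x. ennreal \<bar>w x - (G x - G (x - h)) / h\<bar> * indicator {h<..<1} x \<partial>lborel) \<le> ennreal e'"
    using averages_converge_L1[OF e'] by blast
  have "Lp_norm p (cls (fibre \<gamma> (\<lambda>x. indicator {a + h<..} x * (w x - (G x - G (x - h)) / h)))) \<le> e / 2"
    if h: "0 < h" "h < d" for h
  proof (rule Lp_norm_fibre_le[OF p])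
    define u where "u x = w x - (G x - G (x - h)) / h" for x
    have um [measurable]: "u \<in> borel_measurable borel" unfolding u_def by measurable
    show "(\<lambda>x. indicator {a + h<..} x * (w x - (G x - G (x - h)) / h)) \<in> borel_measurable borel" by measurable
    have u: "\<bar>u x\<bar> \<le> c" if "h < x" for x
    proof -
      have "0 \<le> G x - G (x - h)" "G x - G (x - h) \<le> c * h" using G_diff_bounds[of "x - h" x] that h by auto
      then have "0 \<le> (G x - G (x - h)) / h" "(G x - G (x - h)) / h \<le> c" using h by (simp_all add: divide_le_eq)
      then show ?thesis using w_nonneg[of x] w_le[of x] unfolding u_def by linarith
    qed
    have "(\<integral>\<^sup>+x. ennreal (\<bar>indicator {a + h<..} x * u x\<bar> powr p) * indicator {0<..<1} x \<partial>lborel) \<le>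
        (\<integral>\<^sup>+x. ennreal (c powr (p - 1)) * (ennreal \<bar>u x\<bar> * indicator {h<..<1} x) \<partial>lborel)"
    proof (intro nn_integral_mono)
      fix x :: real
      show "ennreal (\<bar>indicator {a + h<..} x * u x\<bar> powr p) * indicator {0<..<1} x \<le>
          ennreal (c powr (p - 1)) * (ennreal \<bar>u x\<bar> * indicator {h<..<1} x)"
      proof (cases "a + h < x \<and> x < 1")
        case True
        then have x: "x \<in> {h<..<1}" "x \<in> {0<..<1}" using a h by auto
        have "\<bar>u x\<bar> powr p = \<bar>u x\<bar> powr (p - 1) * \<bar>u x\<bar>"
          by (cases "u x = 0") (simp_all add: powr_diff)
        also have "\<dots> \<le> c powr (p - 1) * \<bar>u x\<bar>"
          using u[of x] x p by (intro mult_right_mono powr_mono2) auto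
        finally have "ennreal (\<bar>u x\<bar> powr p) \<le> ennreal (c powr (p - 1)) * ennreal \<bar>u x\<bar>"
          by (simp add: ennreal_leI flip: ennreal_mult)
        then show ?thesis using x True by simp
      next
        case False
        then consider "x \<le> a + h" | "1 \<le> x" by linarith
        then show ?thesis by cases simp_all
      qed
    qed
    also have "\<dots> = ennreal (c powr (p - 1)) * (\<integral>\<^sup>+x. ennreal \<bar>u x\<bar> * indicator {h<..<1} x \<partial>lborel)"
      by (rule nn_integral_cmult) measurable
    also have "\<dots> \<le> ennreal (c powr (p - 1)) * ennreal e'"
      using d(2)[OF h] by (intro mult_left_mono) (auto simp: u_def)
    also have "\<dots> = ennreal ((e / 2) powr p)"
      using e' c_pos by (simp add: e'_def flip: ennreal_mult)
    finally show "(\<integral>\<^sup>+x. ennreal (\<bar>indicator {a + h<..} x * (w x - (G x - G (x - h)) / h)\<bar> powr p) * indicator {0<..<1} x \<partial>lborel)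
        \<le> ennreal ((e / 2) powr p)" by (simp add: u_def)
  qed (use e in simp)
  then have "\<forall>\<^sub>F h in at_right 0. Lp_norm p (cls (fibre \<gamma> (\<lambda>x. indicator {a + h<..} x * (w x - (G x - G (x - h)) / h)))) \<le> e / 2"
    using d(1) by (auto simp: eventually_at_right_field)
  then show "\<forall>\<^sub>F h in at_right 0. dist (Lp_norm p (cls (fibre \<gamma> (\<lambda>x. indicator {a + h<..} x * (w x - (G x - G (x - h)) / h))))) 0 < e"
    by eventually_elim (use e in \<open>simp add: dist_real_def abs_of_nonneg[OF Lp_norm_nonneg']\<close>)
qed

lemma R_difference_bounded:
  assumes p: "1 \<le> p" and h: "0 < h" and F: "F \<in> bandN p"
  shows "Lp_norm p ((1 / h) *\<^sub>R (R h F - shift h F)) \<le> c * Lp_norm p F"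
proof -
  interpret normed_subspace "Lp p" "Lp_norm p" by (rule normed_subspace_Lp[OF p])
  obtain f where f: "f \<in> borel_measurable mu" and Ff: "F = cls f" by (rule L0_cases)
  have FL: "F \<in> Lp p" by (rule bands_subset(2)[OF F])
  note m = R_fun_meas[OF f, of h] shift_fun_measurable[OF f, of h]
  have "AE \<omega> in mu. \<bar>R_fun h f \<omega> - shift_fun h f \<omega>\<bar> \<le> (c * h) * \<bar>shift_fun h f \<omega>\<bar>"
  proof (rule AE_I2)
    fix \<omega> :: "real \<times> 'a"
    show "\<bar>R_fun h f \<omega> - shift_fun h f \<omega>\<bar> \<le> (c * h) * \<bar>shift_fun h f \<omega>\<bar>"
    proof (cases "fst \<omega> - h \<in> {0<..<1}")
      case True
      then have b: "0 \<le> G (fst \<omega>) - G (fst \<omega> - h)" "G (fst \<omega>) - G (fst \<omega> - h) \<le> c * h"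
        using G_diff_bounds[of "fst \<omega> - h" "fst \<omega>"] h by auto
      have "\<bar>exp (- (G (fst \<omega>) - G (fst \<omega> - h))) - 1\<bar> \<le> c * h"
        using exp_minus_bounds(2)[OF b(1)] b(2) by linarith
      moreover have "R_fun h f \<omega> - shift_fun h f \<omega> = (exp (- (G (fst \<omega>) - G (fst \<omega> - h))) - 1) * shift_fun h f \<omega>"
        by (simp add: R_fun_def algebra_simps)
      ultimately show ?thesis by (simp only: abs_mult) (intro mult_right_mono, auto)
    next
      case False
      then have "shift_fun h f \<omega> = 0" by (cases \<omega>) (auto simp: shift_fun_def)
      then show ?thesis by (simp add: R_fun_def)
    qed
  qed
  then have "Lp_norm p (cls (\<lambda>\<omega>. R_fun h f \<omega> - shift_fun h f \<omega>)) \<le> (c * h) * Lp_norm p (cls (shift_fun h f))"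
    using Lp_norm_shift_le(1)[OF p FL, of h] f h c_pos m
    by (intro Lp_bounded_by(2) p) (simp_all add: Ff cls_shift)
  also have "cls (\<lambda>\<omega>. R_fun h f \<omega> - shift_fun h f \<omega>) = R h F - shift h F"
    using f m by (simp add: Ff R_cls cls_shift cls_diff)
  also have "cls (shift_fun h f) = shift h F" using f by (simp add: Ff cls_shift)
  also have "(c * h) * Lp_norm p (shift h F) \<le> (c * h) * Lp_norm p F"
    using h c_pos by (intro mult_left_mono Lp_norm_shift_le p FL) auto
  finally have le: "Lp_norm p (R h F - shift h F) \<le> c * h * Lp_norm p F" .
  have "R h F - shift h F \<in> Lp p"
    using h by (intro bands_subset(2) bands_closed p R_contraction shift_bandN F) auto
  then have "Lp_norm p ((1 / h) *\<^sub>R (R h F - shift h F)) = (1 / h) * Lp_norm p (R h F - shift h F)"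
    using h by (simp add: N_scaleR)
  also have "\<dots> \<le> (1 / h) * (c * h * Lp_norm p F)" using h le by (intro mult_left_mono) auto
  finally show ?thesis using h by simp
qed

text \<open>For the indicator of \<open>(a, 1)\<close> on a fibre, there remain three terms: \<open>b1\<close> lives on the short interval
\<open>(a, a + h]\<close> which the translation has just left, \<open>b2\<close> is the second-order error of the exponential
function, and \<open>b3\<close> compares \<open>w\<close> with its averages.\<close>

lemma R_derivative:
  fixes F :: "'g L0"
  assumes p: "1 \<le> p" and F: "F \<in> bandN p"
  shows "((\<lambda>h. Lp_norm p ((1 / h) *\<^sub>R (R h F - shift h F) + V F)) \<longlongrightarrow> 0) (at_right 0)"
proof -
  interpret normed_subspace "Lp p :: 'g L0 set" "Lp_norm p" by (rule normed_subspace_Lp[OF p])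
  let ?B = "\<lambda>h F :: 'g L0. (1 / h) *\<^sub>R (R h F - shift h F) + V F"
  show ?thesis
  proof (rule bandN_family_tendsto_0[OF p F, where B = ?B and C = "2 * c"])
    fix h :: real and F H :: "'g L0" and s :: real
    show "?B h (F + H) = ?B h F + ?B h H"
      by (simp add: R_def V_def shift_add distrib_left scaleR_add_right scaleR_diff_right)
    show "?B h (s *\<^sub>R F) = s *\<^sub>R ?B h F"
      by (simp add: R_def V_def shift_scaleR times_scaleR_L0 scaleR_add_right scaleR_diff_right)
    assume h: "0 < h" and F: "F \<in> bandN p"
    have X: "(1 / h) *\<^sub>R (R h F - shift h F) \<in> Lp p" "V F \<in> Lp p"
      using h F by (auto intro!: bands_subset(2) bands_closed p R_contraction shift_bandN V_bounded(4))
    then show "?B h F \<in> Lp p" by (rule X_add)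
    show "Lp_norm p (?B h F) \<le> 2 * c * Lp_norm p F"
      using N_triangle[OF X] R_difference_bounded[OF p h F] V_bounded(2)[OF p bands_subset(2)[OF F]]
      by linarith
  next
    fix a :: real and \<gamma> :: 'g assume base: "0 \<le> a" "a < 1"
    let ?e = "cls (fibre \<gamma> (indicator {a<..}))"
    define \<delta> where "\<delta> h x = G x - G (x - h)" for h x
    have \<delta>m [measurable]: "\<delta> h \<in> borel_measurable borel" for h unfolding \<delta>_def by measurable
    define b1 where "b1 h x = w x * indicator {a<..a + h} x" for h x
    define b2 where "b2 h x = indicator {a + h<..} x * ((1 / h) * (exp (- \<delta> h x) - 1 + \<delta> h x))" for h x
    define b3 where "b3 h x = indicator {a + h<..} x * (w x - \<delta> h x / h)" for h x
    have m [measurable]: "b1 h \<in> borel_measurable borel" "b2 h \<in> borel_measurable borel" "b3 h \<in> borel_measurable borel" for h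
      unfolding b1_def b2_def b3_def by measurable
    have \<delta>: "0 \<le> \<delta> h x" "\<delta> h x \<le> c * h" if "a + h < x" "0 < h" for h x
      using G_diff_bounds[of "x - h" x] that base(1) unfolding \<delta>_def by auto
    have N1: "cls (fibre \<gamma> (b1 h)) \<in> bandN p" "Lp_norm p (cls (fibre \<gamma> (b1 h))) \<le> c * (1 * h) powr (1 / p)" if h: "0 < h" for h
    proof -
      note b = Lp_fibre_bounded[OF p m(1)[of h], where B = "{a<..a + h}" and c = c and m = h and \<gamma> = \<gamma>]
      have "\<bar>b1 h x\<bar> \<le> c * indicator {a<..a + h} x" for x
        using w_nonneg[of x] w_le[of x] by (simp add: b1_def split: split_indicator)
      then show "cls (fibre \<gamma> (b1 h)) \<in> bandN p" "Lp_norm p (cls (fibre \<gamma> (b1 h))) \<le> c * (1 * h) powr (1 / p)"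
        using b h c_pos by auto
    qed
    have N2: "cls (fibre \<gamma> (b2 h)) \<in> bandN p" "Lp_norm p (cls (fibre \<gamma> (b2 h))) \<le> h * c\<^sup>2" if h: "0 < h" for h
    proof -
      note b = Lp_fibre_bounded[OF p m(2)[of h], where B = "{0<..<1}" and c = "h * c\<^sup>2" and m = 1 and \<gamma> = \<gamma>]
      have "\<bar>b2 h x\<bar> \<le> h * c\<^sup>2 * indicator {0<..<1} x" if "x \<in> {0<..<1}" for x
      proof (cases "a + h < x")
        case True
        have "\<bar>b2 h x\<bar> = (1 / h) * \<bar>exp (- \<delta> h x) - 1 + \<delta> h x\<bar>"
          using True h by (simp add: b2_def abs_mult)
        also have "\<dots> \<le> (1 / h) * (\<delta> h x)\<^sup>2"
          using h \<delta>[OF True h] by (intro mult_left_mono exp_minus_bounds) auto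
        also have "\<dots> \<le> (1 / h) * (c * h)\<^sup>2"
          using h \<delta>[OF True h] by (intro mult_left_mono power_mono) auto
        also have "\<dots> = h * c\<^sup>2" using h by (simp add: power2_eq_square)
        finally show ?thesis using that by simp
      next
        case False
        then show ?thesis using h by (simp add: b2_def)
      qed
      then show "cls (fibre \<gamma> (b2 h)) \<in> bandN p" "Lp_norm p (cls (fibre \<gamma> (b2 h))) \<le> h * c\<^sup>2"
        using b h by auto
    qed
    have N3: "cls (fibre \<gamma> (b3 h)) \<in> bandN p" if h: "0 < h" for h
    proof (rule Lp_fibre_bounded(1)[OF p m(3)[of h], where B = "{0<..<1}" and c = c and m = 1])
      fix x :: real assume x: "x \<in> {0<..<1}"
      show "\<bar>b3 h x\<bar> \<le> c * indicator {0<..<1} x"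
      proof (cases "a + h < x")
        case True
        then have "0 \<le> \<delta> h x / h" "\<delta> h x / h \<le> c" using \<delta>[OF True h] h by (simp_all add: divide_le_eq)
        then have "\<bar>w x - \<delta> h x / h\<bar> \<le> c" using w_nonneg[of x] w_le[of x] by linarith
        then show ?thesis using True x by (simp add: b3_def)
      next
        case False
        then show ?thesis using c_pos by (simp add: b3_def)
      qed
    qed (use c_pos in auto)
    have eq: "(1 / h) *\<^sub>R (R h ?e - shift h ?e) + V ?e = cls (fibre \<gamma> (b1 h)) + cls (fibre \<gamma> (b2 h)) + cls (fibre \<gamma> (b3 h))"
      if h: "0 < h" for h
    proof -
      let ?f = "fibre \<gamma> (indicator {a<..})"
      have fm: "?f \<in> borel_measurable mu" by measurable
      have vm: "(\<lambda>\<omega>. w (fst \<omega>) * ?f \<omega>) \<in> borel_measurable mu" by (rule borel_measurable_times[OF V_meas fm])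
      note rm = R_fun_meas[OF fm, of h] shift_fun_measurable[OF fm, of h]
      have "(1 / h) *\<^sub>R (R h ?e - shift h ?e) + V ?e =
          (1 / h) *\<^sub>R (cls (R_fun h ?f) - cls (shift_fun h ?f)) + cls (\<lambda>\<omega>. w (fst \<omega>) * ?f \<omega>)"
        by (simp only: R_cls[OF fm] cls_shift[OF fm] V_def cls_times[OF V_meas fm])
      also have "\<dots> = cls (\<lambda>\<omega>. (1 / h) * (R_fun h ?f \<omega> - shift_fun h ?f \<omega>) + w (fst \<omega>) * ?f \<omega>)"
        using rm vm by (simp add: cls_diff cls_scaleR cls_plus)
      also have "\<dots> = cls (\<lambda>\<omega>. fibre \<gamma> (b1 h) \<omega> + fibre \<gamma> (b2 h) \<omega> + fibre \<gamma> (b3 h) \<omega>)"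
      proof (subst cls_eq_iff)
        show "AE \<omega> in mu. (1 / h) * (R_fun h ?f \<omega> - shift_fun h ?f \<omega>) + w (fst \<omega>) * ?f \<omega> =
            fibre \<gamma> (b1 h) \<omega> + fibre \<gamma> (b2 h) \<omega> + fibre \<gamma> (b3 h) \<omega>"
        proof (rule AE_I2)
          fix \<omega> :: "real \<times> 'g" assume "\<omega> \<in> space mu"
          then obtain x \<gamma>' where \<omega>: "\<omega> = (x, \<gamma>')" "0 < x" "x < 1" by (auto simp: Omega_def)
          show "(1 / h) * (R_fun h ?f \<omega> - shift_fun h ?f \<omega>) + w (fst \<omega>) * ?f \<omega> =
            fibre \<gamma> (b1 h) \<omega> + fibre \<gamma> (b2 h) \<omega> + fibre \<gamma> (b3 h) \<omega>"
          proof (cases "\<gamma>' = \<gamma>")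
            case True
            consider "x \<le> a" | "a < x" "x \<le> a + h" | "a + h < x" by linarith
            then show ?thesis
              by cases (use True \<omega> h base(1) in \<open>simp_all add: fibre_apply R_fun_def shift_fun_def b1_def b2_def b3_def \<delta>_def field_simps\<close>)
          next
            case False
            then show ?thesis using \<omega> by (simp add: fibre_apply R_fun_def shift_fun_def)
          qed
        qed
      qed (use rm vm in simp_all)
      also have "\<dots> = cls (fibre \<gamma> (b1 h)) + cls (fibre \<gamma> (b2 h)) + cls (fibre \<gamma> (b3 h))"
        by (simp add: cls_plus)
      finally show ?thesis .
    qed
    have X: "cls (fibre \<gamma> (b1 h)) \<in> Lp p" "cls (fibre \<gamma> (b2 h)) \<in> Lp p" "cls (fibre \<gamma> (b3 h)) \<in> Lp p" if "0 < h" for h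
      using N1[OF that] N2[OF that] N3[OF that] by (auto intro: bands_subset)
    have "((\<lambda>h. Lp_norm p (cls (fibre \<gamma> (b1 h)) + cls (fibre \<gamma> (b2 h)) + cls (fibre \<gamma> (b3 h)))) \<longlongrightarrow> 0) (at_right 0)"
    proof (intro N_tendsto_0_add)
      show "((\<lambda>h. Lp_norm p (cls (fibre \<gamma> (b1 h)))) \<longlongrightarrow> 0) (at_right 0)"
      proof (rule tendsto_sandwich[OF _ _ tendsto_const tendsto_powr_at_right_0[OF p, of 1 c]])
        show "\<forall>\<^sub>F h in at_right 0. Lp_norm p (cls (fibre \<gamma> (b1 h))) \<le> c * (1 * h) powr (1 / p)"
          using eventually_at_right_less[of 0] by eventually_elim (rule N1)
      qed (simp_all add: Lp_norm_nonneg')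
      have "((\<lambda>h. h * c\<^sup>2) \<longlongrightarrow> 0 * c\<^sup>2) (at_right 0)" by (intro tendsto_intros)
      then have z: "((\<lambda>h. h * c\<^sup>2) \<longlongrightarrow> 0) (at_right 0)" by simp
      show "((\<lambda>h. Lp_norm p (cls (fibre \<gamma> (b2 h)))) \<longlongrightarrow> 0) (at_right 0)"
      proof (rule tendsto_sandwich[OF _ _ tendsto_const z])
        show "\<forall>\<^sub>F h in at_right 0. Lp_norm p (cls (fibre \<gamma> (b2 h))) \<le> h * c\<^sup>2"
          using eventually_at_right_less[of 0] by eventually_elim (rule N2)
      qed (simp_all add: Lp_norm_nonneg')
      show "((\<lambda>h. Lp_norm p (cls (fibre \<gamma> (b3 h)))) \<longlongrightarrow> 0) (at_right 0)"
        using averages_converge_Lp[OF p base(1), of \<gamma>] unfolding b3_def[abs_def] \<delta>_def .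
      show "\<forall>\<^sub>F h in at_right 0. cls (fibre \<gamma> (b1 h)) \<in> Lp p \<and> cls (fibre \<gamma> (b2 h)) \<in> Lp p"
        using eventually_at_right_less[of 0] by eventually_elim (intro conjI X)
      show "\<forall>\<^sub>F h in at_right 0. cls (fibre \<gamma> (b1 h)) + cls (fibre \<gamma> (b2 h)) \<in> Lp p \<and> cls (fibre \<gamma> (b3 h)) \<in> Lp p"
        using eventually_at_right_less[of 0] by eventually_elim (intro conjI X_add X)
    qed
    then show "((\<lambda>h. Lp_norm p (?B h ?e)) \<longlongrightarrow> 0) (at_right 0)"
      by (rule Lim_transform_eventually)
        (use eventually_at_right_less[of 0] in \<open>eventually_elim; simp add: eq\<close>)
  qed
qed

definition S :: "real \<Rightarrow> real \<Rightarrow> 'g L0 \<Rightarrow> 'g L0" where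
  "S p t F = K t (projM p F) + R t (F - projM p F)"

lemma C0_semigroup_S: "1 \<le> p \<Longrightarrow> C0_semigroup (Lp p) (Lp_norm p) (S p)"
  unfolding S_def[abs_def] by (intro C0_semigroup_direct_sum C0_semigroup_K C0_semigroup_R)

theorem generator_S:
  assumes p: "1 \<le> p"
  shows "generator (Lp p) (Lp_norm p) (S p :: real \<Rightarrow> 'g L0 \<Rightarrow> 'g L0) =
    {(F, H - V F) | F H. (F, H) \<in> generator (Lp p) (Lp_norm p) (T_sg p)}"
proof -
  interpret normed_subspace "Lp p :: 'g L0 set" "Lp_norm p" by (rule normed_subspace_Lp[OF p])
  show ?thesis
  proof (rule generator_of_perturbation[OF C0_semigroup_S[OF p] C0_semigroup_T[OF p]])
    show "V F \<in> Lp p" if "F \<in> Lp p" for F :: "'g L0" by (rule V_bounded[OF p that])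
    fix F :: "'g L0" assume F: "F \<in> Lp p"
    have clM: "(1 / h) *\<^sub>R (K h A - A) + V A \<in> Lp p" if "0 < h" "A \<in> bandM p" for h and A :: "'g L0"
      using that by (intro bands_subset(1) bands_closed p K_bounded V_bounded(3)) auto
    have clN: "(1 / h) *\<^sub>R (R h B - shift h B) + V B \<in> Lp p" if "0 < h" "B \<in> bandN p" for h and B :: "'g L0"
      using that by (intro bands_subset(2) bands_closed p R_contraction shift_bandN V_bounded(4)) auto
    let ?A = "projM p F" and ?B = "F - projM p F"
    have AB: "?A \<in> bandM p" "?B \<in> bandN p" by (rule projM[OF p F])+
    have "((\<lambda>h. Lp_norm p (((1 / h) *\<^sub>R (K h ?A - ?A) + V ?A) + ((1 / h) *\<^sub>R (R h ?B - shift h ?B) + V ?B))) \<longlongrightarrow> 0) (at_right 0)"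
    proof (rule N_tendsto_0_add[OF K_derivative[OF p AB(1)] R_derivative[OF p AB(2)]])
      show "\<forall>\<^sub>F h in at_right 0. (1 / h) *\<^sub>R (K h ?A - ?A) + V ?A \<in> Lp p \<and> (1 / h) *\<^sub>R (R h ?B - shift h ?B) + V ?B \<in> Lp p"
        using eventually_at_right_less[of 0] by eventually_elim (intro conjI clM clN AB)
    qed
    moreover have "((1 / h) *\<^sub>R (K h ?A - ?A) + V ?A) + ((1 / h) *\<^sub>R (R h ?B - shift h ?B) + V ?B) =
        (1 / h) *\<^sub>R (S p h F - T_sg p h F) + V F" for h
    proof -
      have "V F = V ?A + V ?B" by (simp add: V_def flip: distrib_left)
      then show ?thesis by (simp add: S_def T_sg_def algebra_simps)
    qed
    ultimately show "((\<lambda>h. Lp_norm p ((1 / h) *\<^sub>R (S p h F - T_sg p h F) + V F)) \<longlongrightarrow> 0) (at_right 0)"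
      by simp
  qed
qed

text \<open>The semigroup picked by its generator \<open>A - w\<close> is \<open>S\<close>: such semigroups exist, as \<open>S\<close> shows, and they
agree because the domain of \<open>A - w\<close> is that of \<open>A\<close>, which is dense.\<close>

theorem semigroup_generated_by_S:
  assumes p: "1 \<le> p" and t: "0 \<le> t" and F: "F \<in> Lp p"
  shows "semigroup_generated_by (Lp p) (Lp_norm p)
    {(F, H - V F) | F H. (F, H) \<in> generator (Lp p) (Lp_norm p) (T_sg p)} t F = S p t F"
proof -
  interpret banach_subspace "Lp p :: 'a L0 set" "Lp_norm p" by (rule banach_subspace_Lp[OF p])
  let ?A = "{(F, H - V F) | F H. (F, H) \<in> generator (Lp p) (Lp_norm p) (T_sg p)} :: ('a L0 \<times> 'a L0) set"
  let ?S = "semigroup_generated_by (Lp p) (Lp_norm p) ?A"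
  have "C0_semigroup (Lp p) (Lp_norm p) ?S \<and> generator (Lp p) (Lp_norm p) ?S = ?A"
    unfolding semigroup_generated_by_def
    by (rule someI[where x = "S p"]) (use C0_semigroup_S[OF p] generator_S[OF p] in blast)
  moreover have "\<exists>G\<in>Domain ?A. Lp_norm p (F - G) < e" if F: "F \<in> Lp p" and "0 < e" for F :: "'a L0" and e
  proof -
    have "Domain ?A = Domain (generator (Lp p) (Lp_norm p) (T_sg p))" by auto
    then show ?thesis using generator_T_dense[OF p that] by simp
  qed
  ultimately show ?thesis
    using C0_semigroup_S[OF p] generator_S[OF p] t F
    by (intro C0_semigroup_unique) auto
qed

end

section \<open>The absorption semigroup\<close>

lemma Lp_mult_tendsto:
  fixes F :: "'g L0"
  assumes p: "1 \<le> p" and F: "F \<in> Lp p"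
    and h: "\<And>i. h i \<in> borel_measurable mu" "h0 \<in> borel_measurable mu"
    and le: "\<And>i \<omega>. \<omega> \<in> Omega \<Longrightarrow> \<bar>h i \<omega>\<bar> \<le> 1"
    and lim: "\<And>\<omega>. \<omega> \<in> Omega \<Longrightarrow> (\<lambda>i. h i \<omega>) \<longlonglongrightarrow> h0 \<omega>"
  shows "(\<lambda>i. Lp_norm p (cls (h i) * F - cls h0 * F)) \<longlonglongrightarrow> 0"
proof -
  obtain f where f: "f \<in> borel_measurable mu" and Ff: "F = cls f" by (rule L0_cases)
  have "(\<lambda>i. Lp_norm p (cls (\<lambda>\<omega>. h i \<omega> * f \<omega>) - cls (\<lambda>\<omega>. h0 \<omega> * f \<omega>))) \<longlonglongrightarrow> 0"
  proof (rule Lp_dominated_convergence[OF p, where w = "\<lambda>\<omega>. \<bar>f \<omega>\<bar>"])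
    show "(\<lambda>\<omega>. h i \<omega> * f \<omega>) \<in> borel_measurable mu" for i using h f by measurable
    show "(\<lambda>\<omega>. h0 \<omega> * f \<omega>) \<in> borel_measurable mu" using h f by measurable
    show "(\<lambda>\<omega>. \<bar>f \<omega>\<bar>) \<in> borel_measurable mu" using f by measurable
    show "cls (\<lambda>\<omega>. \<bar>f \<omega>\<bar>) \<in> Lp p" using F f by (simp add: Ff cls_in_Lp)
    show "AE \<omega> in mu. \<bar>h i \<omega> * f \<omega>\<bar> \<le> \<bar>f \<omega>\<bar>" for i
      using le by (intro AE_I2) (simp add: abs_mult mult_left_le_one_le)
    show "AE \<omega> in mu. (\<lambda>i. h i \<omega> * f \<omega>) \<longlonglongrightarrow> h0 \<omega> * f \<omega>"
      by (rule AE_I2) (intro tendsto_intros lim, simp)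
  qed
  then show ?thesis using h f by (simp add: Ff cls_times)
qed

locale absorption =
  fixes p :: real and W :: "real \<Rightarrow> real" and V :: "real \<times> 'g \<Rightarrow> real"
  assumes p: "1 \<le> p"
    and W_meas: "W \<in> borel_measurable (restrict_space borel {0<..<1})"
    and W_nonneg: "\<And>x. x \<in> {0<..<1} \<Longrightarrow> 0 \<le> W x"
    and W_not_L1: "\<And>U. open U \<Longrightarrow> U \<noteq> {} \<Longrightarrow> U \<subseteq> {0<..<1} \<Longrightarrow> \<not> set_integrable lborel U W"
    and V: "\<And>x \<gamma>. x \<in> {0<..<1} \<Longrightarrow> V (x, \<gamma>) = W x"
begin

definition W0 :: "real \<Rightarrow> real" where
  "W0 x = (if x \<in> {0<..<1} then W x else 0)"

definition w :: "nat \<Rightarrow> real \<Rightarrow> real" where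
  "w n x = min (W0 x) (real n)"

lemma W0_meas [measurable]: "W0 \<in> borel_measurable borel"
proof -
  have "(\<lambda>x. indicator {0<..<1} x *\<^sub>R W x) \<in> borel_measurable borel"
    using W_meas by (subst (asm) borel_measurable_restrict_space_iff) simp_all
  moreover have "W0 = (\<lambda>x. indicator {0<..<1} x *\<^sub>R W x)" by (auto simp: W0_def)
  ultimately show ?thesis by simp
qed

lemma W0_nonneg: "0 \<le> W0 x"
  using W_nonneg by (simp add: W0_def)

lemma w_meas [measurable]: "w n \<in> borel_measurable borel"
  unfolding w_def by measurable

text \<open>The bound \<open>n + 1\<close>, instead of \<open>n\<close>, is positive also for \<open>n = 0\<close>.\<close>

lemma bounded_potential_w: "bounded_potential (w n) (real n + 1)"
  by standard (auto simp: w_def W0_nonneg min_def)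

lemma V_eq: "\<omega> \<in> Omega \<Longrightarrow> V \<omega> = W0 (fst \<omega>)"
  using V by (cases \<omega>) (auto simp: Omega_def W0_def)

lemma V_meas: "V \<in> borel_measurable mu"
proof -
  have "(\<lambda>x. if x \<in> {0<..<1} then W0 x else 0) \<in> borel_measurable borel" by measurable
  then have "(\<lambda>\<omega>. W0 (fst \<omega>)) \<in> borel_measurable (mu :: (real \<times> 'g) measure)"
    using measurable_mu_fst[of W0] by (simp add: case_prod_beta')
  then show ?thesis by (subst measurable_cong[where g = "\<lambda>\<omega>. W0 (fst \<omega>)"]) (auto simp: V_eq)
qed

lemma mult_op_truncated: "mult_op (\<lambda>\<omega>. min (V \<omega>) (real n)) F = bounded_potential.V (w n) F"
proof -
  have "(\<lambda>\<omega>. min (V \<omega>) (real n)) \<in> borel_measurable mu" using V_meas by measurable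
  then have "cls (\<lambda>\<omega>. min (V \<omega>) (real n)) = cls (\<lambda>\<omega>. w n (fst \<omega>))"
    using bounded_potential.V_meas[OF bounded_potential_w, of n]
    by (subst cls_eq_iff) (auto intro!: AE_I2 simp: w_def V_eq)
  then show ?thesis
    by (simp add: mult_op_def bounded_potential.V_def[OF bounded_potential_w])
qed

lemma perturbed_semigroup_eq:
  assumes "0 \<le> t" "F \<in> Lp p"
  shows "perturbed_semigroup p (T_sg p) V n t F = bounded_potential.S (w n) p t F"
  unfolding perturbed_semigroup_def mult_op_truncated
  by (rule bounded_potential.semigroup_generated_by_S[OF bounded_potential_w p assms])

text \<open>By monotone convergence, the limit is the integral of \<open>W\<close> over \<open>(a, b]\<close>, and \<open>W\<close> is not integrable over
any interval.\<close>

lemma integral_w_diverges: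
  assumes ab: "0 \<le> a" "a < b" "b < 1"
  shows "filterlim (\<lambda>n. LINT y|lborel. indicator {a<..b} y * w n y) at_top sequentially"
proof -
  define I where "I n = (LINT y|lborel. indicator {a<..b} y * w n y)" for n
  have int: "integrable lborel (\<lambda>y. indicator {a<..b} y * w n y)" for n
    by (rule bounded_potential.integrable_interval[OF bounded_potential_w])
  have mono: "I m \<le> I n" if "m \<le> n" for m n
    unfolding I_def using that W0_nonneg
    by (intro integral_mono int) (auto simp: w_def split: split_indicator)
  have nn: "(\<integral>\<^sup>+y. ennreal (indicator {a<..b} y * w n y) \<partial>lborel) = ennreal (I n)" for n
    unfolding I_def by (rule nn_integral_eq_integral[OF int]) (auto simp: w_def W0_nonneg)
  have SUP: "(SUP n. ennreal (indicator {a<..b} y * w n y)) = ennreal (indicator {a<..b} y * W0 y)" for y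
  proof (rule antisym)
    show "(SUP n. ennreal (indicator {a<..b} y * w n y)) \<le> ennreal (indicator {a<..b} y * W0 y)"
      by (intro SUP_least ennreal_leI mult_left_mono) (auto simp: w_def)
    obtain n :: nat where "W0 y \<le> real n" using real_arch_simple by blast
    then have "w n y = W0 y" by (simp add: w_def)
    then show "ennreal (indicator {a<..b} y * W0 y) \<le> (SUP n. ennreal (indicator {a<..b} y * w n y))"
      by (metis SUP_upper UNIV_I)
  qed
  have inc: "incseq (\<lambda>n y. ennreal (indicator {a<..b} y * w n y))"
    by (intro incseq_SucI le_funI ennreal_leI mult_left_mono) (auto simp: w_def)
  have "(\<integral>\<^sup>+y. ennreal (indicator {a<..b} y * W0 y) \<partial>lborel) = (SUP n. ennreal (I n))"
    unfolding SUP[symmetric] nn[symmetric]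
    by (rule nn_integral_monotone_convergence_SUP[OF inc]) measurable
  moreover have "(\<integral>\<^sup>+y. ennreal (indicator {a<..b} y * W0 y) \<partial>lborel) = \<infinity>"
  proof (rule ccontr)
    assume fin: "(\<integral>\<^sup>+y. ennreal (indicator {a<..b} y * W0 y) \<partial>lborel) \<noteq> \<infinity>"
    have "(\<integral>\<^sup>+y. ennreal (norm (indicator {a<..<b} y * W0 y)) \<partial>lborel) \<le> (\<integral>\<^sup>+y. ennreal (indicator {a<..b} y * W0 y) \<partial>lborel)"
      by (intro nn_integral_mono) (auto simp: W0_nonneg split: split_indicator)
    then have "(\<integral>\<^sup>+y. ennreal (norm (indicator {a<..<b} y * W0 y)) \<partial>lborel) < \<infinity>"
      using fin by (simp add: less_top[symmetric] top_unique) (metis top.not_eq_extremum top_unique)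
    then have "integrable lborel (\<lambda>y. indicator {a<..<b} y * W0 y)"
      by (intro integrableI_bounded) auto
    then have "set_integrable lborel {a<..<b} W"
      unfolding set_integrable_def
      by (rule Bochner_Integration.integrable_cong[THEN iffD1, rotated 2])
        (use ab in \<open>auto simp: W0_def split: split_indicator\<close>)
    moreover have "{a<..<b} \<noteq> {}" "{a<..<b} \<subseteq> {0<..<1}" using ab by auto
    ultimately show False using W_not_L1[OF open_greaterThanLessThan] by blast
  qed
  ultimately have inf: "(SUP n. ennreal (I n)) = \<infinity>" by simp
  have "\<forall>\<^sub>F n in sequentially. Z \<le> I n" for Z
  proof -
    have "ennreal Z < (SUP n. ennreal (I n))" unfolding inf by simp
    then obtain m where "ennreal Z < ennreal (I m)" by (auto simp: less_SUP_iff)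
    then have "Z \<le> I m" by (metis ennreal_leI leD linear)
    then have "Z \<le> I n" if "m \<le> n" for n using mono[OF that] by linarith
    then show ?thesis by (auto simp: eventually_sequentially)
  qed
  then show ?thesis by (simp add: filterlim_at_top I_def)
qed

text \<open>The second term keeps \<open>M\<^sup>\<bottom>\<close> at time 0 and annihilates it at all later times.\<close>

definition T_lim :: "real \<Rightarrow> 'g L0 \<Rightarrow> 'g L0" where
  "T_lim t F = mult_op (\<lambda>\<omega>. exp (- t * V \<omega>)) (projM p F) + (if t = 0 then F - projM p F else 0)"

lemma exp_V_meas: "(\<lambda>\<omega>. exp (- t * V \<omega>)) \<in> borel_measurable mu"
  using V_meas by measurable

lemma exp_V_bounded:
  assumes "0 \<le> t" "\<omega> \<in> Omega"
  shows "\<bar>exp (- t * V \<omega>)\<bar> \<le> 1"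
  using assms W0_nonneg by (simp add: V_eq)

lemma mult_exp_V:
  assumes t: "0 \<le> t" and F: "F \<in> bandM p"
  shows "mult_op (\<lambda>\<omega>. exp (- t * V \<omega>)) F \<in> bandM p"
    "Lp_norm p (mult_op (\<lambda>\<omega>. exp (- t * V \<omega>)) F) \<le> Lp_norm p F"
proof -
  have "AE \<omega> in mu. \<bar>exp (- t * V \<omega>)\<bar> \<le> 1" by (rule AE_I2, rule exp_V_bounded[OF t]) simp
  from mult_bounded_Lp[OF p exp_V_meas this _ bands_subset(1)[OF F]] F
  show "mult_op (\<lambda>\<omega>. exp (- t * V \<omega>)) F \<in> bandM p"
    "Lp_norm p (mult_op (\<lambda>\<omega>. exp (- t * V \<omega>)) F) \<le> Lp_norm p F" by (simp_all add: mult_op_def)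
qed

lemma bounded_op_T_lim:
  assumes t: "0 \<le> t"
  shows "bounded_op (Lp p) (Lp_norm p) (T_lim t)"
proof -
  interpret normed_subspace "Lp p :: 'g L0 set" "Lp_norm p" by (rule normed_subspace_Lp[OF p])
  have mX: "mult_op (\<lambda>\<omega>. exp (- t * V \<omega>)) (projM p F) \<in> Lp p" if "F \<in> Lp p" for F
    by (intro bands_subset(1) mult_exp_V t projM p that)
  have NX: "F - projM p F \<in> Lp p" if "F \<in> Lp p" for F :: "'g L0"
    by (intro bands_subset(2) projM p that)
  show ?thesis
    unfolding bounded_op_def
  proof (intro conjI ballI allI)
    fix F H :: "'g L0" and s :: real assume F: "F \<in> Lp p"
    show "T_lim t F \<in> Lp p" unfolding T_lim_def using mX[OF F] NX[OF F] by (intro X_add) auto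
    show "T_lim t (s *\<^sub>R F) = s *\<^sub>R T_lim t F"
      using F by (simp add: T_lim_def mult_op_def projM_scaleR[OF p] times_scaleR_L0 algebra_simps)
    assume "H \<in> Lp p"
    then show "T_lim t (F + H) = T_lim t F + T_lim t H"
      using F by (simp add: T_lim_def mult_op_def projM_add[OF p] algebra_simps)
  next
    show "\<exists>C. \<forall>F\<in>Lp p. Lp_norm p (T_lim t F) \<le> C * Lp_norm p F"
    proof (intro exI ballI)
      fix F :: "'g L0" assume F: "F \<in> Lp p"
      have "Lp_norm p (T_lim t F) \<le> Lp_norm p (mult_op (\<lambda>\<omega>. exp (- t * V \<omega>)) (projM p F)) +
          Lp_norm p (if t = 0 then F - projM p F else 0)"
        unfolding T_lim_def using mX[OF F] NX[OF F] by (intro N_triangle) auto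
      also have "\<dots> \<le> Lp_norm p F + Lp_norm p F"
        using mult_exp_V(2)[OF t projM(1)[OF p F]] projM(3,4)[OF p F] Lp_norm_nonneg'[of p F]
        by (intro add_mono) auto
      finally show "Lp_norm p (T_lim t F) \<le> 2 * Lp_norm p F" by simp
    qed
  qed
qed

lemma K_tendsto:
  assumes t: "0 \<le> t" and F: "F \<in> bandM p"
  shows "(\<lambda>n. Lp_norm p (bounded_potential.K (w n) t F - mult_op (\<lambda>\<omega>. exp (- t * V \<omega>)) F)) \<longlonglongrightarrow> 0"
  unfolding bounded_potential.K_def[OF bounded_potential_w] mult_op_def
proof (rule Lp_mult_tendsto[OF p bands_subset(1)[OF F]])
  show "(\<lambda>\<omega>. exp (- t * w n (fst \<omega>))) \<in> borel_measurable mu" for n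
    by (rule bounded_potential.K_meas[OF bounded_potential_w])
  show "(\<lambda>\<omega>. exp (- t * V \<omega>)) \<in> borel_measurable mu" by (rule exp_V_meas)
  show "\<bar>exp (- t * w n (fst \<omega>))\<bar> \<le> 1" for n and \<omega> :: "real \<times> 'g"
    using t W0_nonneg by (simp add: w_def)
  fix \<omega> :: "real \<times> 'g" assume \<omega>: "\<omega> \<in> Omega"
  obtain m :: nat where m: "W0 (fst \<omega>) \<le> real m" using real_arch_simple by blast
  have "w n (fst \<omega>) = V \<omega>" if "n \<ge> m" for n
  proof -
    have "W0 (fst \<omega>) \<le> real n" using m that by linarith
    then show ?thesis using V_eq[OF \<omega>] by (simp add: w_def)
  qed
  then have "\<forall>\<^sub>F n in sequentially. exp (- t * w n (fst \<omega>)) = exp (- t * V \<omega>)"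
    by (auto simp: eventually_sequentially intro!: exI[of _ m])
  then show "(\<lambda>n. exp (- t * w n (fst \<omega>))) \<longlonglongrightarrow> exp (- t * V \<omega>)" by (rule tendsto_eventually)
qed

text \<open>A particle that arrives at \<open>x\<close> has crossed the interval \<open>(x - t, x)\<close>, over which the integral of
\<open>min(W, n)\<close> tends to infinity.\<close>

lemma R_tendsto:
  fixes F :: "'g L0"
  assumes t: "0 < t" and F: "F \<in> bandN p"
  shows "(\<lambda>n. Lp_norm p (bounded_potential.R (w n) t F)) \<longlonglongrightarrow> 0"
proof -
  obtain f where f: "f \<in> borel_measurable mu" and Ff: "F = cls f" by (rule L0_cases)
  note sm = shift_fun_measurable[OF f, of t]
  let ?r = "\<lambda>n. bounded_potential.R_fun (w n) t f"
  have rm: "?r n \<in> borel_measurable mu" for n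
    by (rule bounded_potential.R_fun_meas[OF bounded_potential_w f])
  have r: "?r n \<omega> = exp (bounded_potential.G (w n) (fst \<omega> - t) - bounded_potential.G (w n) (fst \<omega>)) * shift_fun t f \<omega>" for n \<omega>
    by (rule bounded_potential.R_fun_def[OF bounded_potential_w])
  have "(\<lambda>n. Lp_norm p (cls (?r n) - cls (\<lambda>_. 0))) \<longlonglongrightarrow> 0"
  proof (rule Lp_dominated_convergence[OF p, where w = "\<lambda>\<omega>. \<bar>shift_fun t f \<omega>\<bar>"])
    show "(\<lambda>\<omega>. \<bar>shift_fun t f \<omega>\<bar>) \<in> borel_measurable mu" using sm by measurable
    have "cls (shift_fun t f) \<in> Lp p"
      using Lp_norm_shift_le(1)[OF p bands_subset(2)[OF F], of t] f by (simp add: Ff cls_shift)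
    then show "cls (\<lambda>\<omega>. \<bar>shift_fun t f \<omega>\<bar>) \<in> Lp p" using sm by (simp add: cls_in_Lp)
    show "AE \<omega> in mu. \<bar>?r n \<omega>\<bar> \<le> \<bar>shift_fun t f \<omega>\<bar>" for n
    proof (rule AE_I2)
      fix \<omega> :: "real \<times> 'g"
      have "bounded_potential.G (w n) (fst \<omega> - t) \<le> bounded_potential.G (w n) (fst \<omega>)"
        using t by (intro monoD[OF bounded_potential.G_mono[OF bounded_potential_w]]) simp
      then show "\<bar>?r n \<omega>\<bar> \<le> \<bar>shift_fun t f \<omega>\<bar>"
        unfolding r by (simp add: abs_mult mult_left_le_one_le)
    qed
    show "AE \<omega> in mu. (\<lambda>n. ?r n \<omega>) \<longlonglongrightarrow> 0"
    proof (rule AE_I2)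
      fix \<omega> :: "real \<times> 'g" assume "\<omega> \<in> space mu"
      then obtain x \<gamma> where \<omega>: "\<omega> = (x, \<gamma>)" "0 < x" "x < 1" by (auto simp: Omega_def)
      show "(\<lambda>n. ?r n \<omega>) \<longlonglongrightarrow> 0"
      proof (cases "0 < x - t")
        case True
        have eq: "bounded_potential.G (w n) x - bounded_potential.G (w n) (x - t) = (LINT y|lborel. indicator {x - t<..x} y * w n y)" for n
          using True t by (intro bounded_potential.G_diff[OF bounded_potential_w]) auto
        have "filterlim (\<lambda>n. bounded_potential.G (w n) x - bounded_potential.G (w n) (x - t)) at_top sequentially"
          unfolding eq using True t \<omega> by (intro integral_w_diverges) auto
        then have "filterlim (\<lambda>n. - (bounded_potential.G (w n) x - bounded_potential.G (w n) (x - t))) at_bot sequentially"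
          by (simp only: filterlim_uminus_at_top)
        then have "(\<lambda>n. exp (- (bounded_potential.G (w n) x - bounded_potential.G (w n) (x - t)))) \<longlonglongrightarrow> 0"
          by (rule filterlim_compose[OF exp_at_bot])
        then have "(\<lambda>n. exp (- (bounded_potential.G (w n) x - bounded_potential.G (w n) (x - t))) * shift_fun t f \<omega>) \<longlonglongrightarrow> 0 * shift_fun t f \<omega>"
          by (intro tendsto_intros)
        then show ?thesis by (simp add: r \<omega>)
      next
        case False
        then have "shift_fun t f \<omega> = 0" by (simp add: \<omega> shift_fun_def)
        then show ?thesis by (simp add: r)
      qed
    qed
  qed (use rm in simp_all)
  then show ?thesis
    by (simp add: Ff bounded_potential.R_cls[OF bounded_potential_w f] flip: zero_L0_def)
qed

lemma strong_limit_perturbed: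
  assumes t: "0 \<le> t"
  shows "strong_limit (Lp p) (Lp_norm p) (\<lambda>n. perturbed_semigroup p (T_sg p) V n t) sequentially (T_lim t)"
  unfolding strong_limit_def
proof (intro conjI ballI bounded_op_T_lim t)
  interpret normed_subspace "Lp p :: 'g L0 set" "Lp_norm p" by (rule normed_subspace_Lp[OF p])
  fix F :: "'g L0" assume F: "F \<in> Lp p"
  let ?A = "projM p F" and ?B = "F - projM p F"
  have AB: "?A \<in> bandM p" "?B \<in> bandN p" by (rule projM[OF p F])+
  let ?a = "\<lambda>n. bounded_potential.K (w n) t ?A - mult_op (\<lambda>\<omega>. exp (- t * V \<omega>)) ?A"
  let ?b = "\<lambda>n. bounded_potential.R (w n) t ?B - (if t = 0 then ?B else 0)"
  have bN: "?b n \<in> bandN p" for n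
    using bounded_potential.R_contraction(1)[OF bounded_potential_w p t AB(2), of n] AB(2) bands_closed(5)[OF p]
    by (intro bands_closed(7)[OF p]) auto
  have aM: "?a n \<in> bandM p" for n
    by (intro bands_closed(3)[OF p] bounded_potential.K_bounded[OF bounded_potential_w] mult_exp_V p t AB)
  have "(\<lambda>n. Lp_norm p (?a n + ?b n)) \<longlonglongrightarrow> 0"
  proof (rule N_tendsto_0_add)
    show "(\<lambda>n. Lp_norm p (?a n)) \<longlonglongrightarrow> 0" by (rule K_tendsto[OF t AB(1)])
    show "(\<lambda>n. Lp_norm p (?b n)) \<longlonglongrightarrow> 0"
    proof (cases "t = 0")
      case True
      have "bounded_potential.R (w n) 0 ?B = ?B" for n
      proof -
        have "C0_semigroup (bandN p :: 'g L0 set) (Lp_norm p) (bounded_potential.R (w n))"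
          by (rule bounded_potential.C0_semigroup_R[OF bounded_potential_w p])
        then show ?thesis using AB(2) by (simp add: C0_semigroup_def)
      qed
      then show ?thesis using True by simp
    next
      case False
      then show ?thesis using R_tendsto[OF _ AB(2)] t by simp
    qed
    show "\<forall>\<^sub>F n in sequentially. ?a n \<in> Lp p \<and> ?b n \<in> Lp p"
      using aM bN by (intro always_eventually allI conjI bands_subset)
  qed
  moreover have "perturbed_semigroup p (T_sg p) V n t F - T_lim t F = ?a n + ?b n" for n
    by (simp add: perturbed_semigroup_eq[OF t F] bounded_potential.S_def[OF bounded_potential_w] T_lim_def)
  ultimately show "(\<lambda>n. Lp_norm p (perturbed_semigroup p (T_sg p) V n t F - T_lim t F)) \<longlonglongrightarrow> 0" by simp
qed

theorem absorption_semigroup_eq: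
  assumes t: "0 \<le> t" and F: "F \<in> Lp p"
  shows "absorption_semigroup p (T_sg p) V t F = T_lim t F"
proof -
  interpret normed_subspace "Lp p :: 'g L0 set" "Lp_norm p" by (rule normed_subspace_Lp[OF p])
  have ex: "\<exists>P. strong_limit (Lp p) (Lp_norm p) (\<lambda>n. perturbed_semigroup p (T_sg p) V n t) sequentially P"
    by (rule exI[of _ "T_lim t"]) (rule strong_limit_perturbed[OF t])
  have "strong_limit (Lp p) (Lp_norm p) (\<lambda>n. perturbed_semigroup p (T_sg p) V n t) sequentially
      (absorption_semigroup p (T_sg p) V t)"
    unfolding absorption_semigroup_def by (rule someI_ex[OF ex])
  then show ?thesis
  proof (rule strong_limit_unique[OF _ strong_limit_perturbed[OF t] _ F])
    have "bounded_potential.S (w n) p t F \<in> Lp p" for n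
    proof -
      have "C0_semigroup (Lp p :: 'g L0 set) (Lp_norm p) (bounded_potential.S (w n) p)"
        by (rule bounded_potential.C0_semigroup_S[OF bounded_potential_w p])
      then show ?thesis using t F by (simp add: C0_semigroup_def bounded_op_def)
    qed
    then show "\<forall>\<^sub>F n in sequentially. perturbed_semigroup p (T_sg p) V n t F \<in> Lp p"
      by (simp add: perturbed_semigroup_eq[OF t F])
  qed simp
qed

lemma absorption_semigroup_bandM:
  assumes t: "0 \<le> t" and F: "F \<in> bandM p"
  shows "absorption_semigroup p (T_sg p) V t F = mult_op (\<lambda>\<omega>. exp (- t * V \<omega>)) F"
  by (simp add: absorption_semigroup_eq[OF t bands_subset(1)[OF F]] T_lim_def projM_id[OF p F])

lemma absorption_semigroup_bandN:
  assumes t: "0 < t" and F: "F \<in> bandN p"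
  shows "absorption_semigroup p (T_sg p) V t F = 0"
  using t absorption_semigroup_eq[OF _ bands_subset(2)[OF F], of t]
  by (simp add: T_lim_def projM_0[OF p F] mult_op_def)

theorem strong_limit_at_0:
  "strong_limit (Lp p) (Lp_norm p) (absorption_semigroup p (T_sg p) V) (at_right 0) (projM p)"
  unfolding strong_limit_def
proof (intro conjI ballI)
  show "bounded_op (Lp p) (Lp_norm p) (projM p)"
    unfolding bounded_op_def
    by (auto intro!: exI[of _ 1] bands_subset(1) simp: projM[OF p] projM_add[OF p] projM_scaleR[OF p])
  fix F :: "'g L0" assume F: "F \<in> Lp p"
  let ?A = "projM p F"
  have AB: "?A \<in> bandM p" by (rule projM[OF p F])
  have "((\<lambda>t. Lp_norm p (mult_op (\<lambda>\<omega>. exp (- t * V \<omega>)) ?A - ?A)) \<longlongrightarrow> 0) (at_right 0)"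
  proof (rule tendsto_at_right_sequentially[of 0 1])
    fix t :: "nat \<Rightarrow> real" assume t: "\<And>n. 0 < t n" "t \<longlonglongrightarrow> 0"
    have "(\<lambda>n. Lp_norm p (cls (\<lambda>\<omega>. exp (- t n * V \<omega>)) * ?A - cls (\<lambda>_. 1) * ?A)) \<longlonglongrightarrow> 0"
    proof (rule Lp_mult_tendsto[OF p bands_subset(1)[OF AB]])
      show "(\<lambda>\<omega>. exp (- t n * V \<omega>)) \<in> borel_measurable mu" for n by (rule exp_V_meas)
      show "\<bar>exp (- t n * V \<omega>)\<bar> \<le> 1" if "\<omega> \<in> Omega" for n \<omega>
        by (intro exp_V_bounded that less_imp_le t)
      have "(\<lambda>n. exp (- t n * V \<omega>)) \<longlonglongrightarrow> exp (- 0 * V \<omega>)" for \<omega> by (intro tendsto_intros t)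
      then show "(\<lambda>n. exp (- t n * V \<omega>)) \<longlonglongrightarrow> 1" for \<omega> by simp
    qed simp
    then show "(\<lambda>n. Lp_norm p (mult_op (\<lambda>\<omega>. exp (- t n * V \<omega>)) ?A - ?A)) \<longlonglongrightarrow> 0"
      by (simp add: mult_op_def mult_one)
  qed simp
  moreover have "\<forall>\<^sub>F t in at_right 0. Lp_norm p (mult_op (\<lambda>\<omega>. exp (- t * V \<omega>)) ?A - ?A) =
      Lp_norm p (absorption_semigroup p (T_sg p) V t F - ?A)"
    using eventually_at_right_less[of 0]
    by eventually_elim (simp add: absorption_semigroup_eq[OF _ F] T_lim_def)
  ultimately show "((\<lambda>t. Lp_norm p (absorption_semigroup p (T_sg p) V t F - ?A)) \<longlongrightarrow> 0) (at_right 0)"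
    by (rule Lim_transform_eventually)
qed

end

theorem proposition3p2:
  fixes p :: real and W :: "real \<Rightarrow> real" and V :: "real \<times> 'g \<Rightarrow> real"
  assumes p: "1 \<le> p"
    and Gamma: "(UNIV :: real set) \<prec> (UNIV :: 'g set)"
    and W_meas: "W \<in> borel_measurable (restrict_space borel {0<..<1})"
    and W_nonneg: "\<And>x. x \<in> {0<..<1} \<Longrightarrow> 0 \<le> W x"
    and W_not_L1: "\<And>U. open U \<Longrightarrow> U \<noteq> {} \<Longrightarrow> U \<subseteq> {0<..<1} \<Longrightarrow> \<not> set_integrable lborel U W"
    and V: "\<And>x \<gamma>. x \<in> {0<..<1} \<Longrightarrow> V (x, \<gamma>) = W x"
  shows "(\<forall>t\<ge>0. \<forall>f\<in>bandM p.
            absorption_semigroup p (T_sg p) V t f = mult_op (\<lambda>\<omega>. exp (- t * V \<omega>)) f) \<and>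
         (\<forall>t>0. \<forall>f\<in>disj_compl (Lp p) (bandM p).
            absorption_semigroup p (T_sg p) V t f = 0) \<and>
         strong_limit (Lp p) (Lp_norm p) (absorption_semigroup p (T_sg p) V) (at_right 0)
           (band_proj (Lp p) (bandM p))"
proof -
  interpret absorption p W V
    by standard (fact p W_meas W_nonneg W_not_L1 V)+
  show ?thesis
    unfolding disj_compl_bandM[OF p]
    using absorption_semigroup_bandM absorption_semigroup_bandN strong_limit_at_0 by blast
qed

end
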